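(* Let $\Gamma$ be a finitely generated discrete group with polynomial growth, with finite symmetric generating set $S$, and assume that the action of $\mathbb Q(\Gamma)=\mathbb Q(\Gamma,S)$ on $C^*_r(\Gamma)$ has full spectrum. Then the dual discrete quantum group of $\mathbb Q(\Gamma)$ also has the polynomial growth property.
   Context: A compact quantum group (CQG) is a unital $C^*$-algebra $\mathcal Q$ with a coassociative unital $*$-homomorphism $\Delta:\mathcal Q\to\mathcal Q\hat\otimes\mathcal Q$ ($\hat\otimes$ the spatial tensor product) such that the linear spans of $\Delta(\mathcal Q)(1\otimes\mathcal Q)$ and $\Delta(\mathcal Q)(\mathcal Q\otimes 1)$ are norm-dense. A CQG morphism is a unital $*$-homomorphism intertwining the coproducts. An action of $\mathcal Q$ on a unital $C^*$-algebra $B$ is a unital $*$-homomorphism $\alpha:B\to B\hat\otimes\mathcal Q$ with $(\alpha\otimes id)\alpha=(id\otimes\Delta)\alpha$ and with the linear span of $\alpha(B)(1\otimes\mathcal Q)$ dense in $B\hat\otimes\mathcal Q$. Let $\Gamma$ be a discrete group with finite symmetric generating set $S$ ($a\in S\Rightarrow a^{-1}\in S$, elements of order 2 listed once), with word length $l$, canonical unitaries $\lambda_g\in C^*_r(\Gamma)$ and canonical trace $\tau$. $\mathbb Q(\Gamma,S)$ denotes the quantum isometry group $QISO^+(\mathbb C\Gamma,\ell^2(\Gamma),D_\Gamma)$ of the spectral triple with $D_\Gamma\delta_g=l(g)\delta_g$. Equivalently it is the universal object in the category of pairs $(\mathcal Q,\alpha)$ where $\mathcal Q$ is a CQG and $\alpha$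 is a $\tau$-preserving action of $\mathcal Q$ on $C^*_r(\Gamma)$ mapping $\mathrm{span}\{\lambda_g:l(g)=r\}$ into $\mathrm{span}\{\lambda_g:l(g)=r\}\otimes\mathcal Q$ for every $r\ge0$ (morphisms are CQG morphisms intertwining the actions; universality means that for every object there is a unique morphism from $\mathbb Q(\Gamma,S)$ to it). Full spectrum: for an action $\alpha$ of $\mathcal Q$ on $B$ and an irreducible unitary representation $\pi$ of $\mathcal Q$, the spectral subspace $B_\pi$ is the image of the canonical spectral projection $P_\pi$ on $B$, i.e. the span of all finite-dimensional subspaces $V\subseteq B$ with $\alpha(V)\subseteq V\otimes\mathcal Q$ on which $\alpha|_V$ is equivalent to $\pi$. The action has full spectrum if $B_\pi\ne0$ for every irreducible $\pi$. Polynomial growth: $\Gamma$ has polynomial growth if the number of elements of word length $\le n$ is bounded by a polynomial in $n$. The dual discrete quantum group of a CQG $\mathcal Q$ has polynomial growth if there is a central length function $\ell$ on the set $\hat{\mathcal Q}$ of equivalence classes of irreducible unitary representations (a function $\ell:\hat{\mathcal Q}\to[0,\infty)$ with $\ell(1)=0$, $\ell(\bar\pi)=\ell(\pi)$, and $\ell(\rho)\le\ell(\pi)+\ell(\sigma)$ whenever $\rho\subset\pi\otimes\sigma$) and a polynomial $P$ such that $\sum_{\pi:\,\ell(\pi)\le n}d_\pi^2\le P(n)$ for all $n$, where $d_\pi=\dim\pi$. *)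

theory Defs
  imports
    "HOL-Analysis.Analysis"
    "HOL-Library.Function_Algebras"
    "HOL-Computational_Algebra.Polynomial"
begin

section \<open>Operators on \<open>\<ell>\<^sup>2\<close> spaces and concrete C*-algebras\<close>

text \<open>
  An operator on \<open>\<ell>\<^sup>2('x)\<close> is represented by its matrix \<open>T x y = \<langle>\<delta>\<^sub>x, T \<delta>\<^sub>y\<rangle>\<close> with respect to the
  canonical orthonormal basis. Addition, zero and finite sums of matrices are the pointwise ones of
  \<^theory>\<open>HOL-Library.Function_Algebras\<close>; the pointwise product and unit of that theory are not used.
\<close>

type_synonym 'x opr = "'x \<Rightarrow> 'x \<Rightarrow> complex"

definition opr_scale :: "complex \<Rightarrow> 'x opr \<Rightarrow> 'x opr" where
  "opr_scale c T = (\<lambda>x y. c * T x y)"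

interpretation opr: vector_space opr_scale
  by unfold_locales (simp_all add: opr_scale_def fun_eq_iff algebra_simps)

text \<open>\<open>opr_norm_le T C\<close>: the matrix defines an operator of norm at most \<open>C\<close>, tested on finitely
  supported vectors \<open>u\<close> and \<open>v\<close>.\<close>

definition opr_norm_le :: "'x opr \<Rightarrow> real \<Rightarrow> bool" where
  "opr_norm_le T C \<longleftrightarrow> (\<forall>F G u v. finite F \<longrightarrow> finite G \<longrightarrow>
     cmod (\<Sum>x\<in>F. \<Sum>y\<in>G. cnj (u x) * T x y * v y)
       \<le> C * L2_set (\<lambda>x. cmod (u x)) F * L2_set (\<lambda>y. cmod (v y)) G)"

definition bounded_oprs :: "'x opr set" where
  "bounded_oprs = {T. \<exists>C. opr_norm_le T C}"

definition opr_closure :: "'x opr set \<Rightarrow> 'x opr set" where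
  "opr_closure M = {T. \<forall>e>0. \<exists>a\<in>M. opr_norm_le (T - a) e}"

definition opr_one :: "'x opr" where
  "opr_one = (\<lambda>x y. if x = y then 1 else 0)"

text \<open>For bounded operators the series below converges absolutely, by Cauchy--Schwarz.\<close>

definition opr_mult :: "'x opr \<Rightarrow> 'x opr \<Rightarrow> 'x opr" where
  "opr_mult S T = (\<lambda>x z. \<Sum>\<^sub>\<infinity>y. S x y * T y z)"

definition opr_adj :: "'x opr \<Rightarrow> 'x opr" where
  "opr_adj T = (\<lambda>x y. cnj (T y x))"

text \<open>The tensor product of operators acts on \<open>\<ell>\<^sup>2('x) \<otimes> \<ell>\<^sup>2('y) = \<ell>\<^sup>2('x \<times> 'y)\<close>.\<close>

definition opr_tensor :: "'x opr \<Rightarrow> 'y opr \<Rightarrow> ('x \<times> 'y) opr" where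
  "opr_tensor S T = (\<lambda>(x, y) (x', y'). S x x' * T y y')"

definition opr_assoc :: "(('x \<times> 'y) \<times> 'z) opr \<Rightarrow> ('x \<times> 'y \<times> 'z) opr" where
  "opr_assoc T = (\<lambda>(x, y, z) (x', y', z'). T ((x, y), z) ((x', y'), z'))"

text \<open>Unital C*-algebras are taken in a faithful representation, i.e. as norm-closed unital
  *-subalgebras of the bounded operators on some \<open>\<ell>\<^sup>2('x)\<close>. By the Gelfand--Naimark theorem
  every unital C*-algebra arises in this way, and the spatial tensor product is then the norm closure
  of the algebraic tensor product on the tensor product Hilbert space.\<close>

definition cstar_algebra :: "'x opr set \<Rightarrow> bool" where
  "cstar_algebra A \<longleftrightarrow>
     A \<subseteq> bounded_oprs \<and> opr.subspace A \<and> opr_one \<in> A \<and>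
     (\<forall>a\<in>A. \<forall>b\<in>A. opr_mult a b \<in> A) \<and> (\<forall>a\<in>A. opr_adj a \<in> A) \<and>
     opr_closure A = A"

definition alg_tensor :: "'x opr set \<Rightarrow> 'y opr set \<Rightarrow> ('x \<times> 'y) opr set" where
  "alg_tensor A B = opr.span {opr_tensor a b | a b. a \<in> A \<and> b \<in> B}"

definition spatial_tensor :: "'x opr set \<Rightarrow> 'y opr set \<Rightarrow> ('x \<times> 'y) opr set" where
  "spatial_tensor A B = opr_closure (alg_tensor A B)"

definition star_hom :: "'x opr set \<Rightarrow> 'y opr set \<Rightarrow> ('x opr \<Rightarrow> 'y opr) \<Rightarrow> bool" where
  "star_hom A B f \<longleftrightarrow>
     (\<forall>a\<in>A. f a \<in> B) \<and> f opr_one = opr_one \<and>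
     (\<forall>a\<in>A. \<forall>b\<in>A. f (a + b) = f a + f b) \<and>
     (\<forall>c. \<forall>a\<in>A. f (opr_scale c a) = opr_scale c (f a)) \<and>
     (\<forall>a\<in>A. \<forall>b\<in>A. f (opr_mult a b) = opr_mult (f a) (f b)) \<and>
     (\<forall>a\<in>A. f (opr_adj a) = opr_adj (f a))"

text \<open>\<open>f \<otimes> g\<close> for unital *-homomorphisms \<open>f\<close> on \<open>A\<close> and \<open>g\<close> on \<open>B\<close>. It exists, and it is
  uniquely determined on \<open>spatial_tensor A B\<close> because *-homomorphisms are contractive.\<close>

definition tensor_hom ::
  "'x opr set \<Rightarrow> 'y opr set \<Rightarrow> ('x opr \<Rightarrow> 'v opr) \<Rightarrow> ('y opr \<Rightarrow> 'w opr)
    \<Rightarrow> ('x \<times> 'y) opr \<Rightarrow> ('v \<times> 'w) opr" where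
  "tensor_hom A B f g = (SOME h. star_hom (spatial_tensor A B) bounded_oprs h \<and>
     (\<forall>a\<in>A. \<forall>b\<in>B. h (opr_tensor a b) = opr_tensor (f a) (g b)))"

section \<open>Compact quantum groups and their actions\<close>

definition cqg :: "'q opr set \<Rightarrow> ('q opr \<Rightarrow> ('q \<times> 'q) opr) \<Rightarrow> bool" where
  "cqg Q \<Delta> \<longleftrightarrow>
     cstar_algebra Q \<and> star_hom Q (spatial_tensor Q Q) \<Delta> \<and>
     (\<forall>a\<in>Q. opr_assoc (tensor_hom Q Q \<Delta> id (\<Delta> a)) = tensor_hom Q Q id \<Delta> (\<Delta> a)) \<and>
     opr_closure (opr.span {opr_mult (\<Delta> a) (opr_tensor opr_one b) | a b. a \<in> Q \<and> b \<in> Q})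
       = spatial_tensor Q Q \<and>
     opr_closure (opr.span {opr_mult (\<Delta> a) (opr_tensor b opr_one) | a b. a \<in> Q \<and> b \<in> Q})
       = spatial_tensor Q Q"

definition cqg_morphism ::
  "'q opr set \<Rightarrow> ('q opr \<Rightarrow> ('q \<times> 'q) opr) \<Rightarrow> 'r opr set \<Rightarrow> ('r opr \<Rightarrow> ('r \<times> 'r) opr)
    \<Rightarrow> ('q opr \<Rightarrow> 'r opr) \<Rightarrow> bool" where
  "cqg_morphism Q \<Delta> Q' \<Delta>' \<phi> \<longleftrightarrow>
     star_hom Q Q' \<phi> \<and> (\<forall>a\<in>Q. \<Delta>' (\<phi> a) = tensor_hom Q Q \<phi> \<phi> (\<Delta> a))"

definition cqg_action ::
  "'q opr set \<Rightarrow> ('q opr \<Rightarrow> ('q \<times> 'q) opr) \<Rightarrow> 'b opr set \<Rightarrow> ('b opr \<Rightarrow> ('b \<times> 'q) opr) \<Rightarrow> bool" where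
  "cqg_action Q \<Delta> B \<alpha> \<longleftrightarrow>
     star_hom B (spatial_tensor B Q) \<alpha> \<and>
     (\<forall>b\<in>B. opr_assoc (tensor_hom B Q \<alpha> id (\<alpha> b)) = tensor_hom B Q id \<Delta> (\<alpha> b)) \<and>
     opr_closure (opr.span {opr_mult (\<alpha> b) (opr_tensor opr_one q) | b q. b \<in> B \<and> q \<in> Q})
       = spatial_tensor B Q"

section \<open>Finite-dimensional representations\<close>

text \<open>A representation on \<open>\<complex>\<^sup>I\<close>, \<open>I\<close> finite, is given by its matrix \<open>u\<close> of coefficients: the basis
  vector \<open>e\<^sub>j\<close> is sent to \<open>\<Sum>\<^sub>i e\<^sub>i \<otimes> u i j\<close>. Entries of \<open>u\<close> outside \<open>I \<times> I\<close> are irrelevant.\<close>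

definition unitary_rep ::
  "'q opr set \<Rightarrow> ('q opr \<Rightarrow> ('q \<times> 'q) opr) \<Rightarrow> 'i set \<Rightarrow> ('i \<Rightarrow> 'i \<Rightarrow> 'q opr) \<Rightarrow> bool" where
  "unitary_rep Q \<Delta> I u \<longleftrightarrow>
     finite I \<and>
     (\<forall>i\<in>I. \<forall>j\<in>I. u i j \<in> Q) \<and>
     (\<forall>i\<in>I. \<forall>j\<in>I. \<Delta> (u i j) = (\<Sum>k\<in>I. opr_tensor (u i k) (u k j))) \<and>
     (\<forall>i\<in>I. \<forall>j\<in>I. (\<Sum>k\<in>I. opr_mult (opr_adj (u k i)) (u k j)) = (if i = j then opr_one else 0)) \<and>
     (\<forall>i\<in>I. \<forall>j\<in>I. (\<Sum>k\<in>I. opr_mult (u i k) (opr_adj (u j k))) = (if i = j then opr_one else 0))"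

text \<open>\<open>T\<close> is the matrix of a linear map from \<open>\<complex>\<^sup>I\<close> to \<open>\<complex>\<^sup>J\<close>, and the condition is
  \<open>(T \<otimes> 1) u = v (T \<otimes> 1)\<close>.\<close>

definition intertwiner ::
  "'i set \<Rightarrow> ('i \<Rightarrow> 'i \<Rightarrow> 'q opr) \<Rightarrow> 'j set \<Rightarrow> ('j \<Rightarrow> 'j \<Rightarrow> 'q opr) \<Rightarrow> ('j \<Rightarrow> 'i \<Rightarrow> complex) \<Rightarrow> bool" where
  "intertwiner I u J v T \<longleftrightarrow>
     (\<forall>j\<in>J. \<forall>i\<in>I. (\<Sum>k\<in>I. opr_scale (T j k) (u k i)) = (\<Sum>l\<in>J. opr_scale (T l i) (v j l)))"

definition rep_equiv ::
  "'i set \<Rightarrow> ('i \<Rightarrow> 'i \<Rightarrow> 'q opr) \<Rightarrow> 'j set \<Rightarrow> ('j \<Rightarrow> 'j \<Rightarrow> 'q opr) \<Rightarrow> bool" where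
  "rep_equiv I u J v \<longleftrightarrow> (\<exists>T R. intertwiner I u J v T \<and>
     (\<forall>i\<in>I. \<forall>i'\<in>I. (\<Sum>j\<in>J. R i j * T j i') = (if i = i' then 1 else 0)) \<and>
     (\<forall>j\<in>J. \<forall>j'\<in>J. (\<Sum>i\<in>I. T j i * R i j') = (if j = j' then 1 else 0)))"

text \<open>Containment of unitary representations, via an isometric intertwiner.\<close>

definition subrep ::
  "'i set \<Rightarrow> ('i \<Rightarrow> 'i \<Rightarrow> 'q opr) \<Rightarrow> 'j set \<Rightarrow> ('j \<Rightarrow> 'j \<Rightarrow> 'q opr) \<Rightarrow> bool" where
  "subrep I u J v \<longleftrightarrow> (\<exists>T. intertwiner I u J v T \<and>
     (\<forall>i\<in>I. \<forall>i'\<in>I. (\<Sum>j\<in>J. cnj (T j i) * T j i') = (if i = i' then 1 else 0)))"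

definition rep_tensor ::
  "('i \<Rightarrow> 'i \<Rightarrow> 'q opr) \<Rightarrow> ('j \<Rightarrow> 'j \<Rightarrow> 'q opr) \<Rightarrow> 'i \<times> 'j \<Rightarrow> 'i \<times> 'j \<Rightarrow> 'q opr" where
  "rep_tensor u v = (\<lambda>(i, k) (j, l). opr_mult (u i j) (v k l))"

text \<open>The conjugate representation need not be unitary in this form, but it is equivalent to a
  unitary one.\<close>

definition rep_conj :: "('i \<Rightarrow> 'i \<Rightarrow> 'q opr) \<Rightarrow> 'i \<Rightarrow> 'i \<Rightarrow> 'q opr" where
  "rep_conj u = (\<lambda>i j. opr_adj (u i j))"

text \<open>\<open>p\<close> is the orthogonal projection onto an invariant subspace of \<open>\<complex>\<^sup>I\<close>, where invariance means
  \<open>u (p \<otimes> 1) = (p \<otimes> 1) u (p \<otimes> 1)\<close>.\<close>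

definition invariant_proj ::
  "'i set \<Rightarrow> ('i \<Rightarrow> 'i \<Rightarrow> 'q opr) \<Rightarrow> ('i \<Rightarrow> 'i \<Rightarrow> complex) \<Rightarrow> bool" where
  "invariant_proj I u p \<longleftrightarrow>
     (\<forall>i\<in>I. \<forall>j\<in>I. p i j = cnj (p j i)) \<and>
     (\<forall>i\<in>I. \<forall>j\<in>I. (\<Sum>k\<in>I. p i k * p k j) = p i j) \<and>
     (\<forall>i\<in>I. \<forall>j\<in>I. (\<Sum>l\<in>I. opr_scale (p l j) (u i l))
        = (\<Sum>k\<in>I. \<Sum>l\<in>I. opr_scale (p i k * p l j) (u k l)))"

definition irreducible_rep ::
  "'q opr set \<Rightarrow> ('q opr \<Rightarrow> ('q \<times> 'q) opr) \<Rightarrow> 'i set \<Rightarrow> ('i \<Rightarrow> 'i \<Rightarrow> 'q opr) \<Rightarrow> bool" where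
  "irreducible_rep Q \<Delta> I u \<longleftrightarrow>
     unitary_rep Q \<Delta> I u \<and> I \<noteq> {} \<and>
     (\<forall>p. invariant_proj I u p \<longrightarrow>
        (\<forall>i\<in>I. \<forall>j\<in>I. p i j = 0) \<or> (\<forall>i\<in>I. \<forall>j\<in>I. p i j = (if i = j then 1 else 0)))"

text \<open>Irreducible representations of a compact quantum group are finite-dimensional, so each of them
  is represented, up to equivalence, on some \<open>\<complex>\<^sup>n\<close>.\<close>

type_synonym 'q rep = "nat \<times> (nat \<Rightarrow> nat \<Rightarrow> 'q opr)"

definition irreps :: "'q opr set \<Rightarrow> ('q opr \<Rightarrow> ('q \<times> 'q) opr) \<Rightarrow> 'q rep set" where
  "irreps Q \<Delta> = {(n, u). irreducible_rep Q \<Delta> {..<n} u}"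

definition irrep_rel :: "'q opr set \<Rightarrow> ('q opr \<Rightarrow> ('q \<times> 'q) opr) \<Rightarrow> ('q rep \<times> 'q rep) set" where
  "irrep_rel Q \<Delta> = {((n, u), (m, v)). (n, u) \<in> irreps Q \<Delta> \<and> (m, v) \<in> irreps Q \<Delta> \<and>
     rep_equiv {..<n} u {..<m} v}"

definition irr_classes :: "'q opr set \<Rightarrow> ('q opr \<Rightarrow> ('q \<times> 'q) opr) \<Rightarrow> 'q rep set set" where
  "irr_classes Q \<Delta> = irreps Q \<Delta> // irrep_rel Q \<Delta>"

definition irr_class ::
  "'q opr set \<Rightarrow> ('q opr \<Rightarrow> ('q \<times> 'q) opr) \<Rightarrow> 'q rep \<Rightarrow> 'q rep set" where
  "irr_class Q \<Delta> \<pi> = irrep_rel Q \<Delta> `` {\<pi>}"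

definition class_dim :: "'q rep set \<Rightarrow> nat" where
  "class_dim c = fst (SOME \<pi>. \<pi> \<in> c)"

section \<open>Full spectrum\<close>

text \<open>The last two conditions say that \<open>V\<close> is invariant under \<open>\<alpha>\<close> and that \<open>v\<close>, the matrix of
  the restriction of \<open>\<alpha>\<close> to \<open>V\<close> in the basis \<open>e\<close>, is equivalent to \<open>u\<close>.\<close>

definition spectral_subspace ::
  "'q opr set \<Rightarrow> 'b opr set \<Rightarrow> ('b opr \<Rightarrow> ('b \<times> 'q) opr) \<Rightarrow> 'q rep \<Rightarrow> 'b opr set" where
  "spectral_subspace Q B \<alpha> = (\<lambda>(n, u). opr.span (\<Union>{V. V \<subseteq> B \<and>
     (\<exists>m e v. inj_on e {..<m} \<and> opr.independent (e ` {..<m}) \<and> V = opr.span (e ` {..<m}) \<and>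
        (\<forall>j<m::nat. (\<forall>i<m. v i j \<in> Q) \<and> \<alpha> (e j) = (\<Sum>i<m. opr_tensor (e i) (v i j))) \<and>
        rep_equiv {..<m} v {..<n} u)}))"

definition full_spectrum ::
  "'q opr set \<Rightarrow> ('q opr \<Rightarrow> ('q \<times> 'q) opr) \<Rightarrow> 'b opr set \<Rightarrow> ('b opr \<Rightarrow> ('b \<times> 'q) opr) \<Rightarrow> bool" where
  "full_spectrum Q \<Delta> B \<alpha> \<longleftrightarrow> (\<forall>\<pi>\<in>irreps Q \<Delta>. spectral_subspace Q B \<alpha> \<pi> \<noteq> {0})"

section \<open>Polynomial growth of the dual\<close>

definition central_length ::
  "'q opr set \<Rightarrow> ('q opr \<Rightarrow> ('q \<times> 'q) opr) \<Rightarrow> ('q rep set \<Rightarrow> real) \<Rightarrow> bool" where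
  "central_length Q \<Delta> len \<longleftrightarrow>
     (\<forall>c\<in>irr_classes Q \<Delta>. 0 \<le> len c) \<and>
     len (irr_class Q \<Delta> (1, \<lambda>_ _. opr_one)) = 0 \<and>
     (\<forall>(n, u)\<in>irreps Q \<Delta>. \<forall>(m, v)\<in>irreps Q \<Delta>.
        rep_equiv {..<m} v {..<n} (rep_conj u) \<longrightarrow>
        len (irr_class Q \<Delta> (m, v)) = len (irr_class Q \<Delta> (n, u))) \<and>
     (\<forall>(n, u)\<in>irreps Q \<Delta>. \<forall>(m, v)\<in>irreps Q \<Delta>. \<forall>(k, w)\<in>irreps Q \<Delta>.
        subrep {..<k} w ({..<n} \<times> {..<m}) (rep_tensor u v) \<longrightarrow>
        len (irr_class Q \<Delta> (k, w)) \<le> len (irr_class Q \<Delta> (n, u)) + len (irr_class Q \<Delta> (m, v)))"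

definition dual_polynomial_growth ::
  "'q opr set \<Rightarrow> ('q opr \<Rightarrow> ('q \<times> 'q) opr) \<Rightarrow> bool" where
  "dual_polynomial_growth Q \<Delta> \<longleftrightarrow>
     (\<exists>len (P :: real poly). central_length Q \<Delta> len \<and>
        (\<forall>n::nat. finite {c \<in> irr_classes Q \<Delta>. len c \<le> real n} \<and>
           (\<Sum>c | c \<in> irr_classes Q \<Delta> \<and> len c \<le> real n. (real (class_dim c))\<^sup>2) \<le> poly P (real n)))"

section \<open>The discrete group, its reduced C*-algebra and its quantum isometry group\<close>

text \<open>The group is a type of class \<^class>\<open>group_add\<close>, that is, an arbitrary, not
  necessarily commutative group in additive notation.\<close>

definition symmetric_generating_set :: "'g::group_add set \<Rightarrow> bool" where
  "symmetric_generating_set S \<longleftrightarrow>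
     (\<forall>a\<in>S. - a \<in> S) \<and> (\<forall>g. \<exists>ws. set ws \<subseteq> S \<and> sum_list ws = g)"

definition word_length :: "'g::group_add set \<Rightarrow> 'g \<Rightarrow> nat" where
  "word_length S g = (LEAST n. \<exists>ws. length ws = n \<and> set ws \<subseteq> S \<and> sum_list ws = g)"

definition group_polynomial_growth :: "'g::group_add set \<Rightarrow> bool" where
  "group_polynomial_growth S \<longleftrightarrow>
     (\<exists>P :: real poly. \<forall>n. finite {g. word_length S g \<le> n} \<and>
        real (card {g. word_length S g \<le> n}) \<le> poly P (real n))"

definition lam :: "'g::group_add \<Rightarrow> 'g opr" where
  "lam g = (\<lambda>x y. if x = g + y then 1 else 0)"

definition reduced_group_algebra :: "'g::group_add opr set" where
  "reduced_group_algebra = opr_closure (opr.span (range lam))"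

definition canonical_trace :: "'g::group_add opr \<Rightarrow> complex" where
  "canonical_trace T = T 0 0"

text \<open>\<open>\<tau> \<otimes> id\<close> for the trace \<open>\<tau> T = \<langle>\<delta>\<^sub>0, T \<delta>\<^sub>0\<rangle>\<close> above.\<close>

definition trace_slice :: "('g::group_add \<times> 'q) opr \<Rightarrow> 'q opr" where
  "trace_slice T = (\<lambda>y y'. T (0, y) (0, y'))"

definition length_sphere_span :: "'g::group_add set \<Rightarrow> nat \<Rightarrow> 'g opr set" where
  "length_sphere_span S r = opr.span (lam ` {g. word_length S g = r})"

definition qiso_object ::
  "'g::group_add set \<Rightarrow> 'q opr set \<Rightarrow> ('q opr \<Rightarrow> ('q \<times> 'q) opr) \<Rightarrow> ('g opr \<Rightarrow> ('g \<times> 'q) opr) \<Rightarrow> bool"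
  where
  "qiso_object S Q \<Delta> \<alpha> \<longleftrightarrow>
     cqg Q \<Delta> \<and> cqg_action Q \<Delta> reduced_group_algebra \<alpha> \<and>
     (\<forall>b\<in>reduced_group_algebra. trace_slice (\<alpha> b) = opr_scale (canonical_trace b) opr_one) \<and>
     (\<forall>r. \<forall>b\<in>length_sphere_span S r. \<alpha> b \<in> alg_tensor (length_sphere_span S r) Q)"

definition qiso_morphism ::
  "'q opr set \<Rightarrow> ('q opr \<Rightarrow> ('q \<times> 'q) opr) \<Rightarrow> ('g::group_add opr \<Rightarrow> ('g \<times> 'q) opr) \<Rightarrow>
   'r opr set \<Rightarrow> ('r opr \<Rightarrow> ('r \<times> 'r) opr) \<Rightarrow> ('g opr \<Rightarrow> ('g \<times> 'r) opr) \<Rightarrow>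
   ('q opr \<Rightarrow> 'r opr) \<Rightarrow> bool" where
  "qiso_morphism Q \<Delta> \<alpha> Q' \<Delta>' \<alpha>' \<phi> \<longleftrightarrow>
     cqg_morphism Q \<Delta> Q' \<Delta>' \<phi> \<and>
     (\<forall>b\<in>reduced_group_algebra. tensor_hom reduced_group_algebra Q id \<phi> (\<alpha> b) = \<alpha>' b)"

text \<open>The universal object of the category, i.e. \<open>\<rat>(\<Gamma>, S)\<close> with its action. HOL cannot quantify over
  all Hilbert spaces, so the test objects live on the same \<open>\<ell>\<^sup>2('q)\<close> as \<open>Q\<close>. For infinite \<open>'q\<close>
  (and finitely generated \<open>\<Gamma>\<close>) this loses nothing: every separable unital C*-algebra has a faithful
  unital representation on \<open>\<ell>\<^sup>2('q)\<close>. The coefficients of the action of an arbitrary object generate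
  a separable subobject, and a universal object is generated by the coefficients of its action. So
  universality against the objects on \<open>\<ell>\<^sup>2('q)\<close> is universality against all objects.
  Morphisms are compared on \<open>Q\<close>, their values elsewhere being irrelevant.\<close>

definition is_QISO ::
  "'g::group_add set \<Rightarrow> 'q opr set \<Rightarrow> ('q opr \<Rightarrow> ('q \<times> 'q) opr) \<Rightarrow> ('g opr \<Rightarrow> ('g \<times> 'q) opr) \<Rightarrow> bool"
  where
  "is_QISO S Q \<Delta> \<alpha> \<longleftrightarrow>
     qiso_object S Q \<Delta> \<alpha> \<and>
     (\<forall>(Q' :: 'q opr set) \<Delta>' \<alpha>'. qiso_object S Q' \<Delta>' \<alpha>' \<longrightarrow>
        (\<exists>\<phi>. qiso_morphism Q \<Delta> \<alpha> Q' \<Delta>' \<alpha>' \<phi> \<and>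
           (\<forall>\<psi>. qiso_morphism Q \<Delta> \<alpha> Q' \<Delta>' \<alpha>' \<psi> \<longrightarrow> (\<forall>a\<in>Q. \<psi> a = \<phi> a))))"

end

theory Submission
  imports Defs
begin

text \<open>
  The action of \<open>\<rat>(\<Gamma>, S)\<close> has coefficients \<open>q\<^bsub>h,g\<^esub>\<close> with
  \<open>\<alpha>(\<lambda>\<^sub>g) = \<Sum>\<^sub>h \<lambda>\<^sub>h \<otimes> q\<^bsub>h,g\<^esub>\<close>, where \<open>h\<close> runs over the elements of the same length as \<open>g\<close>. By full
  spectrum every irreducible representation \<open>\<pi>\<close> occurs in the reduced group algebra. Its Fourier
  coefficients give a nonzero intertwiner from \<open>\<pi>\<close> into the span of some sphere of \<open>\<Gamma>\<close>
  (\<open>full_spectrum_intertwiner\<close>).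

  The group algebra, acting on itself by its comultiplication \<open>\<lambda>\<^sub>g \<mapsto> \<lambda>\<^sub>g \<otimes> \<lambda>\<^sub>g\<close>, is an object of the category.
  Universality therefore provides a morphism \<open>\<phi>\<close> from \<open>\<rat>(\<Gamma>, S)\<close> to it with
  \<open>\<phi>(q\<^bsub>h,g\<^esub>) = \<delta>\<^bsub>h,g\<^esub> \<lambda>\<^sub>g\<close> (\<open>qiso_morphism_coeff\<close>). This is the restriction to the dual of \<open>\<Gamma>\<close>, and it
  turns \<open>\<pi>\<close> into a sum of group elements. If \<open>\<pi>\<close> occurs in the sphere of radius \<open>r\<close>, all of them have
  length exactly \<open>r\<close> (\<open>irrep_supported_on_sphere\<close>). Hence \<open>\<pi>\<close> occurs in one sphere only, and its radius is
  the length of \<open>\<pi>\<close>. It is a central length function, because restriction turns conjugates into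
  inverses and constituents of tensor products into products of group elements.

  The irreducible representations of length at most \<open>n\<close> all occur in the span of the ball of radius
  \<open>n\<close>. As they are simple and pairwise inequivalent, their images are linearly independent
  (\<open>inequivalent_irreducibles_independent\<close>), so the sum of their dimensions is at most the number of
  elements of the ball, and the sum of the squares is at most the square of this number.

  The analytic work is about tensor products of *-homomorphisms, which are given by a choice: for each
  one in use it must be shown that it exists and that the elementary tensors determine it. Uniqueness
  holds because *-homomorphisms are contractive (\<open>star_map_contractive\<close>). Existence of
  \<open>id \<otimes> \<phi>\<close> is obtained by applying \<open>\<phi>\<close> to the slices of an operator (\<open>star_hom_ampl\<close>), and for the
  comultiplication of the group algebra there is an explicit formula (\<open>diag_hom_coassociative\<close>). The
  group algebra is realised on \<open>\<ell>\<^sup>2('q)\<close> by a free action of \<open>\<Gamma>\<close> on \<open>'q\<close>.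
\<close>

section \<open>Norm bounds for matrices of operators\<close>

lemma opr_sum_apply: "(\<Sum>i\<in>I. T i) x y = (\<Sum>i\<in>I. T i x y)" for T :: "'i \<Rightarrow> 'x opr"
  by (induction I rule: infinite_finite_induct) auto

lemmas opr_apply = minus_apply zero_fun_def opr_scale_def opr_sum_apply

abbreviation l2_norm :: "('x \<Rightarrow> complex) \<Rightarrow> 'x set \<Rightarrow> real" where
  "l2_norm v F \<equiv> L2_set (\<lambda>x. cmod (v x)) F"

lemma cmod_sum_mult_le:
  "cmod (\<Sum>i\<in>A. f i * g i) \<le> l2_norm f A * l2_norm g A"
proof -
  have "cmod (\<Sum>i\<in>A. f i * g i) \<le> (\<Sum>i\<in>A. cmod (f i * g i))" by (rule norm_sum)
  also have "\<dots> = (\<Sum>i\<in>A. \<bar>cmod (f i)\<bar> * \<bar>cmod (g i)\<bar>)" by (simp add: norm_mult)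
  also have "\<dots> \<le> l2_norm f A * l2_norm g A" by (rule L2_set_mult_ineq)
  finally show ?thesis .
qed

lemma L2_set_power2: "(L2_set f A)\<^sup>2 = (\<Sum>i\<in>A. (f i)\<^sup>2)"
  by (simp add: L2_set_def sum_nonneg)

lemma opr_norm_leD:
  assumes "opr_norm_le T C" "finite F" "finite G"
  shows "cmod (\<Sum>x\<in>F. \<Sum>y\<in>G. cnj (u x) * T x y * v y)
       \<le> C * l2_norm u F * l2_norm v G"
  using assms unfolding opr_norm_le_def by blast

lemma opr_norm_le_entry:
  assumes "opr_norm_le T C" shows "cmod (T x y) \<le> C"
  using opr_norm_leD[OF assms, of "{x}" "{y}" "\<lambda>_. 1" "\<lambda>_. 1"] by simp

lemma opr_norm_le_nonneg:
  assumes "opr_norm_le T C" shows "0 \<le> C"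
  using opr_norm_le_entry[OF assms, of undefined undefined] norm_ge_zero order_trans by blast

lemma opr_norm_le_mono:
  assumes "opr_norm_le T C" "C \<le> D" shows "opr_norm_le T D"
  unfolding opr_norm_le_def
proof (intro allI impI)
  fix F G :: "'a set" and u v :: "'a \<Rightarrow> complex"
  assume f: "finite F" "finite G"
  have "C * l2_norm u F * l2_norm v G
     \<le> D * l2_norm u F * l2_norm v G"
    by (intro mult_right_mono assms L2_set_nonneg)
  then show "cmod (\<Sum>x\<in>F. \<Sum>y\<in>G. cnj (u x) * T x y * v y)
       \<le> D * l2_norm u F * l2_norm v G"
    using opr_norm_leD[OF assms(1) f, of u v] by linarith
qed

lemma opr_norm_le_add:
  assumes "opr_norm_le S C" "opr_norm_le T D" shows "opr_norm_le (S + T) (C + D)"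
  unfolding opr_norm_le_def
proof (intro allI impI)
  fix F G :: "'a set" and u v :: "'a \<Rightarrow> complex"
  assume f: "finite F" "finite G"
  have "(\<Sum>x\<in>F. \<Sum>y\<in>G. cnj (u x) * (S + T) x y * v y)
    = (\<Sum>x\<in>F. \<Sum>y\<in>G. cnj (u x) * S x y * v y) + (\<Sum>x\<in>F. \<Sum>y\<in>G. cnj (u x) * T x y * v y)"
    by (simp add: algebra_simps sum.distrib)
  then show "cmod (\<Sum>x\<in>F. \<Sum>y\<in>G. cnj (u x) * (S + T) x y * v y)
       \<le> (C + D) * l2_norm u F * l2_norm v G"
    using order_trans[OF norm_triangle_ineq
        add_mono[OF opr_norm_leD[OF assms(1) f, of u v] opr_norm_leD[OF assms(2) f, of u v]]]
    by (simp add: distrib_right)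
qed

lemma opr_norm_le_scale:
  assumes "opr_norm_le T C" shows "opr_norm_le (opr_scale c T) (cmod c * C)"
  unfolding opr_norm_le_def
proof (intro allI impI)
  fix F G :: "'a set" and u v :: "'a \<Rightarrow> complex"
  assume f: "finite F" "finite G"
  have "(\<Sum>x\<in>F. \<Sum>y\<in>G. cnj (u x) * opr_scale c T x y * v y)
    = c * (\<Sum>x\<in>F. \<Sum>y\<in>G. cnj (u x) * T x y * v y)"
    by (simp add: opr_scale_def sum_distrib_left mult_ac)
  then show "cmod (\<Sum>x\<in>F. \<Sum>y\<in>G. cnj (u x) * opr_scale c T x y * v y)
       \<le> (cmod c * C) * l2_norm u F * l2_norm v G"
    using mult_left_mono[OF opr_norm_leD[OF assms(1) f, of u v], of "cmod c"]
    by (simp add: norm_mult mult_ac)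
qed

lemma opr_minus_eq: "S - T = S + opr_scale (-1) T" for S T :: "'x opr"
  by (simp add: fun_eq_iff opr_apply)

lemma opr_norm_le_diff:
  assumes "opr_norm_le S C" "opr_norm_le T D" shows "opr_norm_le (S - T) (C + D)"
  using opr_norm_le_add[OF assms(1) opr_norm_le_scale[OF assms(2), of "-1"]]
  unfolding opr_minus_eq[of S T] by simp

lemma opr_norm_le_minus_commute:
  assumes "opr_norm_le (S - T) C" shows "opr_norm_le (T - S) C"
proof -
  have "opr_scale (-1) (S - T) = T - S" by (simp add: fun_eq_iff opr_apply)
  then show ?thesis using opr_norm_le_scale[OF assms, of "-1"] by simp
qed

lemma opr_norm_le_zero [simp]: "opr_norm_le 0 C \<longleftrightarrow> 0 \<le> C"
  by (auto dest: opr_norm_le_nonneg) (auto simp: opr_norm_le_def)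

lemma opr_norm_le_zero' [simp]: "opr_norm_le (\<lambda>x y. 0) C \<longleftrightarrow> 0 \<le> C"
  using opr_norm_le_zero[of C] by (simp only: zero_fun_def)

lemma opr_norm_le_all_zero:
  assumes "\<And>e. e > 0 \<Longrightarrow> opr_norm_le T e" shows "T = 0"
proof -
  have "T x y = 0" for x y
  proof (rule ccontr)
    assume "T x y \<noteq> 0"
    then show False using opr_norm_le_entry[OF assms[of "cmod (T x y) / 2"], of x y] by simp
  qed
  then show ?thesis by (simp add: fun_eq_iff)
qed

lemma opr_norm_le_adj:
  assumes "opr_norm_le T C" shows "opr_norm_le (opr_adj T) C"
  unfolding opr_norm_le_def
proof (intro allI impI)
  fix F G :: "'a set" and u v :: "'a \<Rightarrow> complex"
  assume f: "finite F" "finite G"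
  have "cnj (\<Sum>x\<in>F. \<Sum>y\<in>G. cnj (u x) * opr_adj T x y * v y)
     = (\<Sum>x\<in>F. \<Sum>y\<in>G. cnj (v y) * T y x * u x)"
    by (simp add: opr_adj_def cnj_sum mult_ac)
  also have "\<dots> = (\<Sum>y\<in>G. \<Sum>x\<in>F. cnj (v y) * T y x * u x)" by (rule sum.swap)
  finally have "cmod (cnj (\<Sum>x\<in>F. \<Sum>y\<in>G. cnj (u x) * opr_adj T x y * v y))
     = cmod (\<Sum>y\<in>G. \<Sum>x\<in>F. cnj (v y) * T y x * u x)"
    by (rule arg_cong)
  then have "cmod (\<Sum>x\<in>F. \<Sum>y\<in>G. cnj (u x) * opr_adj T x y * v y)
     = cmod (\<Sum>y\<in>G. \<Sum>x\<in>F. cnj (v y) * T y x * u x)"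
    unfolding complex_mod_cnj .
  then show "cmod (\<Sum>x\<in>F. \<Sum>y\<in>G. cnj (u x) * opr_adj T x y * v y)
       \<le> C * l2_norm u F * l2_norm v G"
    using opr_norm_leD[OF assms f(2,1), of v u] by (simp add: mult_ac)
qed

text \<open>Testing against the vector \<open>T v\<close> itself turns the bound on the sesquilinear form into the usual
  bound on \<open>T v\<close>.\<close>

lemma opr_norm_le_column:
  assumes "opr_norm_le T C" "finite F" "finite G"
  shows "l2_norm (\<lambda>x. \<Sum>y\<in>G. T x y * v y) F \<le> C * l2_norm v G"
proof -
  define w where "w x = (\<Sum>y\<in>G. T x y * v y)" for x
  let ?N = "l2_norm w F"
  have "(\<Sum>x\<in>F. \<Sum>y\<in>G. cnj (w x) * T x y * v y) = (\<Sum>x\<in>F. cnj (w x) * w x)"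
    by (simp add: w_def sum_distrib_left mult.assoc)
  also have "\<dots> = of_real (\<Sum>x\<in>F. (cmod (w x))\<^sup>2)"
    by (simp add: complex_norm_square mult.commute del: of_real_power)
  also have "(\<Sum>x\<in>F. (cmod (w x))\<^sup>2) = ?N\<^sup>2" by (simp add: L2_set_power2)
  finally have "?N * ?N \<le> (C * l2_norm v G) * ?N"
    using opr_norm_leD[OF assms, of w v] by (simp add: power2_eq_square norm_mult mult_ac)
  moreover have "0 \<le> C * l2_norm v G"
    using opr_norm_le_nonneg[OF assms(1)] by simp
  ultimately have "?N \<le> C * l2_norm v G"
    by (cases "?N = 0") (auto dest: mult_right_le_imp_le simp: less_le)
  then show ?thesis by (simp add: w_def)
qed

lemma opr_norm_leI:
  assumes "\<And>F G v. finite F \<Longrightarrow> finite G \<Longrightarrow>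
    l2_norm (\<lambda>x. \<Sum>y\<in>G. T x y * v y) F \<le> C * l2_norm v G"
  shows "opr_norm_le T C"
  unfolding opr_norm_le_def
proof (intro allI impI)
  fix F G :: "'a set" and u v :: "'a \<Rightarrow> complex"
  assume f: "finite F" "finite G"
  have "(\<Sum>x\<in>F. \<Sum>y\<in>G. cnj (u x) * T x y * v y) = (\<Sum>x\<in>F. cnj (u x) * (\<Sum>y\<in>G. T x y * v y))"
    by (simp add: sum_distrib_left mult.assoc)
  then have "cmod (\<Sum>x\<in>F. \<Sum>y\<in>G. cnj (u x) * T x y * v y)
    \<le> l2_norm (\<lambda>x. cnj (u x)) F * l2_norm (\<lambda>x. \<Sum>y\<in>G. T x y * v y) F"
    using cmod_sum_mult_le[of "\<lambda>x. cnj (u x)" "\<lambda>x. \<Sum>y\<in>G. T x y * v y" F] by simp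
  also have "\<dots> \<le> l2_norm (\<lambda>x. cnj (u x)) F * (C * l2_norm v G)"
    by (intro mult_left_mono assms f L2_set_nonneg)
  finally show "cmod (\<Sum>x\<in>F. \<Sum>y\<in>G. cnj (u x) * T x y * v y)
       \<le> C * l2_norm u F * l2_norm v G"
    by (simp add: mult_ac)
qed

lemma opr_norm_le_row:
  assumes "opr_norm_le T C" "finite F" "finite G"
  shows "l2_norm (\<lambda>y. \<Sum>x\<in>F. cnj (u x) * T x y) G \<le> C * l2_norm u F"
proof -
  have "cmod (\<Sum>x\<in>F. cnj (u x) * T x y) = cmod (\<Sum>x\<in>F. opr_adj T y x * u x)" for y
    using complex_mod_cnj[of "\<Sum>x\<in>F. opr_adj T y x * u x"]
    by (simp add: opr_adj_def cnj_sum mult.commute)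
  then show ?thesis using opr_norm_le_column[OF opr_norm_le_adj[OF assms(1)] assms(3,2), of u] by simp
qed

lemma has_sum_finite_sum:
  fixes f :: "'i \<Rightarrow> 'a \<Rightarrow> 'b :: topological_comm_monoid_add"
  assumes "\<And>i. i \<in> I \<Longrightarrow> (f i has_sum s i) A"
  shows "((\<lambda>x. \<Sum>i\<in>I. f i x) has_sum (\<Sum>i\<in>I. s i)) A"
  using assms by (induction I rule: infinite_finite_induct) (auto intro: has_sum_add)

lemma has_sum_norm_le:
  assumes s: "(f has_sum s) A" and b: "\<And>F. finite F \<Longrightarrow> F \<subseteq> A \<Longrightarrow> norm (sum f F) \<le> B"
  shows "norm s \<le> B"
proof -
  have "((\<lambda>F. norm (sum f F)) \<longlongrightarrow> norm s) (finite_subsets_at_top A)"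
    using s unfolding has_sum_def by (rule tendsto_norm)
  moreover have "eventually (\<lambda>F. norm (sum f F) \<le> B) (finite_subsets_at_top A)"
    by (rule eventually_finite_subsets_at_top_weakI) (rule b)
  ultimately show ?thesis by (rule tendsto_upperbound) simp
qed

lemma bounded_oprs_iff: "T \<in> bounded_oprs \<longleftrightarrow> (\<exists>C. opr_norm_le T C)"
  by (simp add: bounded_oprs_def)

lemma bounded_oprsI: "opr_norm_le T C \<Longrightarrow> T \<in> bounded_oprs"
  by (auto simp: bounded_oprs_iff)

text \<open>Rows and columns of a bounded matrix are square summable, by testing on basis vectors.\<close>

lemma row_column_abs_summable:
  assumes S: "opr_norm_le S C" and T: "opr_norm_le T D"
  shows "(\<lambda>y. norm (S x y * T y z)) summable_on UNIV"
proof (rule nonneg_bdd_above_summable_on)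
  show "bdd_above (sum (\<lambda>y. norm (S x y * T y z)) ` {F. F \<subseteq> UNIV \<and> finite F})"
  proof (rule bdd_aboveI2)
    fix F assume "F \<in> {F :: 'a set. F \<subseteq> UNIV \<and> finite F}"
    then have f: "finite F" by simp
    have "(\<Sum>y\<in>F. norm (S x y * T y z)) = (\<Sum>y\<in>F. \<bar>cmod (S x y)\<bar> * \<bar>cmod (T y z)\<bar>)"
      by (simp add: norm_mult)
    also have "\<dots> \<le> l2_norm (\<lambda>y. S x y) F * l2_norm (\<lambda>y. T y z) F"
      by (rule L2_set_mult_ineq)
    also have "\<dots> \<le> C * D"
      using opr_norm_le_row[OF S _ f, of "{x}" "\<lambda>_. 1"] opr_norm_le_column[OF T f, of "{z}" "\<lambda>_. 1"]
      by (intro mult_mono) (auto simp: opr_norm_le_nonneg[OF S])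
    finally show "(\<Sum>y\<in>F. norm (S x y * T y z)) \<le> C * D" .
  qed
qed auto

lemma opr_mult_has_sum:
  assumes S: "opr_norm_le S C" and T: "opr_norm_le T D"
  shows "((\<lambda>y. S x y * T y z) has_sum opr_mult S T x z) UNIV"
  unfolding opr_mult_def
  by (rule has_sum_infsum, rule abs_summable_summable, rule row_column_abs_summable[OF S T])

text \<open>The form of \<open>S T\<close> at \<open>u\<close>, \<open>v\<close> is the pairing of \<open>u\<^sup>* S\<close> with \<open>T v\<close>, and the finite partial sums of this
  pairing are bounded by Cauchy--Schwarz.\<close>

lemma opr_norm_le_mult:
  assumes S: "opr_norm_le S C" and T: "opr_norm_le T D"
  shows "opr_norm_le (opr_mult S T) (C * D)"
  unfolding opr_norm_le_def
proof (intro allI impI)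
  fix F G :: "'a set" and u v :: "'a \<Rightarrow> complex"
  assume f: "finite F" "finite G"
  define a where "a y = (\<Sum>x\<in>F. cnj (u x) * S x y)" for y
  define b where "b y = (\<Sum>z\<in>G. T y z * v z)" for y
  have "((\<lambda>y. \<Sum>x\<in>F. \<Sum>z\<in>G. cnj (u x) * (S x y * T y z) * v z)
     has_sum (\<Sum>x\<in>F. \<Sum>z\<in>G. cnj (u x) * opr_mult S T x z * v z)) UNIV"
    by (intro has_sum_finite_sum has_sum_cmult_left has_sum_cmult_right opr_mult_has_sum[OF S T])
  moreover have "(\<Sum>x\<in>F. \<Sum>z\<in>G. cnj (u x) * (S x y * T y z) * v z) = a y * b y" for y
    by (simp add: a_def b_def sum_product mult.assoc)
  ultimately have hs: "((\<lambda>y. a y * b y) has_sum (\<Sum>x\<in>F. \<Sum>z\<in>G. cnj (u x) * opr_mult S T x z * v z)) UNIV"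
    by simp
  show "cmod (\<Sum>x\<in>F. \<Sum>z\<in>G. cnj (u x) * opr_mult S T x z * v z)
       \<le> C * D * l2_norm u F * l2_norm v G"
  proof (rule has_sum_norm_le[OF hs])
    fix H :: "'a set" assume "finite H"
    have "cmod (\<Sum>y\<in>H. a y * b y) \<le> l2_norm a H * l2_norm b H"
      by (rule cmod_sum_mult_le)
    also have "\<dots> \<le> (C * l2_norm u F) * (D * l2_norm v G)"
      unfolding a_def b_def using \<open>finite H\<close> f
      by (intro mult_mono opr_norm_le_row[OF S] opr_norm_le_column[OF T])
         (auto simp: opr_norm_le_nonneg[OF S])
    finally show "cmod (\<Sum>y\<in>H. a y * b y)
      \<le> C * D * l2_norm u F * l2_norm v G" by (simp add: mult_ac)
  qed
qed

lemma bounded_add: "S \<in> bounded_oprs \<Longrightarrow> T \<in> bounded_oprs \<Longrightarrow> S + T \<in> bounded_oprs"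
  unfolding bounded_oprs_iff by (elim exE) (rule exI, rule opr_norm_le_add)

lemma bounded_scale: "T \<in> bounded_oprs \<Longrightarrow> opr_scale c T \<in> bounded_oprs"
  unfolding bounded_oprs_iff by (elim exE) (rule exI, rule opr_norm_le_scale)

lemma bounded_mult: "S \<in> bounded_oprs \<Longrightarrow> T \<in> bounded_oprs \<Longrightarrow> opr_mult S T \<in> bounded_oprs"
  unfolding bounded_oprs_iff by (elim exE) (rule exI, rule opr_norm_le_mult)

lemma bounded_adj: "T \<in> bounded_oprs \<Longrightarrow> opr_adj T \<in> bounded_oprs"
  unfolding bounded_oprs_iff by (elim exE) (rule exI, rule opr_norm_le_adj)

lemma bounded_zero: "0 \<in> bounded_oprs"
  unfolding bounded_oprs_iff by (rule exI[of _ 0]) simp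

lemma subspace_bounded_oprs: "opr.subspace bounded_oprs"
  by (simp add: opr.subspace_def bounded_zero bounded_add bounded_scale)

lemma opr_mult_has_sum':
  assumes "S \<in> bounded_oprs" "T \<in> bounded_oprs"
  shows "((\<lambda>y. S x y * T y z) has_sum opr_mult S T x z) UNIV"
  using assms unfolding bounded_oprs_iff by (elim exE) (rule opr_mult_has_sum)

lemma opr_mult_eqI:
  assumes "\<And>x z. ((\<lambda>y. S x y * T y z) has_sum R x z) UNIV"
  shows "opr_mult S T = R"
  unfolding opr_mult_def by (intro ext infsumI assms)

lemma opr_mult_add_left:
  assumes "S \<in> bounded_oprs" "S' \<in> bounded_oprs" "T \<in> bounded_oprs"
  shows "opr_mult (S + S') T = opr_mult S T + opr_mult S' T"
  by (rule opr_mult_eqI) (simp add: distrib_right has_sum_add opr_mult_has_sum' assms)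

lemma opr_mult_add_right:
  assumes "S \<in> bounded_oprs" "T' \<in> bounded_oprs" "T \<in> bounded_oprs"
  shows "opr_mult S (T + T') = opr_mult S T + opr_mult S T'"
  by (rule opr_mult_eqI) (simp add: distrib_left has_sum_add opr_mult_has_sum' assms)

lemma opr_mult_scale_left: "opr_mult (opr_scale c S) T = opr_scale c (opr_mult S T)"
  unfolding opr_mult_def opr_scale_def mult.assoc by (simp only: infsum_cmult_right')

lemma opr_mult_scale_right: "opr_mult S (opr_scale c T) = opr_scale c (opr_mult S T)"
proof -
  have "s * (c * t) = c * (s * t)" for s t :: complex by simp
  then show ?thesis unfolding opr_mult_def opr_scale_def by (simp only: infsum_cmult_right')
qed

lemma opr_mult_diff_left:
  assumes "S \<in> bounded_oprs" "S' \<in> bounded_oprs" "T \<in> bounded_oprs"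
  shows "opr_mult (S - S') T = opr_mult S T - opr_mult S' T"
  using assms unfolding opr_minus_eq[of S S'] opr_minus_eq[of "opr_mult S T"]
  by (simp only: opr_mult_add_left opr_mult_scale_left bounded_scale)

lemma opr_mult_diff_right:
  assumes "S \<in> bounded_oprs" "T' \<in> bounded_oprs" "T \<in> bounded_oprs"
  shows "opr_mult S (T - T') = opr_mult S T - opr_mult S T'"
  using assms unfolding opr_minus_eq[of T T'] opr_minus_eq[of "opr_mult S T"]
  by (simp only: opr_mult_add_right opr_mult_scale_right bounded_scale)

lemma opr_adj_mult: "opr_adj (opr_mult S T) = opr_mult (opr_adj T) (opr_adj S)"
  unfolding opr_adj_def opr_mult_def infsum_cnj[symmetric] complex_cnj_mult
  by (simp only: mult.commute)

lemma opr_adj_adj [simp]: "opr_adj (opr_adj T) = T"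
  by (simp add: opr_adj_def)

lemma opr_adj_add: "opr_adj (S + T) = opr_adj S + opr_adj T"
  by (simp add: opr_adj_def fun_eq_iff)

lemma opr_adj_diff: "opr_adj (S - T) = opr_adj S - opr_adj T"
  by (simp add: opr_adj_def fun_eq_iff opr_apply)

lemma opr_adj_scale: "opr_adj (opr_scale c T) = opr_scale (cnj c) (opr_adj T)"
  by (simp add: opr_adj_def opr_scale_def)

lemma opr_adj_one [simp]: "opr_adj opr_one = opr_one"
  by (auto simp: opr_adj_def opr_one_def fun_eq_iff)

text \<open>Such a matrix is a partial isometry between coordinate subspaces. Identities, matrix units and
  permutation matrices are of this kind.\<close>

lemma opr_norm_le_partial_bijection:
  fixes P :: "'x \<Rightarrow> 'x \<Rightarrow> bool"
  assumes row: "\<And>x y y'. P x y \<Longrightarrow> P x y' \<Longrightarrow> y = y'" and col: "\<And>x x' y. P x y \<Longrightarrow> P x' y \<Longrightarrow> x = x'"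
  shows "opr_norm_le (\<lambda>x y. if P x y then 1 else 0) 1"
proof (rule opr_norm_leI)
  fix F G :: "'x set" and v :: "'x \<Rightarrow> complex"
  assume f: "finite F" "finite G"
  have "(cmod (\<Sum>y\<in>G. (if P x y then 1 else 0) * v y))\<^sup>2 = (\<Sum>y\<in>G. if P x y then (cmod (v y))\<^sup>2 else 0)" for x
  proof (cases "\<exists>y\<in>G. P x y")
    case True
    then obtain y0 where y0: "y0 \<in> G" "P x y0" by blast
    have eq: "P x y \<longleftrightarrow> y = y0" for y using row y0(2) by blast
    have "(\<Sum>y\<in>G. (if P x y then 1 else 0) * v y) = (\<Sum>y\<in>G. if y = y0 then v y else 0)"
      by (intro sum.cong refl) (simp add: eq)
    then show ?thesis using f y0(1) by (simp add: eq)
  qed auto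
  then have "(l2_norm (\<lambda>x. \<Sum>y\<in>G. (if P x y then 1 else 0) * v y) F)\<^sup>2
    = (\<Sum>x\<in>F. \<Sum>y\<in>G. if P x y then (cmod (v y))\<^sup>2 else 0)" by (simp add: L2_set_power2)
  also have "\<dots> = (\<Sum>y\<in>G. \<Sum>x\<in>F. if P x y then (cmod (v y))\<^sup>2 else 0)" by (rule sum.swap)
  also have "\<dots> \<le> (\<Sum>y\<in>G. (cmod (v y))\<^sup>2)"
  proof (rule sum_mono)
    fix y
    show "(\<Sum>x\<in>F. if P x y then (cmod (v y))\<^sup>2 else 0) \<le> (cmod (v y))\<^sup>2"
    proof (cases "\<exists>x\<in>F. P x y")
      case True
      then obtain x0 where x0: "x0 \<in> F" "P x0 y" by blast
      then have "P x y \<longleftrightarrow> x = x0" for x using col by blast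
      then show ?thesis using f x0(1) by simp
    next
      case False
      then have "(\<Sum>x\<in>F. if P x y then (cmod (v y))\<^sup>2 else 0) = 0" by (intro sum.neutral) auto
      then show ?thesis by simp
    qed
  qed
  also have "\<dots> = (l2_norm v G)\<^sup>2" by (simp add: L2_set_power2)
  finally show "l2_norm (\<lambda>x. \<Sum>y\<in>G. (if P x y then 1 else 0) * v y) F \<le> 1 * l2_norm v G"
    unfolding mult_1 by (rule power2_le_imp_le) simp
qed

lemma opr_norm_le_one: "opr_norm_le opr_one 1"
  unfolding opr_one_def by (rule opr_norm_le_partial_bijection) auto

lemma opr_mult_one_right [simp]: "opr_mult T opr_one = T"
proof (rule opr_mult_eqI)
  fix x z
  show "((\<lambda>y. T x y * opr_one y z) has_sum T x z) UNIV"
    by (rule has_sum_finite_neutralI[of "{z}"]) (auto simp: opr_one_def)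
qed

lemma opr_norm_le_limit:
  assumes lim: "\<And>x y. (\<lambda>m. T m x y) \<longlonglongrightarrow> L x y" and ev: "eventually (\<lambda>m. opr_norm_le (T m) C) sequentially"
  shows "opr_norm_le L C"
  unfolding opr_norm_le_def
proof (intro allI impI)
  fix F G :: "'a set" and u v :: "'a \<Rightarrow> complex"
  assume f: "finite F" "finite G"
  have "(\<lambda>m. cmod (\<Sum>x\<in>F. \<Sum>y\<in>G. cnj (u x) * T m x y * v y))
     \<longlonglongrightarrow> cmod (\<Sum>x\<in>F. \<Sum>y\<in>G. cnj (u x) * L x y * v y)"
    by (intro tendsto_intros lim)
  moreover have "eventually (\<lambda>m. cmod (\<Sum>x\<in>F. \<Sum>y\<in>G. cnj (u x) * T m x y * v y)
     \<le> C * l2_norm u F * l2_norm v G) sequentially"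
    using ev by eventually_elim (rule opr_norm_leD[OF _ f])
  ultimately show "cmod (\<Sum>x\<in>F. \<Sum>y\<in>G. cnj (u x) * L x y * v y)
       \<le> C * l2_norm u F * l2_norm v G"
    by (rule tendsto_upperbound) simp
qed

lemma opr_norm_le_closed:
  assumes "\<And>D. D > C \<Longrightarrow> opr_norm_le T D" shows "opr_norm_le T C"
  unfolding opr_norm_le_def
proof (intro allI impI)
  fix F G :: "'a set" and u v :: "'a \<Rightarrow> complex"
  assume f: "finite F" "finite G"
  have "((\<lambda>D. D * l2_norm u F * l2_norm v G)
     \<longlongrightarrow> C * l2_norm u F * l2_norm v G) (at_right C)"
    by (intro tendsto_intros)
  moreover have "eventually (\<lambda>D. cmod (\<Sum>x\<in>F. \<Sum>y\<in>G. cnj (u x) * T x y * v y)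
    \<le> D * l2_norm u F * l2_norm v G) (at_right C)"
    using eventually_at_right_less[of C] by eventually_elim (rule opr_norm_leD[OF assms f])
  ultimately show "cmod (\<Sum>x\<in>F. \<Sum>y\<in>G. cnj (u x) * T x y * v y)
    \<le> C * l2_norm u F * l2_norm v G"
    by (rule tendsto_lowerbound) simp
qed

text \<open>Completeness: the limit is taken entrywise, and norm bounds pass to entrywise limits.\<close>

lemma opr_geometric_limit:
  assumes r: "0 \<le> r" "r < 1" and step: "\<And>n. opr_norm_le (b (Suc n) - b n) (K * r ^ n)"
  obtains l where "\<And>n. opr_norm_le (l - b n) (K * r ^ n / (1 - r))"
proof -
  have K: "0 \<le> K" using opr_norm_le_nonneg[OF step[of 0]] by simp
  have diff: "opr_norm_le (b (n + k) - b n) (K * r ^ n * (\<Sum>i<k. r ^ i))" for n k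
  proof (induction k)
    case (Suc k)
    have "b (n + Suc k) - b n = (b (Suc (n + k)) - b (n + k)) + (b (n + k) - b n)"
      by (simp add: fun_eq_iff opr_apply)
    moreover have "K * r ^ n * (\<Sum>i<Suc k. r ^ i) = K * r ^ (n + k) + K * r ^ n * (\<Sum>i<k. r ^ i)"
      by (simp add: algebra_simps power_add)
    ultimately show ?case using opr_norm_le_add[OF step[of "n + k"] Suc.IH] by (simp only:)
  qed simp
  have geo: "(\<Sum>i<k. r ^ i) \<le> 1 / (1 - r)" for k
    using r by (simp add: sum_gp_strict divide_right_mono)
  have diff': "opr_norm_le (b (n + k) - b n) (K * r ^ n / (1 - r))" for n k
  proof (rule opr_norm_le_mono[OF diff])
    have "K * r ^ n * (\<Sum>i<k. r ^ i) \<le> K * r ^ n * (1 / (1 - r))"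
      using K r by (intro mult_left_mono geo) auto
    then show "K * r ^ n * (\<Sum>i<k. r ^ i) \<le> K * r ^ n / (1 - r)" by simp
  qed
  have "convergent (\<lambda>n. b n x y)" for x y
  proof -
    have "summable (\<lambda>n. b (Suc n) x y - b n x y)"
    proof (rule summable_comparison_test')
      show "summable (\<lambda>n. K * r ^ n)" using r by (intro summable_mult summable_geometric) auto
      show "norm (b (Suc n) x y - b n x y) \<le> K * r ^ n" for n
        using opr_norm_le_entry[OF step[of n], of x y] by (simp add: opr_apply)
    qed
    then have "convergent (\<lambda>n. \<Sum>k<n. b (Suc k) x y - b k x y)"
      by (simp add: summable_iff_convergent)
    then have "convergent (\<lambda>n. b n x y - b 0 x y)" 
      unfolding sum_lessThan_telescope[of "\<lambda>n. b n x y"] .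
    then show ?thesis by (simp add: convergent_diff_const_right_iff)
  qed
  then obtain l where l: "(\<lambda>n. b n x y) \<longlonglongrightarrow> l x y" for x y
    unfolding convergent_def by metis
  show ?thesis
  proof
    fix n
    show "opr_norm_le (l - b n) (K * r ^ n / (1 - r))"
    proof (rule opr_norm_le_limit)
      show "(\<lambda>m. (b m - b n) x y) \<longlonglongrightarrow> (l - b n) x y" for x y
        unfolding minus_apply by (intro tendsto_intros l)
      show "eventually (\<lambda>m. opr_norm_le (b m - b n) (K * r ^ n / (1 - r))) sequentially"
        unfolding eventually_sequentially using diff' by (metis le_Suc_ex)
    qed
  qed
qed

section \<open>Multiplicative *-maps are contractive\<close>

text \<open>The unit is left out in order to cover the algebra of finite matrices over a C*-algebra, which is
  a corner of an infinite matrix algebra.\<close>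

definition star_closed :: "'x opr set \<Rightarrow> bool" where
  "star_closed A \<longleftrightarrow> A \<subseteq> bounded_oprs \<and> opr.subspace A \<and>
     (\<forall>a\<in>A. \<forall>b\<in>A. opr_mult a b \<in> A) \<and> (\<forall>a\<in>A. opr_adj a \<in> A)"

definition star_map :: "'x opr set \<Rightarrow> ('x opr \<Rightarrow> 'y opr) \<Rightarrow> bool" where
  "star_map A f \<longleftrightarrow> (\<forall>a\<in>A. f a \<in> bounded_oprs) \<and>
     (\<forall>a\<in>A. \<forall>b\<in>A. f (a + b) = f a + f b) \<and>
     (\<forall>c. \<forall>a\<in>A. f (opr_scale c a) = opr_scale c (f a)) \<and>
     (\<forall>a\<in>A. \<forall>b\<in>A. f (opr_mult a b) = opr_mult (f a) (f b)) \<and>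
     (\<forall>a\<in>A. f (opr_adj a) = opr_adj (f a))"

lemma star_closedD:
  assumes "star_closed A"
  shows "a \<in> A \<Longrightarrow> a \<in> bounded_oprs" "0 \<in> A" "a \<in> A \<Longrightarrow> b \<in> A \<Longrightarrow> a + b \<in> A"
    "a \<in> A \<Longrightarrow> opr_scale c a \<in> A" "a \<in> A \<Longrightarrow> b \<in> A \<Longrightarrow> a - b \<in> A"
    "a \<in> A \<Longrightarrow> b \<in> A \<Longrightarrow> opr_mult a b \<in> A" "a \<in> A \<Longrightarrow> opr_adj a \<in> A"
  using assms unfolding star_closed_def
  by (auto simp: opr.subspace_0 opr.subspace_add opr.subspace_scale opr.subspace_diff)

lemma star_mapD:
  assumes "star_map A f"
  shows "a \<in> A \<Longrightarrow> f a \<in> bounded_oprs" "a \<in> A \<Longrightarrow> b \<in> A \<Longrightarrow> f (a + b) = f a + f b"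
    "a \<in> A \<Longrightarrow> f (opr_scale c a) = opr_scale c (f a)"
    "a \<in> A \<Longrightarrow> b \<in> A \<Longrightarrow> f (opr_mult a b) = opr_mult (f a) (f b)"
    "a \<in> A \<Longrightarrow> f (opr_adj a) = opr_adj (f a)"
  using assms unfolding star_map_def by blast+

lemma opr_mult_diff_square:
  assumes "b \<in> bounded_oprs" "c \<in> bounded_oprs"
  shows "opr_mult b b - opr_mult c c = opr_mult b (b - c) + opr_mult (b - c) c"
  using assms by (simp add: opr_mult_diff_left opr_mult_diff_right)

text \<open>The element \<open>b\<close> is \<open>1 - (1 - t)\<^sup>1\<^sup>/\<^sup>2\<close>. It is the limit of the iteration
  \<open>b \<mapsto> (t + b\<^sup>2) / 2\<close>, which is a contraction on the ball of radius \<open>r\<close>. It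
  is used in place of \<open>(1 - t)\<^sup>1\<^sup>/\<^sup>2\<close> since it lies in the algebra also when there is no unit.\<close>

lemma square_root_complement:
  assumes A: "star_closed A" and cl: "opr_closure A = A"
    and t: "t \<in> A" "opr_adj t = t" "opr_norm_le t r" and r: "r < 1"
  obtains b where "b \<in> A" "opr_adj b = b" "b + b - opr_mult b b = t"
proof -
  have r0: "0 \<le> r" by (rule opr_norm_le_nonneg[OF t(3)])
  define it where "it b = opr_scale (1/2) (t + opr_mult b b)" for b
  define b where "b n = (it ^^ n) 0" for n
  have b_Suc: "b (Suc n) = it (b n)" for n by (simp add: b_def)
  have inA: "b n \<in> A" for n
  proof (induction n)
    case 0 show ?case unfolding b_def funpow_0 by (rule star_closedD(2)[OF A])
  next
    case (Suc n) then show ?case unfolding b_Suc it_def by (intro star_closedD[OF A] t(1))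
  qed
  note bdd = star_closedD(1)[OF A inA]
  have sa: "opr_adj (b n) = b n" for n
  proof (induction n)
    case 0 show ?case by (simp add: b_def opr_adj_def fun_eq_iff)
  next
    case (Suc n) then show ?case
      by (simp add: b_Suc it_def opr_adj_scale opr_adj_add opr_adj_mult t(2))
  qed
  have nb: "opr_norm_le (b n) r" for n
  proof (induction n)
    case 0 show ?case by (simp add: b_def r0)
  next
    case (Suc n)
    have "opr_norm_le (b (Suc n)) (cmod (1/2) * (r + r * r))"
      unfolding b_Suc it_def by (intro opr_norm_le_scale opr_norm_le_add opr_norm_le_mult t(3) Suc.IH)
    moreover have "r * r \<le> r" using r r0 by (simp add: mult_left_le)
    ultimately show ?case by (elim opr_norm_le_mono) (simp add: norm_divide)
  qed
  have it_diff: "it x - it y = opr_scale (1/2) (opr_mult x (x - y) + opr_mult (x - y) y)"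
    if "x \<in> bounded_oprs" "y \<in> bounded_oprs" for x y
    unfolding opr_mult_diff_square[OF that, symmetric] it_def
    by (simp add: fun_eq_iff opr_scale_def algebra_simps)
  have step: "opr_norm_le (b (Suc n) - b n) (r * r ^ n)" for n
  proof (induction n)
    case 0 show ?case using nb[of 1] by (simp add: b_def)
  next
    case (Suc n)
    have "opr_norm_le (it (b (Suc n)) - it (b n)) (cmod (1/2) * (r * (r * r ^ n) + r * r ^ n * r))"
      unfolding it_diff[OF bdd bdd]
      by (intro opr_norm_le_scale opr_norm_le_add opr_norm_le_mult nb Suc.IH)
    moreover have "cmod (1/2) * (r * (r * r ^ n) + r * r ^ n * r) = r * r ^ Suc n"
      by (simp add: norm_divide)
    ultimately show ?case unfolding b_Suc[of "Suc n"] b_Suc[of n] by (simp only: b_Suc)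
  qed
  obtain l where l: "\<And>n. opr_norm_le (l - b n) (r * r ^ n / (1 - r))"
    by (rule opr_geometric_limit[OF r0 r, of b r, OF step], rule that)
  have lim0: "(\<lambda>n. r * r ^ n / (1 - r)) \<longlonglongrightarrow> 0"
  proof -
    have "(\<lambda>n. r * r ^ n / (1 - r)) \<longlonglongrightarrow> r * 0 / (1 - r)"
      using r r0 by (intro tendsto_intros LIMSEQ_power_zero) auto
    then show ?thesis by simp
  qed
  have close: "\<exists>n. opr_norm_le (l - b n) e \<and> opr_norm_le (b (Suc n) - l) e" if "e > 0" for e
  proof -
    from order_tendstoD(2)[OF lim0 that] obtain N where N: "\<And>n. n \<ge> N \<Longrightarrow> r * r ^ n / (1 - r) < e"
      unfolding eventually_sequentially by blast
    have "opr_norm_le (l - b N) e" "opr_norm_le (l - b (Suc N)) e"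
      using opr_norm_le_mono[OF l less_imp_le[OF N]] by auto
    then show ?thesis using opr_norm_le_minus_commute by blast
  qed
  have lA: "l \<in> A"
  proof -
    have "l \<in> opr_closure A" unfolding opr_closure_def using close inA by blast
    then show ?thesis using cl by simp
  qed
  note lb = star_closedD(1)[OF A lA]
  have ladj: "opr_adj l - l = 0"
  proof (rule opr_norm_le_all_zero)
    fix e :: real assume "e > 0"
    then obtain n where n: "opr_norm_le (l - b n) (e/2)" using close[of "e/2"] by auto
    have "opr_norm_le (opr_adj (l - b n) + (b n - l)) (e/2 + e/2)"
      by (intro opr_norm_le_add opr_norm_le_adj n opr_norm_le_minus_commute[OF n])
    moreover have "opr_adj (l - b n) + (b n - l) = opr_adj l - l" by (simp add: opr_adj_diff sa)
    ultimately show "opr_norm_le (opr_adj l - l) e" by (simp only: field_sum_of_halves)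
  qed
  obtain L where L: "opr_norm_le l L" using lb unfolding bounded_oprs_iff by blast
  have "it l - l = 0"
  proof (rule opr_norm_le_all_zero)
    fix e :: real assume e: "e > 0"
    \<comment> \<open>small enough for \<open>(L d + d r) / 2 + d \<le> e\<close>\<close>
    define d where "d = e / (L + r + 2)"
    have L0: "0 \<le> L" by (rule opr_norm_le_nonneg[OF L])
    have d: "d > 0" using e L0 r0 by (simp add: d_def)
    from close[OF this] obtain n where n: "opr_norm_le (l - b n) d" "opr_norm_le (b (Suc n) - l) d" by blast
    have "opr_norm_le ((it l - it (b n)) + (b (Suc n) - l)) (cmod (1/2) * (L * d + d * r) + d)"
      unfolding it_diff[OF lb bdd]
      by (intro opr_norm_le_scale opr_norm_le_add opr_norm_le_mult nb L n)
    moreover have "(it l - it (b n)) + (b (Suc n) - l) = it l - l" by (simp add: b_Suc)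
    moreover have "cmod (1/2) * (L * d + d * r) + d \<le> e"
    proof -
      have "e = (L + r + 2) * d" using L0 r0 by (simp add: d_def)
      then show ?thesis using mult_nonneg_nonneg[OF L0 less_imp_le[OF d]] mult_nonneg_nonneg[OF less_imp_le[OF d] r0] d
        by (simp add: norm_divide algebra_simps)
    qed
    ultimately show "opr_norm_le (it l - l) e" using opr_norm_le_mono by metis
  qed
  then have fix_l: "it l x y = l x y" for x y by (simp add: fun_eq_iff)
  have "l + l - opr_mult l l = t"
  proof (intro ext)
    fix x y show "(l + l - opr_mult l l) x y = t x y"
      using fix_l[of x y] by (simp add: it_def opr_scale_def field_simps)
  qed
  moreover have "opr_adj l = l" using ladj by simp
  ultimately show ?thesis using that lA by blast
qed

text \<open>The diagonal form of \<open>X\<^sup>* X\<close> at \<open>v\<close> is the square of the norm of \<open>X v\<close>.\<close>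

lemma gram_has_sum:
  assumes X: "opr_norm_le X C"
  shows "((\<lambda>z. complex_of_real ((cmod (\<Sum>y\<in>G. X z y * v y))\<^sup>2)) has_sum
     (\<Sum>x\<in>G. \<Sum>y\<in>G. cnj (v x) * opr_mult (opr_adj X) X x y * v y)) UNIV"
proof -
  have "((\<lambda>z. \<Sum>x\<in>G. \<Sum>y\<in>G. cnj (v x) * (opr_adj X x z * X z y) * v y)
     has_sum (\<Sum>x\<in>G. \<Sum>y\<in>G. cnj (v x) * opr_mult (opr_adj X) X x y * v y)) UNIV"
    by (intro has_sum_finite_sum has_sum_cmult_left has_sum_cmult_right
        opr_mult_has_sum[OF opr_norm_le_adj[OF X] X])
  moreover have "(\<Sum>x\<in>G. \<Sum>y\<in>G. cnj (v x) * (opr_adj X x z * X z y) * v y)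
    = complex_of_real ((cmod (\<Sum>y\<in>G. X z y * v y))\<^sup>2)" for z
  proof -
    have "complex_of_real ((cmod (\<Sum>y\<in>G. X z y * v y))\<^sup>2)
      = cnj (\<Sum>x\<in>G. X z x * v x) * (\<Sum>y\<in>G. X z y * v y)"
      by (simp add: complex_norm_square mult.commute del: of_real_power)
    also have "\<dots> = (\<Sum>x\<in>G. \<Sum>y\<in>G. cnj (v x) * (opr_adj X x z * X z y) * v y)"
      unfolding cnj_sum sum_product complex_cnj_mult
      by (intro sum.cong refl) (simp add: opr_adj_def mult_ac)
    finally show ?thesis ..
  qed
  ultimately show ?thesis by simp
qed

text \<open>From \<open>X\<^sup>* X = 2 Y - Y\<^sup>2\<close> one gets \<open>1 - X\<^sup>* X = (1 - Y)\<^sup>2 \<ge> 0\<close>.\<close>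

lemma opr_norm_le_one_of_square:
  assumes X: "opr_norm_le X C" and Y: "opr_norm_le Y D" and sa: "opr_adj Y = Y"
    and eq: "Y + Y - opr_mult Y Y = opr_mult (opr_adj X) X"
  shows "opr_norm_le X 1"
proof (rule opr_norm_leI)
  fix F G :: "'a set" and v :: "'a \<Rightarrow> complex"
  assume f: "finite F" "finite G"
  define a where "a z = (cmod (\<Sum>y\<in>G. X z y * v y))\<^sup>2" for z
  define w where "w z = (\<Sum>y\<in>G. Y z y * v y)" for z
  define sX where "sX = (\<Sum>x\<in>G. \<Sum>y\<in>G. cnj (v x) * opr_mult (opr_adj X) X x y * v y)"
  define sY where "sY = (\<Sum>x\<in>G. \<Sum>y\<in>G. cnj (v x) * opr_mult Y Y x y * v y)"
  have hX: "((\<lambda>z. complex_of_real (a z)) has_sum sX) UNIV"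
    unfolding sX_def a_def by (rule gram_has_sum[OF X])
  have hY: "((\<lambda>z. complex_of_real ((cmod (w z))\<^sup>2)) has_sum sY) UNIV"
    using gram_has_sum[OF Y, of v G] unfolding sY_def w_def sa .
  have hX': "(a has_sum Re sX) UNIV" using has_sum_Re[OF hX] by simp
  have hY': "((\<lambda>z. (cmod (w z))\<^sup>2) has_sum Re sY) UNIV" using has_sum_Re[OF hY] by simp
  define q where "q = (\<Sum>x\<in>G. cnj (v x) * w x)"
  have "sX = q + q - sY"
    unfolding sX_def sY_def eq[symmetric] q_def w_def
    by (simp add: algebra_simps sum.distrib sum_subtractf sum_distrib_left)
  then have "Re sX = 2 * Re q - Re sY" by simp
  also have "\<dots> \<le> (\<Sum>y\<in>G. (cmod (v y))\<^sup>2)"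
  proof -
    have "2 * Re q \<le> (\<Sum>x\<in>G. (cmod (v x))\<^sup>2 + (cmod (w x))\<^sup>2)"
      unfolding q_def Re_sum sum_distrib_left
    proof (rule sum_mono)
      fix x
      have "Re (cnj (v x) * w x) \<le> cmod (v x) * cmod (w x)"
        using complex_Re_le_cmod[of "cnj (v x) * w x"] by (simp add: norm_mult)
      moreover have "2 * (cmod (v x) * cmod (w x)) \<le> (cmod (v x))\<^sup>2 + (cmod (w x))\<^sup>2"
        using sum_squares_bound[of "cmod (v x)" "cmod (w x)"] by simp
      ultimately show "2 * Re (cnj (v x) * w x) \<le> (cmod (v x))\<^sup>2 + (cmod (w x))\<^sup>2" by linarith
    qed
    moreover have "(\<Sum>x\<in>G. (cmod (w x))\<^sup>2) \<le> Re sY"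
      using finite_sum_le_has_sum[OF hY' f(2)] by simp
    ultimately show ?thesis by (simp add: sum.distrib)
  qed
  finally have le: "Re sX \<le> (l2_norm v G)\<^sup>2" by (simp add: L2_set_power2)
  have "(l2_norm (\<lambda>x. \<Sum>y\<in>G. X x y * v y) F)\<^sup>2 = sum a F"
    by (simp add: L2_set_power2 a_def)
  also have "\<dots> \<le> Re sX" using finite_sum_le_has_sum[OF hX' f(1)] by (simp add: a_def)
  also note le
  finally show "l2_norm (\<lambda>x. \<Sum>y\<in>G. X x y * v y) F \<le> 1 * l2_norm v G"
    unfolding mult_1 by (rule power2_le_imp_le) simp
qed

text \<open>For \<open>a\<close> of norm less than \<open>1\<close>, apply the map to \<open>1 - a\<^sup>* a = (1 - b)\<^sup>2\<close>, in the form
  \<open>a\<^sup>* a = 2 b - b\<^sup>2\<close>.\<close>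

theorem star_map_contractive:
  assumes A: "star_closed A" and cl: "opr_closure A = A" and f: "star_map A f"
    and a: "a \<in> A" "opr_norm_le a C"
  shows "opr_norm_le (f a) C"
proof (rule opr_norm_le_closed)
  fix D assume D: "C < D"
  have C0: "0 \<le> C" by (rule opr_norm_le_nonneg[OF a(2)])
  define x where "x = opr_scale (of_real (1 / D)) a"
  define r where "r = C / D"
  have r: "0 \<le> r" "r < 1" using C0 D by (auto simp: r_def)
  have x: "x \<in> A" unfolding x_def by (rule star_closedD(4)[OF A a(1)])
  have "opr_norm_le x (cmod (of_real (1 / D)) * C)" unfolding x_def by (rule opr_norm_le_scale[OF a(2)])
  moreover have "cmod (of_real (1 / D)) * C = r" using C0 D by (simp add: r_def norm_divide)
  ultimately have xr: "opr_norm_le x r" by (simp only:)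
  have rr: "r * r < 1" using mult_strict_mono'[of r 1 r 1] r by simp
  let ?t = "opr_mult (opr_adj x) x"
  have "?t \<in> A" "opr_adj ?t = ?t" "opr_norm_le ?t (r * r)"
    using star_closedD(6,7)[OF A] x opr_norm_le_mult[OF opr_norm_le_adj[OF xr] xr]
    by (auto simp: opr_adj_mult)
  then obtain b where b: "b \<in> A" "opr_adj b = b" "b + b - opr_mult b b = ?t"
    using square_root_complement[OF A cl _ _ _ rr] by blast
  have fdiff: "f (c - d) = f c - f d" if "c \<in> A" "d \<in> A" for c d
    unfolding opr_minus_eq[of c d] opr_minus_eq[of "f c" "f d"]
    using that star_mapD(2,3)[OF f] star_closedD(4)[OF A] by (simp only:)
  obtain B1 where B1: "opr_norm_le (f x) B1" using star_mapD(1)[OF f x] unfolding bounded_oprs_iff by blast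
  obtain B2 where B2: "opr_norm_le (f b) B2" using star_mapD(1)[OF f b(1)] unfolding bounded_oprs_iff by blast
  have "opr_norm_le (f x) 1"
  proof (rule opr_norm_le_one_of_square[OF B1 B2])
    show "opr_adj (f b) = f b" using star_mapD(5)[OF f b(1)] b(2) by simp
    have "f (b + b - opr_mult b b) = f b + f b - opr_mult (f b) (f b)"
      using b(1) star_closedD[OF A] by (simp only: fdiff star_mapD[OF f])
    moreover have "f ?t = opr_mult (opr_adj (f x)) (f x)"
      using x star_closedD[OF A] by (simp only: star_mapD[OF f])
    ultimately show "f b + f b - opr_mult (f b) (f b) = opr_mult (opr_adj (f x)) (f x)"
      using b(3) by simp
  qed
  moreover have "f a = opr_scale (of_real D) (f x)"
  proof -
    have "a = opr_scale (of_real D) x" using C0 D by (simp add: x_def opr_scale_def fun_eq_iff)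
    then show ?thesis using star_mapD(3)[OF f x] by simp
  qed
  ultimately have "opr_norm_le (f a) (cmod (of_real D) * 1)" using opr_norm_le_scale by metis
  then show "opr_norm_le (f a) D" using C0 D by simp
qed

section \<open>Block diagonal operators\<close>

text \<open>Coordinates with the same label \<open>k\<close> form a block, and on each block the operator is a copy of a
  compression of \<open>T\<close>, read along \<open>f\<close>. The operators \<open>a \<otimes> 1\<close> and \<open>1 \<otimes> b\<close> and the
  comultiplication of a group algebra are of this form.\<close>

definition block_opr :: "('p \<Rightarrow> 'k) \<Rightarrow> ('p \<Rightarrow> 'x) \<Rightarrow> 'x opr \<Rightarrow> 'p opr" where
  "block_opr k f T = (\<lambda>p q. if k p = k q then T (f p) (f q) else 0)"

text \<open>Since \<open>f\<close> is injective on each block, the operator is an orthogonal direct sum of compressions of \<open>T\<close>.\<close>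

lemma opr_norm_le_block:
  fixes f :: "'p \<Rightarrow> 'x" and k :: "'p \<Rightarrow> 'k"
  assumes inj: "\<And>p q. k p = k q \<Longrightarrow> f p = f q \<Longrightarrow> p = q" and T: "opr_norm_le T C"
  shows "opr_norm_le (block_opr k f T) C"
proof (rule opr_norm_leI)
  fix F G :: "'p set" and v :: "'p \<Rightarrow> complex"
  assume fin: "finite F" "finite G"
  have C: "0 \<le> C" by (rule opr_norm_le_nonneg[OF T])
  let ?L = "k ` (F \<union> G)"
  have grp: "sum g H = (\<Sum>c\<in>?L. \<Sum>p | p \<in> H \<and> k p = c. g p)"
    if "finite H" "H \<subseteq> F \<union> G" for H and g :: "'p \<Rightarrow> real"
    by (rule sum.group[symmetric, of H ?L k g]) (use that fin in auto)
  have piece: "(\<Sum>p | p \<in> F \<and> k p = c. (cmod (\<Sum>q\<in>G. block_opr k f T p q * v q))\<^sup>2)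
     \<le> C\<^sup>2 * (\<Sum>q | q \<in> G \<and> k q = c. (cmod (v q))\<^sup>2)" for c
  proof -
    let ?F = "{p. p \<in> F \<and> k p = c}" and ?G = "{q. q \<in> G \<and> k q = c}"
    have fin': "finite ?F" "finite ?G" using fin by auto
    have injF: "inj_on f ?F" and injG: "inj_on f ?G" by (auto intro!: inj_onI inj)
    define w where "w = v \<circ> inv_into ?G f"
    have w: "w (f q) = v q" if "q \<in> ?G" for q
      using inv_into_f_f[OF injG that] by (simp add: w_def)
    have "(\<Sum>q\<in>G. block_opr k f T p q * v q) = (\<Sum>y\<in>f ` ?G. T (f p) y * w y)" if "p \<in> ?F" for p
    proof -
      have "(\<Sum>q\<in>G. block_opr k f T p q * v q) = (\<Sum>q\<in>?G. T (f p) (f q) * v q)"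
        using that fin by (intro sum.mono_neutral_cong_right) (auto simp: block_opr_def)
      also have "\<dots> = (\<Sum>q\<in>?G. T (f p) (f q) * w (f q))"
        by (intro sum.cong refl) (simp only: w)
      also have "\<dots> = (\<Sum>y\<in>f ` ?G. T (f p) y * w y)"
        by (simp add: sum.reindex[OF injG])
      finally show ?thesis .
    qed
    then have "(\<Sum>p\<in>?F. (cmod (\<Sum>q\<in>G. block_opr k f T p q * v q))\<^sup>2)
      = (\<Sum>p\<in>?F. (cmod (\<Sum>y\<in>f ` ?G. T (f p) y * w y))\<^sup>2)"
      by (intro sum.cong refl) simp
    also have "\<dots> = (\<Sum>x\<in>f ` ?F. (cmod (\<Sum>y\<in>f ` ?G. T x y * w y))\<^sup>2)"
      by (simp add: sum.reindex[OF injF])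
    also have "\<dots> = (l2_norm (\<lambda>x. \<Sum>y\<in>f ` ?G. T x y * w y) (f ` ?F))\<^sup>2"
      by (simp add: L2_set_power2)
    also have "\<dots> \<le> (C * l2_norm w (f ` ?G))\<^sup>2"
      using fin' by (intro power_mono opr_norm_le_column[OF T]) auto
    also have "\<dots> = C\<^sup>2 * (\<Sum>y\<in>f ` ?G. (cmod (w y))\<^sup>2)"
      by (simp add: power_mult_distrib L2_set_power2)
    also have "(\<Sum>y\<in>f ` ?G. (cmod (w y))\<^sup>2) = (\<Sum>q\<in>?G. (cmod (v q))\<^sup>2)"
      unfolding sum.reindex[OF injG] o_def by (intro sum.cong refl) (simp only: w)
    finally show ?thesis .
  qed
  have "(l2_norm (\<lambda>p. \<Sum>q\<in>G. block_opr k f T p q * v q) F)\<^sup>2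
    = (\<Sum>c\<in>?L. \<Sum>p | p \<in> F \<and> k p = c. (cmod (\<Sum>q\<in>G. block_opr k f T p q * v q))\<^sup>2)"
    unfolding L2_set_power2 using fin by (intro grp) auto
  also have "\<dots> \<le> (\<Sum>c\<in>?L. C\<^sup>2 * (\<Sum>q | q \<in> G \<and> k q = c. (cmod (v q))\<^sup>2))"
    by (intro sum_mono piece)
  also have "\<dots> = C\<^sup>2 * (\<Sum>q\<in>G. (cmod (v q))\<^sup>2)"
    using grp[OF fin(2), of "\<lambda>q. (cmod (v q))\<^sup>2"] by (simp add: sum_distrib_left)
  also have "\<dots> = (C * l2_norm v G)\<^sup>2"
    by (simp add: power_mult_distrib L2_set_power2)
  finally show "l2_norm (\<lambda>p. \<Sum>q\<in>G. block_opr k f T p q * v q) F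
     \<le> C * l2_norm v G"
    by (rule power2_le_imp_le) (simp add: C)
qed

lemma block_opr_add: "block_opr k f (S + T) = block_opr k f S + block_opr k f T"
  and block_opr_scale: "block_opr k f (opr_scale c T) = opr_scale c (block_opr k f T)"
  and block_opr_adj: "block_opr k f (opr_adj T) = opr_adj (block_opr k f T)"
  by (auto simp: block_opr_def opr_scale_def opr_adj_def fun_eq_iff)

lemma block_opr_one:
  assumes "\<And>p q. k p = k q \<Longrightarrow> f p = f q \<Longrightarrow> p = q"
  shows "block_opr k f opr_one = opr_one"
  using assms by (auto simp: block_opr_def opr_one_def fun_eq_iff)

text \<open>The hypothesis on \<open>S\<close> says that no term of the product \<open>S T\<close> leaves the image of the block.\<close>

lemma block_opr_mult:
  assumes inj: "\<And>p q. k p = k q \<Longrightarrow> f p = f q \<Longrightarrow> p = q"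
    and supp: "\<And>p y. S (f p) y \<noteq> 0 \<Longrightarrow> \<exists>q. k q = k p \<and> f q = y"
  shows "block_opr k f (opr_mult S T) = opr_mult (block_opr k f S) (block_opr k f T)"
proof (intro ext)
  fix p r
  show "block_opr k f (opr_mult S T) p r = opr_mult (block_opr k f S) (block_opr k f T) p r"
  proof (cases "k p = k r")
    case False
    then have "(\<lambda>q. block_opr k f S p q * block_opr k f T q r) = (\<lambda>q. 0)"
      by (auto simp: block_opr_def fun_eq_iff)
    then show ?thesis using False by (simp add: opr_mult_def block_opr_def)
  next
    case True
    let ?B = "{q. k q = k p}"
    have "(\<Sum>\<^sub>\<infinity>q. block_opr k f S p q * block_opr k f T q r) = (\<Sum>\<^sub>\<infinity>q\<in>?B. S (f p) (f q) * T (f q) (f r))"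
      using True by (intro infsum_cong_neutral) (auto simp: block_opr_def)
    also have "\<dots> = (\<Sum>\<^sub>\<infinity>y\<in>f ` ?B. S (f p) y * T y (f r))"
      by (subst infsum_reindex) (auto intro!: inj_onI inj simp: o_def)
    also have "\<dots> = (\<Sum>\<^sub>\<infinity>y. S (f p) y * T y (f r))"
    proof (rule infsum_cong_neutral)
      fix y assume y: "y \<in> UNIV - f ` ?B"
      show "S (f p) y * T y (f r) = 0"
      proof (rule ccontr)
        assume "S (f p) y * T y (f r) \<noteq> 0"
        then have "S (f p) y \<noteq> 0" by auto
        from supp[OF this] y show False by auto
      qed
    qed auto
    finally show ?thesis using True by (simp add: opr_mult_def block_opr_def)
  qed
qed

lemma bounded_block:
  assumes "\<And>p q. k p = k q \<Longrightarrow> f p = f q \<Longrightarrow> p = q" "T \<in> bounded_oprs"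
  shows "block_opr k f T \<in> bounded_oprs"
proof -
  obtain C where "opr_norm_le T C" using assms(2) unfolding bounded_oprs_iff by blast
  from opr_norm_le_block[OF assms(1) this, of k f] show ?thesis by (intro bounded_oprsI)
qed

section \<open>Tensor products of operators\<close>

lemma opr_tensor_add_left: "opr_tensor (a + a') b = opr_tensor a b + opr_tensor a' b"
  and opr_tensor_add_right: "opr_tensor a (b + b') = opr_tensor a b + opr_tensor a b'"
  and opr_tensor_scale_left: "opr_tensor (opr_scale c a) b = opr_scale c (opr_tensor a b)"
  and opr_tensor_scale_right: "opr_tensor a (opr_scale c b) = opr_scale c (opr_tensor a b)"
  and opr_adj_tensor: "opr_adj (opr_tensor a b) = opr_tensor (opr_adj a) (opr_adj b)"
  and opr_tensor_one: "opr_tensor opr_one opr_one = opr_one"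
  by (auto simp: opr_tensor_def opr_scale_def opr_adj_def opr_one_def fun_eq_iff algebra_simps)

text \<open>\<open>a \<otimes> b = (a \<otimes> 1) (1 \<otimes> b)\<close>, which bounds the norm of \<open>a \<otimes> b\<close>.\<close>

lemma opr_tensor_eq_mult_block:
  "opr_tensor a b = opr_mult (block_opr snd fst a) (block_opr fst snd b)"
proof (rule opr_mult_eqI[symmetric])
  fix p r :: "'a \<times> 'b"
  show "((\<lambda>q. block_opr snd fst a p q * block_opr fst snd b q r) has_sum opr_tensor a b p r) UNIV"
    by (rule has_sum_finite_neutralI[of "{(fst r, snd p)}"])
       (auto simp: block_opr_def opr_tensor_def split: prod.splits if_splits)
qed

lemma opr_norm_le_tensor:
  assumes "opr_norm_le a C" "opr_norm_le b D"
  shows "opr_norm_le (opr_tensor a b) (C * D)"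
  unfolding opr_tensor_eq_mult_block
  by (intro opr_norm_le_mult opr_norm_le_block assms) (auto simp: prod_eq_iff)

lemma bounded_tensor:
  assumes "a \<in> bounded_oprs" "b \<in> bounded_oprs" shows "opr_tensor a b \<in> bounded_oprs"
  using assms unfolding bounded_oprs_iff by (elim exE) (rule exI, rule opr_norm_le_tensor)

text \<open>An operator on the tensor product, viewed as a matrix of operators on the second factor.\<close>

definition opr_slice :: "('x \<times> 'y) opr \<Rightarrow> 'x \<Rightarrow> 'x \<Rightarrow> 'y opr" where
  "opr_slice T x x' = (\<lambda>y y'. T (x, y) (x', y'))"

lemma opr_slice_eqI:
  assumes "\<And>x x'. opr_slice S x x' = opr_slice T x x'" shows "S = T"
proof (intro ext)
  fix p q show "S p q = T p q"
    using fun_cong[OF fun_cong[OF assms[of "fst p" "fst q"]], of "snd p" "snd q"]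
    by (simp add: opr_slice_def)
qed

lemma opr_slice_add: "opr_slice (S + T) x x' = opr_slice S x x' + opr_slice T x x'"
  and opr_slice_scale: "opr_slice (opr_scale c T) x x' = opr_scale c (opr_slice T x x')"
  and opr_slice_adj: "opr_slice (opr_adj T) x x' = opr_adj (opr_slice T x' x)"
  and opr_slice_zero: "opr_slice 0 x x' = 0"
  and opr_slice_tensor: "opr_slice (opr_tensor a b) x x' = opr_scale (a x x') b"
  by (auto simp: opr_slice_def opr_scale_def opr_adj_def opr_tensor_def fun_eq_iff)

lemma opr_slice_sum: "opr_slice (\<Sum>i\<in>I. T i) x x' = (\<Sum>i\<in>I. opr_slice (T i) x x')"
  by (intro ext) (simp add: opr_slice_def opr_sum_apply)

lemma opr_norm_le_slice:
  assumes "opr_norm_le T C" shows "opr_norm_le (opr_slice T x x') C"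
  unfolding opr_norm_le_def
proof (intro allI impI)
  fix F G :: "'b set" and u v :: "'b \<Rightarrow> complex"
  assume f: "finite F" "finite G"
  have i: "inj_on (Pair z) H" for z :: 'a and H :: "'b set" by (auto intro: inj_onI)
  show "cmod (\<Sum>y\<in>F. \<Sum>y'\<in>G. cnj (u y) * opr_slice T x x' y y' * v y')
       \<le> C * l2_norm u F * l2_norm v G"
    using opr_norm_leD[OF assms, of "Pair x ` F" "Pair x' ` G" "u \<circ> snd" "v \<circ> snd"] f
    by (simp add: sum.reindex[OF i] opr_slice_def L2_set_def)
qed

lemma bounded_slice: "T \<in> bounded_oprs \<Longrightarrow> opr_slice T x x' \<in> bounded_oprs"
  unfolding bounded_oprs_iff by (elim exE) (rule exI, rule opr_norm_le_slice)

lemma opr_slice_mult_has_sum: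
  assumes S: "S \<in> bounded_oprs" and T: "T \<in> bounded_oprs"
  shows "((\<lambda>x'. opr_mult (opr_slice S x x') (opr_slice T x' x'') y y'') has_sum
     opr_slice (opr_mult S T) x x'' y y'') UNIV"
proof -
  have "((\<lambda>q. S (x, y) q * T q (x'', y'')) has_sum opr_mult S T (x, y) (x'', y'')) (UNIV \<times> UNIV)"
    using opr_mult_has_sum'[OF S T] by simp
  moreover have "((\<lambda>y'. S (x, y) (x', y') * T (x', y') (x'', y''))
      has_sum opr_mult (opr_slice S x x') (opr_slice T x' x'') y y'') UNIV" for x'
    using opr_mult_has_sum'[OF bounded_slice[OF S, of x x'] bounded_slice[OF T, of x' x''], of y y'']
    by (simp add: opr_slice_def)
  ultimately have "((\<lambda>x'. opr_mult (opr_slice S x x') (opr_slice T x' x'') y y'')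
      has_sum opr_mult S T (x, y) (x'', y'')) UNIV"
    by (rule has_sum_SigmaD)
  then show ?thesis by (simp add: opr_slice_def)
qed

lemma opr_slice_mult_finite:
  assumes S: "S \<in> bounded_oprs" and T: "T \<in> bounded_oprs" and F: "finite F"
    and z: "\<And>x'. x' \<notin> F \<Longrightarrow> opr_slice S x x' = 0"
  shows "opr_slice (opr_mult S T) x x'' = (\<Sum>x'\<in>F. opr_mult (opr_slice S x x') (opr_slice T x' x''))"
proof (intro ext)
  fix y y''
  have z': "opr_mult (opr_slice S x x') R y y'' = 0" if "x' \<notin> F" for x' and R :: "'b opr"
    unfolding z[OF that] by (simp add: opr_mult_def)
  have "((\<lambda>x'. opr_mult (opr_slice S x x') (opr_slice T x' x'') y y'') has_sum
     (\<Sum>x'\<in>F. opr_mult (opr_slice S x x') (opr_slice T x' x'') y y'')) UNIV"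
    by (rule has_sum_finite_neutralI[OF F]) (auto simp: z')
  from has_sum_unique[OF opr_slice_mult_has_sum[OF S T] this]
  show "opr_slice (opr_mult S T) x x'' y y''
    = (\<Sum>x'\<in>F. opr_mult (opr_slice S x x') (opr_slice T x' x'')) y y''"
    by (simp add: opr_sum_apply)
qed

lemma opr_mult_tensor:
  assumes "a \<in> bounded_oprs" "a' \<in> bounded_oprs" "b \<in> bounded_oprs" "b' \<in> bounded_oprs"
  shows "opr_mult (opr_tensor a b) (opr_tensor a' b') = opr_tensor (opr_mult a a') (opr_mult b b')"
proof (rule opr_slice_eqI, intro ext)
  fix x x'' y y''
  have "((\<lambda>x'. opr_mult (opr_slice (opr_tensor a b) x x') (opr_slice (opr_tensor a' b') x' x'') y y'')
     has_sum opr_mult a a' x x'' * opr_mult b b' y y'') UNIV"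
  proof -
    have "opr_mult (opr_slice (opr_tensor a b) x x') (opr_slice (opr_tensor a' b') x' x'') y y''
       = a x x' * a' x' x'' * opr_mult b b' y y''" for x'
      unfolding opr_slice_tensor opr_mult_scale_left opr_mult_scale_right by (simp add: opr_scale_def)
    then show ?thesis by (simp only:) (intro has_sum_cmult_left opr_mult_has_sum' assms)
  qed
  from has_sum_unique[OF opr_slice_mult_has_sum[OF bounded_tensor bounded_tensor] this] assms
  show "opr_slice (opr_mult (opr_tensor a b) (opr_tensor a' b')) x x'' y y''
     = opr_slice (opr_tensor (opr_mult a a') (opr_mult b b')) x x'' y y''"
    by (simp only: opr_slice_tensor opr_scale_def)
qed

section \<open>Norm closures of *-algebras\<close>

lemma opr_closureI: "(\<And>e. e > 0 \<Longrightarrow> \<exists>a\<in>M. opr_norm_le (T - a) e) \<Longrightarrow> T \<in> opr_closure M"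
  by (simp add: opr_closure_def)

lemma opr_closureD: "T \<in> opr_closure M \<Longrightarrow> e > 0 \<Longrightarrow> \<exists>a\<in>M. opr_norm_le (T - a) e"
  by (simp add: opr_closure_def)

lemma opr_closure_subset: "M \<subseteq> opr_closure M"
proof
  fix T assume T: "T \<in> M"
  show "T \<in> opr_closure M"
  proof (rule opr_closureI)
    fix e :: real assume "e > 0"
    then have "opr_norm_le (T - T) e" unfolding diff_self by simp
    then show "\<exists>a\<in>M. opr_norm_le (T - a) e" using T by blast
  qed
qed

lemma opr_closure_mono: "M \<subseteq> N \<Longrightarrow> opr_closure M \<subseteq> opr_closure N"
  unfolding opr_closure_def by blast

lemma opr_diff_split: "S - T = (S - R) + (R - T)" for S R T :: "'x opr"
  by (simp add: fun_eq_iff)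

lemma opr_closure_idem: "opr_closure (opr_closure M) = opr_closure M"
proof
  show "opr_closure (opr_closure M) \<subseteq> opr_closure M"
  proof
    fix T assume T: "T \<in> opr_closure (opr_closure M)"
    show "T \<in> opr_closure M"
    proof (rule opr_closureI)
      fix e :: real assume "e > 0"
      then have e: "e / 2 > 0" by simp
      from opr_closureD[OF T e] obtain S where S: "S \<in> opr_closure M" "opr_norm_le (T - S) (e/2)" by blast
      from opr_closureD[OF S(1) e] obtain a where a: "a \<in> M" "opr_norm_le (S - a) (e/2)" by blast
      have "opr_norm_le (T - a) e"
        using opr_norm_le_add[OF S(2) a(2)] unfolding opr_diff_split[of T a S] field_sum_of_halves .
      with a(1) show "\<exists>a\<in>M. opr_norm_le (T - a) e" by blast
    qed
  qed
qed (rule opr_closure_subset)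

lemma opr_closure_minimal: "M \<subseteq> N \<Longrightarrow> opr_closure N = N \<Longrightarrow> opr_closure M \<subseteq> N"
  using opr_closure_mono by metis

lemma opr_closure_bounded: "opr_closure bounded_oprs = (bounded_oprs :: 'x opr set)"
proof
  show "opr_closure bounded_oprs \<subseteq> (bounded_oprs :: 'x opr set)"
  proof
    fix T :: "'x opr" assume "T \<in> opr_closure bounded_oprs"
    from opr_closureD[OF this zero_less_one] obtain a where a: "a \<in> bounded_oprs" "opr_norm_le (T - a) 1"
      by blast
    have "T = (T - a) + a" by (simp add: fun_eq_iff)
    then show "T \<in> bounded_oprs" using bounded_add[OF bounded_oprsI[OF a(2)] a(1)] by (simp only:)
  qed
qed (rule opr_closure_subset)

definition opr_linear_on :: "'x opr set \<Rightarrow> ('x opr \<Rightarrow> 'y opr) \<Rightarrow> bool" where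
  "opr_linear_on A f \<longleftrightarrow> (\<forall>a\<in>A. \<forall>b\<in>A. f (a + b) = f a + f b) \<and>
     (\<forall>c. \<forall>a\<in>A. f (opr_scale c a) = opr_scale c (f a))"

lemma opr_linear_on_diff:
  assumes A: "opr.subspace A" and f: "opr_linear_on A f" and ab: "a \<in> A" "b \<in> A"
  shows "f (a - b) = f a - f b"
proof -
  have "opr_scale (-1) b \<in> A" using A ab(2) by (rule opr.subspace_scale)
  then show ?thesis unfolding opr_minus_eq[of a b] opr_minus_eq[of "f a" "f b"]
    using f ab unfolding opr_linear_on_def by (simp only:)
qed

lemma opr_linear_on_sum:
  assumes A: "opr.subspace A" and f: "opr_linear_on A f" and I: "finite I" "\<And>i. i \<in> I \<Longrightarrow> a i \<in> A"
  shows "f (\<Sum>i\<in>I. a i) = (\<Sum>i\<in>I. f (a i))"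
  using I
proof (induction I rule: finite_induct)
  case empty
  have "f (0 - 0) = f 0 - f 0" by (intro opr_linear_on_diff[OF A f] opr.subspace_0[OF A])
  then show ?case unfolding diff_self sum.empty .
next
  case (insert i I)
  have "(\<Sum>i\<in>I. a i) \<in> A" using insert by (intro opr.subspace_sum[OF A]) auto
  then have "f (a i + (\<Sum>i\<in>I. a i)) = f (a i) + f (\<Sum>i\<in>I. a i)"
    using f insert.prems unfolding opr_linear_on_def by blast
  moreover have "f (\<Sum>i\<in>I. a i) = (\<Sum>i\<in>I. f (a i))" using insert by blast
  ultimately show ?case unfolding sum.insert[OF insert(1,2)] by (simp only:)
qed

lemma opr_linear_on_zero:
  assumes A: "opr.subspace A" and f: "opr_linear_on A f" shows "f 0 = 0"
  using opr_linear_on_sum[OF A f, of "{} :: nat set"] by (simp only: sum.empty finite.emptyI ball_empty empty_iff simp_thms)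

lemma opr_linear_on_span_image:
  assumes A: "opr.subspace A" and f: "opr_linear_on A f" and K: "opr.subspace K"
    and MA: "M \<subseteq> A" and M: "\<And>m. m \<in> M \<Longrightarrow> f m \<in> K" and a: "a \<in> opr.span M"
  shows "f a \<in> K"
proof -
  have "a \<in> A \<and> f a \<in> K"
    using a
  proof (induction rule: opr.span_induct_alt)
    case base
    show ?case unfolding opr_linear_on_zero[OF A f] using opr.subspace_0[OF A] opr.subspace_0[OF K] by blast
  next
    case (step c x y)
    have x: "x \<in> A" "opr_scale c x \<in> A" using step(1) MA opr.subspace_scale[OF A] by blast+
    have "f (opr_scale c x + y) = opr_scale c (f x) + f y"
      using f x step unfolding opr_linear_on_def by (simp only:)
    then show ?case using opr.subspace_add[OF A x(2)] step
        opr.subspace_add[OF K opr.subspace_scale[OF K M[OF step(1)]]] by (simp only: simp_thms)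
  qed
  then show ?thesis ..
qed

lemma opr_linear_on_closure_image:
  assumes A: "opr.subspace A" and f: "opr_linear_on A f" and MA: "M \<subseteq> A"
    and bound: "\<And>a C. a \<in> A \<Longrightarrow> opr_norm_le a C \<Longrightarrow> opr_norm_le (f a) (L * C)"
    and aA: "a \<in> A" and a: "a \<in> opr_closure M" and L: "0 \<le> L"
    and K: "opr_closure K = K" and M: "\<And>m. m \<in> M \<Longrightarrow> f m \<in> K"
  shows "f a \<in> K"
proof -
  have "f a \<in> opr_closure K"
  proof (rule opr_closureI)
    fix e :: real assume e: "e > 0"
    then have "e / (L + 1) > 0" using L by simp
    from opr_closureD[OF a this] obtain m where m: "m \<in> M" "opr_norm_le (a - m) (e / (L + 1))" by blast
    have mA: "m \<in> A" using m(1) MA by blast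
    have "opr_norm_le (f a - f m) (L * (e / (L + 1)))"
      unfolding opr_linear_on_diff[OF A f aA mA, symmetric]
      by (rule bound[OF opr.subspace_diff[OF A aA mA] m(2)])
    moreover have "L * (e / (L + 1)) \<le> e" using e L by (simp add: field_simps)
    ultimately show "\<exists>c\<in>K. opr_norm_le (f a - c) e" using M[OF m(1)] opr_norm_le_mono by blast
  qed
  then show ?thesis unfolding K .
qed

lemma opr_closure_zero: "opr_closure {0} = {0}"
proof
  show "opr_closure {0} \<subseteq> {0 :: 'x opr}"
  proof
    fix T :: "'x opr" assume T: "T \<in> opr_closure {0}"
    have "T = 0"
    proof (rule opr_norm_le_all_zero)
      fix e :: real assume "e > 0"
      from opr_closureD[OF T this] show "opr_norm_le T e" unfolding bex_simps(7)
        by (elim bexE) (simp only: singleton_iff diff_zero)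
    qed
    then show "T \<in> {0}" by (simp only: singleton_iff)
  qed
qed (rule opr_closure_subset)

lemma opr_linear_mult:
  assumes "b \<in> bounded_oprs"
  shows "opr_linear_on bounded_oprs (\<lambda>a. opr_mult a b)" "opr_linear_on bounded_oprs (\<lambda>a. opr_mult b a)"
  unfolding opr_linear_on_def using assms
  by (intro conjI ballI allI; simp only: opr_mult_add_left opr_mult_add_right opr_mult_scale_left opr_mult_scale_right)+

lemma opr_linear_tensor: "opr_linear_on A (\<lambda>a. opr_tensor a b)" "opr_linear_on B (\<lambda>b. opr_tensor a b)"
  unfolding opr_linear_on_def
  by (intro conjI ballI allI opr_tensor_add_left opr_tensor_add_right opr_tensor_scale_left opr_tensor_scale_right)+

lemma opr_linear_slice: "opr_linear_on A (\<lambda>T. opr_slice T x x')"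
  unfolding opr_linear_on_def by (intro conjI ballI allI opr_slice_add opr_slice_scale)

lemma star_closed_subspace: "star_closed A \<Longrightarrow> opr.subspace A"
  unfolding star_closed_def by blast

lemma star_closed_closure:
  assumes A: "star_closed A" shows "star_closed (opr_closure A)"
  unfolding star_closed_def opr.subspace_def
proof (intro conjI ballI allI)
  show b: "opr_closure A \<subseteq> bounded_oprs"
    by (rule opr_closure_minimal[OF _ opr_closure_bounded]) (use star_closedD(1)[OF A] in blast)
  show "0 \<in> opr_closure A" using opr_closure_subset star_closedD(2)[OF A] by blast
  fix S assume S: "S \<in> opr_closure A"
  show "opr_adj S \<in> opr_closure A"
  proof (rule opr_closureI)
    fix e :: real assume "e > 0"
    from opr_closureD[OF S this] obtain a where a: "a \<in> A" "opr_norm_le (S - a) e" by blast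
    have "opr_norm_le (opr_adj S - opr_adj a) e"
      using opr_norm_le_adj[OF a(2)] unfolding opr_adj_diff .
    then show "\<exists>a\<in>A. opr_norm_le (opr_adj S - a) e" using star_closedD(7)[OF A a(1)] by blast
  qed
  show "opr_scale c S \<in> opr_closure A" for c
  proof (rule opr_closureI)
    fix e :: real assume e: "e > 0"
    have "e / (cmod c + 1) > 0" using e by (simp add: add_nonneg_pos)
    from opr_closureD[OF S this] obtain a where a: "a \<in> A" "opr_norm_le (S - a) (e / (cmod c + 1))" by blast
    have "opr_norm_le (opr_scale c S - opr_scale c a) (cmod c * (e / (cmod c + 1)))"
      using opr_norm_le_scale[OF a(2)] unfolding opr.scale_right_diff_distrib .
    moreover have "cmod c * (e / (cmod c + 1)) \<le> e"
      using e by (simp add: divide_le_eq mult.commute mult_left_mono add_nonneg_pos)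
    ultimately show "\<exists>a\<in>A. opr_norm_le (opr_scale c S - a) e"
      using star_closedD(4)[OF A a(1)] opr_norm_le_mono by blast
  qed
  fix T assume T: "T \<in> opr_closure A"
  show "S + T \<in> opr_closure A"
  proof (rule opr_closureI)
    fix e :: real assume "e > 0"
    then have e: "e / 2 > 0" by simp
    from opr_closureD[OF S e] obtain a where a: "a \<in> A" "opr_norm_le (S - a) (e/2)" by blast
    from opr_closureD[OF T e] obtain b where b: "b \<in> A" "opr_norm_le (T - b) (e/2)" by blast
    have eq: "(S + T) - (a + b) = (S - a) + (T - b)" by (simp add: fun_eq_iff)
    have "opr_norm_le ((S + T) - (a + b)) e"
      using opr_norm_le_add[OF a(2) b(2)] unfolding eq field_sum_of_halves .
    then show "\<exists>a\<in>A. opr_norm_le (S + T - a) e" using star_closedD(3)[OF A a(1) b(1)] by blast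
  qed
  show "opr_mult S T \<in> opr_closure A"
  proof (rule opr_closureI)
    fix e :: real assume e: "e > 0"
    obtain C where C: "opr_norm_le S C" using S b unfolding bounded_oprs_def by blast
    obtain D where D: "opr_norm_le T D" using T b unfolding bounded_oprs_def by blast
    have C0: "0 \<le> C" and D0: "0 \<le> D" using opr_norm_le_nonneg C D by blast+
    \<comment> \<open>\<open>\<parallel>S T - a b\<parallel> \<le> d D + (C + d) d \<le> (C + D + 1) d\<close>, where \<open>d \<le> 1\<close> takes care of the quadratic term\<close>
    define d where "d = min 1 (e / (C + D + 1))"
    have d: "d > 0" "d \<le> 1" using e C0 D0 by (auto simp: d_def)
    have "d \<le> e / (C + D + 1)" by (simp add: d_def)
    then have d3: "d * (C + D + 1) \<le> e" using C0 D0 by (simp add: pos_le_divide_eq)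
    from opr_closureD[OF S d(1)] obtain a where a: "a \<in> A" "opr_norm_le (S - a) d" by blast
    from opr_closureD[OF T d(1)] obtain b' where b': "b' \<in> A" "opr_norm_le (T - b') d" by blast
    note bd = bounded_oprsI[OF C] bounded_oprsI[OF D] star_closedD(1)[OF A a(1)] star_closedD(1)[OF A b'(1)]
    have "a = S - (S - a)" by (simp add: fun_eq_iff)
    then have na: "opr_norm_le a (C + d)" using opr_norm_le_diff[OF C a(2)] by simp
    have "opr_mult S T - opr_mult a b' = opr_mult (S - a) T + opr_mult a (T - b')"
      using bd by (simp add: opr_mult_diff_left opr_mult_diff_right)
    moreover have "opr_norm_le (opr_mult (S - a) T + opr_mult a (T - b')) (d * D + (C + d) * d)"
      by (intro opr_norm_le_add opr_norm_le_mult a b' D na)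
    moreover have "d * D + (C + d) * d \<le> e"
    proof -
      have "d * d \<le> d" using d by (simp add: mult_left_le)
      then show ?thesis using d3 by (simp add: algebra_simps)
    qed
    ultimately have "opr_norm_le (opr_mult S T - opr_mult a b') e"
      using opr_norm_le_mono by metis
    then show "\<exists>a\<in>A. opr_norm_le (opr_mult S T - a) e" using star_closedD(6)[OF A a(1) b'(1)] by blast
  qed
qed

lemma cstar_algebra_iff: "cstar_algebra A \<longleftrightarrow> star_closed A \<and> opr_one \<in> A \<and> opr_closure A = A"
  unfolding cstar_algebra_def star_closed_def by blast

lemma cstar_algebra_closure:
  assumes "star_closed A" "opr_one \<in> A" shows "cstar_algebra (opr_closure A)"
  unfolding cstar_algebra_iff
  using star_closed_closure[OF assms(1)] assms(2) opr_closure_subset opr_closure_idem by blast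

text \<open>The product is bilinear and the adjoint is antilinear, so it suffices to test the spanning set.\<close>

lemma star_closed_span:
  assumes M: "M \<subseteq> bounded_oprs" and mult: "\<And>a b. a \<in> M \<Longrightarrow> b \<in> M \<Longrightarrow> opr_mult a b \<in> opr.span M"
    and adj: "\<And>a. a \<in> M \<Longrightarrow> opr_adj a \<in> opr.span M"
  shows "star_closed (opr.span M)"
proof -
  note sub = subspace_bounded_oprs
  have sb: "opr.span M \<subseteq> bounded_oprs" by (rule opr.span_minimal[OF M sub])
  have 1: "opr_mult a b \<in> opr.span M" if a: "a \<in> opr.span M" and b: "b \<in> M" for a b
    by (rule opr_linear_on_span_image[OF sub opr_linear_mult(1) opr.subspace_span M mult[OF _ b] a]) (use b M in blast)
  have 2: "opr_mult a b \<in> opr.span M" if a: "a \<in> opr.span M" and b: "b \<in> opr.span M" for a b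
    by (rule opr_linear_on_span_image[OF sub opr_linear_mult(2) opr.subspace_span M 1[OF a] b]) (use a sb in blast)
  have 3: "opr_adj a \<in> opr.span M" if a: "a \<in> opr.span M" for a
    using a
  proof (induction rule: opr.span_induct_alt)
    case base
    have "opr_adj 0 = (0 :: 'a opr)" by (simp add: opr_adj_def fun_eq_iff)
    then show ?case using opr.span_zero[of M] by (simp only:)
  next
    case (step c x y)
    then show ?case using adj
      by (simp only: opr_adj_add opr_adj_scale opr.span_add opr.span_scale)
  qed
  show ?thesis unfolding star_closed_def using sb 2 3 opr.subspace_span by blast
qed

lemma star_closed_alg_tensor:
  assumes A: "star_closed A" and B: "star_closed B" shows "star_closed (alg_tensor A B)"
  unfolding alg_tensor_def
proof (rule star_closed_span)
  show "{opr_tensor a b |a b. a \<in> A \<and> b \<in> B} \<subseteq> bounded_oprs"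
    using bounded_tensor star_closedD(1)[OF A] star_closedD(1)[OF B] by blast
next
  fix s t assume s: "s \<in> {opr_tensor a b |a b. a \<in> A \<and> b \<in> B}" and t: "t \<in> {opr_tensor a b |a b. a \<in> A \<and> b \<in> B}"
  then obtain a b a' b' where *: "s = opr_tensor a b" "t = opr_tensor a' b'" "a \<in> A" "a' \<in> A" "b \<in> B" "b' \<in> B"
    by blast
  then have "opr_mult s t = opr_tensor (opr_mult a a') (opr_mult b b')"
    using star_closedD(1)[OF A] star_closedD(1)[OF B] by (simp only: opr_mult_tensor)
  then show "opr_mult s t \<in> opr.span {opr_tensor a b |a b. a \<in> A \<and> b \<in> B}"
    using * star_closedD(6)[OF A] star_closedD(6)[OF B] by (intro opr.span_base) blast
next
  fix s assume "s \<in> {opr_tensor a b |a b. a \<in> A \<and> b \<in> B}"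
  then obtain a b where *: "s = opr_tensor a b" "a \<in> A" "b \<in> B" by blast
  then have "opr_adj s = opr_tensor (opr_adj a) (opr_adj b)" by (simp only: opr_adj_tensor)
  then show "opr_adj s \<in> opr.span {opr_tensor a b |a b. a \<in> A \<and> b \<in> B}"
    using * star_closedD(7)[OF A] star_closedD(7)[OF B] by (intro opr.span_base) blast
qed

lemma opr_tensor_in_alg: "a \<in> A \<Longrightarrow> b \<in> B \<Longrightarrow> opr_tensor a b \<in> alg_tensor A B"
  unfolding alg_tensor_def by (intro opr.span_base) blast

lemma opr_tensor_in_spatial: "a \<in> A \<Longrightarrow> b \<in> B \<Longrightarrow> opr_tensor a b \<in> spatial_tensor A B"
  unfolding spatial_tensor_def using opr_closure_subset opr_tensor_in_alg by blast

lemma cstar_algebra_spatial_tensor: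
  assumes A: "cstar_algebra A" and B: "cstar_algebra B" shows "cstar_algebra (spatial_tensor A B)"
  unfolding spatial_tensor_def
proof (rule cstar_algebra_closure)
  show "star_closed (alg_tensor A B)"
    using A B unfolding cstar_algebra_iff by (intro star_closed_alg_tensor) auto
  have "opr_tensor opr_one opr_one \<in> alg_tensor A B"
    using A B unfolding cstar_algebra_iff by (intro opr_tensor_in_alg) auto
  then show "opr_one \<in> alg_tensor A B" unfolding opr_tensor_one .
qed

lemma star_hom_imp_star_map: "star_hom A B f \<Longrightarrow> B \<subseteq> bounded_oprs \<Longrightarrow> star_map A f"
  unfolding star_hom_def star_map_def by blast

section \<open>The tensor product of the identity with a *-homomorphism\<close>

text \<open>The difference of the two maps is again bounded and linear, and it vanishes on \<open>M\<close>. This is how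
  identities between *-homomorphisms are reduced to generators below.\<close>

lemma bounded_linear_eq_on_closure:
  assumes A: "opr.subspace A" and MA: "M \<subseteq> A" and AM: "A \<subseteq> opr_closure (opr.span M)"
    and f: "opr_linear_on A f" and g: "opr_linear_on A g"
    and bf: "\<And>a C. a \<in> A \<Longrightarrow> opr_norm_le a C \<Longrightarrow> opr_norm_le (f a) (K * C)"
    and bg: "\<And>a C. a \<in> A \<Longrightarrow> opr_norm_le a C \<Longrightarrow> opr_norm_le (g a) (L * C)"
    and eq: "\<And>a. a \<in> M \<Longrightarrow> f a = g a" and KL: "0 \<le> K" "0 \<le> L" and a: "a \<in> A"
  shows "f a = g a"
proof -
  have h: "opr_linear_on A (\<lambda>a. f a - g a)"
    using f g unfolding opr_linear_on_def
    by (intro conjI ballI allI; simp only: opr.scale_right_diff_distrib add_diff_add)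
  have sub0: "opr.subspace {0 :: 'b opr}" by (rule opr.subspace_single_0)
  have span: "f b - g b \<in> {0}" if "b \<in> opr.span M" for b
    by (rule opr_linear_on_span_image[OF A h sub0 MA _ that]) (simp add: eq)
  have "f a - g a \<in> {0}"
  proof (rule opr_linear_on_closure_image[OF A h opr.span_minimal[OF MA A] _ a])
    show "opr_norm_le (f b - g b) ((K + L) * C)" if "b \<in> A" "opr_norm_le b C" for b C
      using opr_norm_le_diff[OF bf[OF that] bg[OF that]] by (simp only: distrib_right)
    show "opr_closure {0 :: 'b opr} = {0}" by (rule opr_closure_zero)
  qed (use AM a KL span in auto)
  then show ?thesis by simp
qed

lemma star_map_linear: "star_map A f \<Longrightarrow> opr_linear_on A f"
  unfolding star_map_def opr_linear_on_def by blast

lemma star_map_eq_on_closure: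
  assumes A: "star_closed A" "opr_closure A = A" and MA: "M \<subseteq> A" and AM: "A \<subseteq> opr_closure (opr.span M)"
    and f: "star_map A f" and g: "star_map A g" and eq: "\<And>a. a \<in> M \<Longrightarrow> f a = g a" and a: "a \<in> A"
  shows "f a = g a"
  by (rule bounded_linear_eq_on_closure[OF star_closed_subspace[OF A(1)] MA AM
        star_map_linear[OF f] star_map_linear[OF g] _ _ eq _ _ a, where K = 1 and L = 1])
     (simp_all add: star_map_contractive[OF A f] star_map_contractive[OF A g])

definition sliced :: "'q opr set \<Rightarrow> ('x \<times> 'q) opr set" where
  "sliced Q = {T \<in> bounded_oprs. \<forall>x x'. opr_slice T x x' \<in> Q}"

text \<open>A copy of the algebra of matrices over \<open>Q\<close> with rows and columns in \<open>F\<close>.\<close>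

definition corner :: "'q opr set \<Rightarrow> 'x set \<Rightarrow> ('x \<times> 'q) opr set" where
  "corner Q F = {T \<in> sliced Q. \<forall>x x'. x \<notin> F \<or> x' \<notin> F \<longrightarrow> opr_slice T x x' = 0}"

text \<open>The map \<open>id \<otimes> f\<close>, applying \<open>f\<close> to every entry of the matrix of slices.\<close>

definition ampl :: "('q opr \<Rightarrow> 'r opr) \<Rightarrow> ('x \<times> 'q) opr \<Rightarrow> ('x \<times> 'r) opr" where
  "ampl f T = (\<lambda>p p'. f (opr_slice T (fst p) (fst p')) (snd p) (snd p'))"

lemma slice_ampl: "opr_slice (ampl f T) x x' = f (opr_slice T x x')"
  by (simp add: opr_slice_def ampl_def fun_eq_iff)

lemma sliced_closed:
  assumes Q: "opr_closure Q = Q" shows "opr_closure (sliced Q :: ('x \<times> 'q) opr set) = sliced Q"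
proof
  show "opr_closure (sliced Q) \<subseteq> (sliced Q :: ('x \<times> 'q) opr set)"
  proof
    fix T :: "('x \<times> 'q) opr" assume T: "T \<in> opr_closure (sliced Q)"
    have "sliced Q \<subseteq> (bounded_oprs :: ('x \<times> 'q) opr set)" by (auto simp: sliced_def)
    with T have bd: "T \<in> bounded_oprs" using opr_closure_mono opr_closure_bounded by blast
    have "opr_slice T x x' \<in> Q" for x x'
      by (rule opr_linear_on_closure_image[OF opr.subspace_UNIV opr_linear_slice subset_UNIV _ UNIV_I T _ Q, where L = 1])
         (auto simp: opr_norm_le_slice sliced_def)
    then show "T \<in> sliced Q" using bd by (simp add: sliced_def)
  qed
qed (rule opr_closure_subset)

lemma subspace_sliced:
  assumes Q: "opr.subspace Q" shows "opr.subspace (sliced Q)"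
  unfolding opr.subspace_def sliced_def
  using bounded_zero bounded_add bounded_scale opr.subspace_0[OF Q] opr.subspace_add[OF Q] opr.subspace_scale[OF Q]
  by (simp only: mem_Collect_eq opr_slice_zero opr_slice_add opr_slice_scale simp_thms Ball_def) blast

lemma spatial_tensor_sliced:
  assumes A: "star_closed A" and Q: "star_closed Q" "opr_closure Q = Q"
  shows "spatial_tensor A Q \<subseteq> sliced Q"
  unfolding spatial_tensor_def
proof (rule opr_closure_minimal[OF _ sliced_closed[OF Q(2)]])
  show "alg_tensor A Q \<subseteq> sliced Q"
    unfolding alg_tensor_def
  proof (rule opr.span_minimal[OF _ subspace_sliced[OF star_closed_subspace[OF Q(1)]]])
    show "{opr_tensor a b |a b. a \<in> A \<and> b \<in> Q} \<subseteq> sliced Q"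
    proof
      fix t assume "t \<in> {opr_tensor a b |a b. a \<in> A \<and> b \<in> Q}"
      then obtain a b where t: "t = opr_tensor a b" "a \<in> A" "b \<in> Q" by blast
      show "t \<in> sliced Q" unfolding t(1) sliced_def mem_Collect_eq opr_slice_tensor
        using bounded_tensor star_closedD(1)[OF A t(2)] star_closedD(1,4)[OF Q(1) t(3)] by blast
    qed
  qed
qed

text \<open>The operator is a finite sum of matrix units tensored with bounded operators.\<close>

lemma bounded_finite_slices:
  fixes T :: "('x \<times> 'q) opr"
  assumes F: "finite F" and z: "\<And>x x'. x \<notin> F \<or> x' \<notin> F \<Longrightarrow> opr_slice T x x' = 0"
    and b: "\<And>x x'. x \<in> F \<Longrightarrow> x' \<in> F \<Longrightarrow> opr_slice T x x' \<in> bounded_oprs"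
  shows "T \<in> bounded_oprs"
proof -
  define E :: "'x \<Rightarrow> 'x \<Rightarrow> 'x opr" where "E a b = (\<lambda>x x'. if x = a \<and> x' = b then 1 else 0)" for a b
  have E: "E a b \<in> bounded_oprs" for a b
    unfolding E_def by (rule bounded_oprsI, rule opr_norm_le_partial_bijection) auto
  have "T = (\<Sum>a\<in>F. \<Sum>b\<in>F. opr_tensor (E a b) (opr_slice T a b))"
  proof (rule opr_slice_eqI)
    fix x x'
    have "opr_slice (\<Sum>a\<in>F. \<Sum>b\<in>F. opr_tensor (E a b) (opr_slice T a b)) x x'
      = (\<Sum>a\<in>F. \<Sum>b\<in>F. opr_scale (E a b x x') (opr_slice T a b))"
      unfolding opr_slice_sum opr_slice_tensor ..
    also have "\<dots> = (\<Sum>a\<in>F. \<Sum>b\<in>F. if b = x' then (if a = x then opr_slice T a b else 0) else 0)"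
      by (intro sum.cong refl) (auto simp: E_def opr_scale_def fun_eq_iff)
    also have "\<dots> = (\<Sum>a\<in>F. if a = x then (if x' \<in> F then opr_slice T x x' else 0) else 0)"
      using F by (intro sum.cong refl) (auto simp: sum.delta)
    also have "\<dots> = (if x \<in> F \<and> x' \<in> F then opr_slice T x x' else 0)"
      using F by (auto simp: sum.delta)
    also have "\<dots> = opr_slice T x x'" using z[of x x'] by auto
    finally show "opr_slice T x x' = opr_slice (\<Sum>a\<in>F. \<Sum>b\<in>F. opr_tensor (E a b) (opr_slice T a b)) x x'" ..
  qed
  moreover have "(\<Sum>a\<in>F. \<Sum>b\<in>F. opr_tensor (E a b) (opr_slice T a b)) \<in> bounded_oprs"
    by (intro opr.subspace_sum[OF subspace_bounded_oprs] bounded_tensor E b)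
  ultimately show ?thesis by (simp only:)
qed

lemma slice_mult_corner:
  assumes S: "S \<in> corner Q F" and T: "T \<in> corner Q F" and F: "finite F"
  shows "opr_slice (opr_mult S T) x x'' = (\<Sum>x'\<in>F. opr_mult (opr_slice S x x') (opr_slice T x' x''))"
  using S T F by (intro opr_slice_mult_finite) (auto simp: corner_def sliced_def)

lemma opr_mult_zero: "opr_mult 0 T = 0" "opr_mult T 0 = 0"
  by (simp_all add: opr_mult_def fun_eq_iff)

lemma star_closed_corner:
  fixes Q :: "'q opr set" and F :: "'x set"
  assumes Q: "star_closed Q" and F: "finite F" shows "star_closed (corner Q F)"
proof -
  note sub = star_closed_subspace[OF Q]
  have bd: "T \<in> corner Q F \<Longrightarrow> T \<in> bounded_oprs" for T :: "('x \<times> 'q) opr" by (simp add: corner_def sliced_def)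
  have slQ: "T \<in> corner Q F \<Longrightarrow> opr_slice T x x' \<in> Q" for T :: "('x \<times> 'q) opr" and x x' by (simp add: corner_def sliced_def)
  have z: "T \<in> corner Q F \<Longrightarrow> x \<notin> F \<or> x' \<notin> F \<Longrightarrow> opr_slice T x x' = 0" for T :: "('x \<times> 'q) opr" and x x'
    unfolding corner_def by blast
  have I: "T \<in> corner Q F" if "T \<in> bounded_oprs" "\<And>x x'. opr_slice T x x' \<in> Q"
    "\<And>x x'. x \<notin> F \<or> x' \<notin> F \<Longrightarrow> opr_slice T x x' = 0" for T :: "('x \<times> 'q) opr"
    using that unfolding corner_def sliced_def by blast
  show ?thesis unfolding star_closed_def opr.subspace_def
  proof (intro conjI ballI allI subsetI)
    fix S assume S: "S \<in> corner Q F"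
    then show "S \<in> bounded_oprs" by (rule bd)
    show "opr_adj S \<in> corner Q F"
    proof (rule I)
      show "opr_slice (opr_adj S) x x' = 0" if "x \<notin> F \<or> x' \<notin> F" for x x'
      proof -
        have "opr_slice S x' x = 0" using z[OF S] that by blast
        then show ?thesis unfolding opr_slice_adj by (simp add: opr_adj_def fun_eq_iff)
      qed
    qed (simp_all only: opr_slice_adj bounded_adj[OF bd[OF S]] star_closedD(7)[OF Q slQ[OF S]])
    show "opr_scale c S \<in> corner Q F" for c
    proof (rule I)
      show "opr_slice (opr_scale c S) x x' = 0" if "x \<notin> F \<or> x' \<notin> F" for x x'
        using z[OF S that] unfolding opr_slice_scale by simp
    qed (simp_all only: opr_slice_scale bounded_scale[OF bd[OF S]] star_closedD(4)[OF Q slQ[OF S]])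
    fix T assume T: "T \<in> corner Q F"
    show "S + T \<in> corner Q F"
    proof (rule I)
      show "opr_slice (S + T) x x' = 0" if "x \<notin> F \<or> x' \<notin> F" for x x'
        using z[OF S that] z[OF T that] unfolding opr_slice_add by simp
    qed (simp_all only: opr_slice_add bounded_add[OF bd[OF S] bd[OF T]] star_closedD(3)[OF Q slQ[OF S] slQ[OF T]])
    show "opr_mult S T \<in> corner Q F"
    proof (rule I)
      show "opr_slice (opr_mult S T) x x' \<in> Q" for x x'
        unfolding slice_mult_corner[OF S T F]
        by (intro opr.subspace_sum[OF sub] star_closedD(6)[OF Q] slQ S T)
      show "opr_slice (opr_mult S T) x x'' = 0" if "x \<notin> F \<or> x'' \<notin> F" for x x''
        unfolding slice_mult_corner[OF S T F]
      proof (rule sum.neutral, rule ballI)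
        fix x'
        have "opr_slice S x x' = 0 \<or> opr_slice T x' x'' = 0" using z[OF S] z[OF T] that by blast
        then show "opr_mult (opr_slice S x x') (opr_slice T x' x'') = 0"
          using opr_mult_zero by metis
      qed
    qed (rule bounded_mult[OF bd[OF S] bd[OF T]])
  qed (simp_all only: opr.subspace_0[OF sub] corner_def sliced_def mem_Collect_eq opr_slice_zero bounded_zero simp_thms)
qed

lemma corner_closed:
  assumes Q: "star_closed Q" "opr_closure Q = Q" and F: "finite F"
  shows "opr_closure (corner Q F :: ('x \<times> 'q) opr set) = corner Q F"
proof
  show "opr_closure (corner Q F) \<subseteq> (corner Q F :: ('x \<times> 'q) opr set)"
  proof
    fix T :: "('x \<times> 'q) opr" assume T: "T \<in> opr_closure (corner Q F)"
    have "corner Q F \<subseteq> (sliced Q :: ('x \<times> 'q) opr set)" by (auto simp: corner_def)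
    with T have sl: "T \<in> sliced Q" using opr_closure_mono sliced_closed[OF Q(2)] by blast
    have "opr_slice T x x' \<in> {0}" if "x \<notin> F \<or> x' \<notin> F" for x x'
    proof (rule opr_linear_on_closure_image[OF opr.subspace_UNIV opr_linear_slice subset_UNIV _ UNIV_I T _ opr_closure_zero, where L = 1])
      show "opr_slice a x x' \<in> {0}" if "a \<in> corner Q F" for a
        using that \<open>x \<notin> F \<or> x' \<notin> F\<close> unfolding corner_def by blast
    qed (simp_all add: opr_norm_le_slice)
    then have "opr_slice T x x' = 0" if "x \<notin> F \<or> x' \<notin> F" for x x' using that by (simp only: singleton_iff)
    then show "T \<in> corner Q F" using sl by (simp add: corner_def)
  qed
qed (rule opr_closure_subset)

lemma ampl_linear:
  fixes Q :: "'q opr set" and f :: "'q opr \<Rightarrow> 'r opr"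
  assumes f: "star_map Q f"
  shows "opr_linear_on (sliced Q :: ('x \<times> 'q) opr set) (ampl f)"
  unfolding opr_linear_on_def
proof (intro conjI ballI allI)
  fix S :: "('x \<times> 'q) opr" assume S: "S \<in> sliced Q"
  show "ampl f (opr_scale c S) = opr_scale c (ampl f S)" for c
    by (rule opr_slice_eqI) (use S in \<open>simp only: slice_ampl opr_slice_scale star_mapD(3)[OF f] sliced_def mem_Collect_eq\<close>)
  fix T :: "('x \<times> 'q) opr" assume T: "T \<in> sliced Q"
  show "ampl f (S + T) = ampl f S + ampl f T"
    by (rule opr_slice_eqI) (use S T in \<open>simp only: slice_ampl opr_slice_add star_mapD(2)[OF f] sliced_def mem_Collect_eq\<close>)
qed

text \<open>The product of two matrices in the corner is given by finite sums, with which \<open>f\<close> commutes.\<close>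

lemma star_map_ampl_corner:
  fixes Q :: "'q opr set" and f :: "'q opr \<Rightarrow> 'r opr" and F :: "'x set"
  assumes Q: "star_closed Q" and f: "star_map Q f" and F: "finite F"
  shows "star_map (corner Q F) (ampl f)"
proof -
  note sub = star_closed_subspace[OF Q]
  have f0: "f 0 = 0" by (rule opr_linear_on_zero[OF sub star_map_linear[OF f]])
  have slQ: "T \<in> corner Q F \<Longrightarrow> opr_slice T x x' \<in> Q" for T :: "('x \<times> 'q) opr" and x x' by (simp add: corner_def sliced_def)
  have z: "T \<in> corner Q F \<Longrightarrow> x \<notin> F \<or> x' \<notin> F \<Longrightarrow> opr_slice T x x' = 0" for T :: "('x \<times> 'q) opr" and x x'
    unfolding corner_def by blast
  have csl: "T \<in> corner Q F \<Longrightarrow> T \<in> sliced Q" for T :: "('x \<times> 'q) opr" by (simp add: corner_def)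
  note lin = ampl_linear[OF f, unfolded opr_linear_on_def]
  have bd: "ampl f S \<in> bounded_oprs" if S: "S \<in> corner Q F" for S :: "('x \<times> 'q) opr"
  proof (rule bounded_finite_slices[OF F])
    show "opr_slice (ampl f S) x x' = 0" if "x \<notin> F \<or> x' \<notin> F" for x x'
      unfolding slice_ampl z[OF S that] f0 ..
    show "opr_slice (ampl f S) x x' \<in> bounded_oprs" for x x'
      unfolding slice_ampl by (rule star_mapD(1)[OF f slQ[OF S]])
  qed
  show ?thesis unfolding star_map_def
  proof (intro conjI ballI allI)
    fix S assume S: "S \<in> corner Q F"
    show "ampl f S \<in> bounded_oprs" by (rule bd[OF S])
    show "ampl f (opr_scale c S) = opr_scale c (ampl f S)" for c using lin csl[OF S] by blast
    show "ampl f (opr_adj S) = opr_adj (ampl f S)"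
      by (rule opr_slice_eqI) (simp only: slice_ampl opr_slice_adj star_mapD(5)[OF f slQ[OF S]])
    fix T assume T: "T \<in> corner Q F"
    show "ampl f (S + T) = ampl f S + ampl f T" using lin csl[OF S] csl[OF T] by blast
    show "ampl f (opr_mult S T) = opr_mult (ampl f S) (ampl f T)"
    proof (rule opr_slice_eqI)
      fix x x''
      have "f (opr_slice (opr_mult S T) x x'') = (\<Sum>x'\<in>F. f (opr_mult (opr_slice S x x') (opr_slice T x' x'')))"
        unfolding slice_mult_corner[OF S T F]
        by (intro opr_linear_on_sum[OF sub star_map_linear[OF f] F] star_closedD(6)[OF Q] slQ S T)
      also have "\<dots> = (\<Sum>x'\<in>F. opr_mult (f (opr_slice S x x')) (f (opr_slice T x' x'')))"
        by (intro sum.cong refl star_mapD(4)[OF f] slQ S T)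
      also have "\<dots> = opr_slice (opr_mult (ampl f S) (ampl f T)) x x''"
      proof (subst opr_slice_mult_finite[OF bd[OF S] bd[OF T] F])
        show "opr_slice (ampl f S) x x' = 0" if "x' \<notin> F" for x'
          unfolding slice_ampl using z[OF S, of x x'] that f0 by (simp only: simp_thms)
      qed (simp only: slice_ampl)
      finally show "opr_slice (ampl f (opr_mult S T)) x x'' = opr_slice (opr_mult (ampl f S) (ampl f T)) x x''"
        unfolding slice_ampl .
    qed
  qed
qed

lemma opr_norm_le_restrict:
  assumes T: "opr_norm_le T C" shows "opr_norm_le (\<lambda>p q. if p \<in> A \<and> q \<in> A then T p q else 0) C"
proof (rule opr_norm_leI)
  fix F G :: "'a set" and v :: "'a \<Rightarrow> complex"
  assume f: "finite F" "finite G"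
  have C: "0 \<le> C" by (rule opr_norm_le_nonneg[OF T])
  have "(l2_norm (\<lambda>x. \<Sum>y\<in>G. (if x \<in> A \<and> y \<in> A then T x y else 0) * v y) F)\<^sup>2
     = (\<Sum>x\<in>F \<inter> A. (cmod (\<Sum>y\<in>G \<inter> A. T x y * v y))\<^sup>2)"
    unfolding L2_set_power2
  proof (rule sum.mono_neutral_cong_right)
    fix x assume "x \<in> F \<inter> A"
    then have "(\<Sum>y\<in>G. (if x \<in> A \<and> y \<in> A then T x y else 0) * v y) = (\<Sum>y\<in>G \<inter> A. T x y * v y)"
      using f by (intro sum.mono_neutral_cong_right) auto
    then show "(cmod (\<Sum>y\<in>G. (if x \<in> A \<and> y \<in> A then T x y else 0) * v y))\<^sup>2
      = (cmod (\<Sum>y\<in>G \<inter> A. T x y * v y))\<^sup>2" by simp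
  qed (use f in auto)
  also have "\<dots> = (l2_norm (\<lambda>x. \<Sum>y\<in>G \<inter> A. T x y * v y) (F \<inter> A))\<^sup>2"
    by (simp add: L2_set_power2)
  also have "\<dots> \<le> (C * l2_norm v (G \<inter> A))\<^sup>2"
    using f by (intro power_mono opr_norm_le_column[OF T]) auto
  also have "\<dots> \<le> (C * l2_norm v G)\<^sup>2"
    unfolding power_mult_distrib L2_set_power2 using f by (intro mult_left_mono sum_mono2) auto
  finally show "l2_norm (\<lambda>x. \<Sum>y\<in>G. (if x \<in> A \<and> y \<in> A then T x y else 0) * v y) F
     \<le> C * l2_norm v G"
    by (rule power2_le_imp_le) (simp add: C)
qed

text \<open>Complete contractivity: the matrix of \<open>(id \<otimes> f) T\<close> is tested on finitely many coordinates
  only, so that \<open>T\<close> may be compressed to a finite matrix over \<open>Q\<close>. Finite matrices over \<open>Q\<close> form a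
  closed *-algebra, on which \<open>id \<otimes> f\<close> is multiplicative and hence contractive.\<close>

lemma opr_norm_le_ampl:
  fixes Q :: "'q opr set" and f :: "'q opr \<Rightarrow> 'r opr" and T :: "('x \<times> 'q) opr"
  assumes Q: "star_closed Q" "opr_closure Q = Q" and f: "star_map Q f"
    and T: "T \<in> sliced Q" "opr_norm_le T C"
  shows "opr_norm_le (ampl f T) C"
  unfolding opr_norm_le_def
proof (intro allI impI)
  fix G H :: "('x \<times> 'r) set" and u v :: "'x \<times> 'r \<Rightarrow> complex"
  assume fin: "finite G" "finite H"
  define F where "F = fst ` (G \<union> H)"
  have F: "finite F" using fin by (simp add: F_def)
  define T' where "T' = (\<lambda>p q. if p \<in> F \<times> UNIV \<and> q \<in> F \<times> UNIV then T p q else 0)"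
  have nT': "opr_norm_le T' C" unfolding T'_def by (rule opr_norm_le_restrict[OF T(2)])
  have sl: "opr_slice T' x x' = (if x \<in> F \<and> x' \<in> F then opr_slice T x x' else 0)" for x x'
    by (auto simp: opr_slice_def T'_def fun_eq_iff)
  have TQ: "opr_slice T x x' \<in> Q" for x x' using T(1) by (simp add: sliced_def)
  have "opr_slice T' x x' \<in> Q" for x x'
    unfolding sl[of x x'] by (cases "x \<in> F \<and> x' \<in> F") (simp_all only: if_True if_False simp_thms TQ star_closedD(2)[OF Q(1)])
  moreover have "opr_slice T' x x' = 0" if "x \<notin> F \<or> x' \<notin> F" for x x'
    unfolding sl[of x x'] by (rule if_not_P) (use that in blast)
  ultimately have "T' \<in> corner Q F"
    unfolding corner_def sliced_def using bounded_oprsI[OF nT'] by blast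
  then have n: "opr_norm_le (ampl f T') C"
    by (rule star_map_contractive[OF star_closed_corner[OF Q(1) F] corner_closed[OF Q F]
        star_map_ampl_corner[OF Q(1) f F] _ nT'])
  have "ampl f T p q = ampl f T' p q" if "p \<in> G" "q \<in> H" for p q
    unfolding ampl_def sl using that by (auto simp: F_def)
  then have "(\<Sum>x\<in>G. \<Sum>y\<in>H. cnj (u x) * ampl f T x y * v y)
     = (\<Sum>x\<in>G. \<Sum>y\<in>H. cnj (u x) * ampl f T' x y * v y)"
    by (intro sum.cong refl) simp
  then show "cmod (\<Sum>x\<in>G. \<Sum>y\<in>H. cnj (u x) * ampl f T x y * v y)
       \<le> C * l2_norm u G * l2_norm v H"
    using opr_norm_leD[OF n fin, of u v] by simp
qed

lemma ampl_tensor: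
  assumes f: "star_map Q f" and b: "b \<in> Q"
  shows "ampl f (opr_tensor a b) = opr_tensor a (f b)"
  by (rule opr_slice_eqI) (simp only: slice_ampl opr_slice_tensor star_mapD(3)[OF f b])

lemma cstarD:
  assumes "cstar_algebra A"
  shows "star_closed A" "opr_closure A = A" "opr_one \<in> A" "A \<subseteq> bounded_oprs" "opr.subspace A"
  using assms unfolding cstar_algebra_iff star_closed_def by blast+

lemma elementary_spans_spatial:
  "spatial_tensor A B \<subseteq> opr_closure (opr.span {opr_tensor a b | a b. a \<in> A \<and> b \<in> B})"
  by (simp add: spatial_tensor_def alg_tensor_def)

lemma elementary_subset_spatial:
  "{opr_tensor a b | a b. a \<in> A \<and> b \<in> B} \<subseteq> spatial_tensor A B"
  using opr_tensor_in_spatial by blast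

text \<open>Both sides of the multiplicativity equation are bounded and linear in each of the two
  arguments, and they agree on elementary tensors.\<close>

lemma star_hom_ampl:
  fixes A :: "'x opr set" and Q :: "'q opr set" and f :: "'q opr \<Rightarrow> 'r opr"
  assumes A: "cstar_algebra A" and Q: "cstar_algebra Q" and f: "star_hom Q R f" and R: "R \<subseteq> bounded_oprs"
  shows "star_hom (spatial_tensor A Q) bounded_oprs (ampl f)"
proof -
  let ?T = "spatial_tensor A Q" and ?M = "{opr_tensor a b | a b. a \<in> A \<and> b \<in> Q}"
  note fm = star_hom_imp_star_map[OF f R]
  note T = cstarD[OF cstar_algebra_spatial_tensor[OF A Q]]
  have sl: "?T \<subseteq> sliced Q" by (rule spatial_tensor_sliced[OF cstarD(1)[OF A] cstarD(1,2)[OF Q]])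
  have slQ: "S \<in> ?T \<Longrightarrow> opr_slice S x x' \<in> Q" for S x x' using sl unfolding sliced_def by blast
  have add: "ampl f (S + S') = ampl f S + ampl f S'" if "S \<in> ?T" "S' \<in> ?T" for S S'
    using ampl_linear[OF fm] that sl unfolding opr_linear_on_def by blast
  have scale: "ampl f (opr_scale c S) = opr_scale c (ampl f S)" if "S \<in> ?T" for S c
    using ampl_linear[OF fm] that sl unfolding opr_linear_on_def by blast
  have nrm: "opr_norm_le (ampl f S) C" if "S \<in> ?T" "opr_norm_le S C" for S C
    using opr_norm_le_ampl[OF cstarD(1,2)[OF Q] fm _ that(2)] that(1) sl by blast
  have bd: "ampl f S \<in> bounded_oprs" if S: "S \<in> ?T" for S
  proof -
    obtain C where "opr_norm_le S C" using S T(4) unfolding bounded_oprs_def by blast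
    from nrm[OF S this] show ?thesis by (rule bounded_oprsI)
  qed
  have adj: "ampl f (opr_adj S) = opr_adj (ampl f S)" if S: "S \<in> ?T" for S
    by (rule opr_slice_eqI) (simp only: slice_ampl opr_slice_adj star_mapD(5)[OF fm slQ[OF S]])
  have Tb: "S \<in> ?T \<Longrightarrow> S \<in> bounded_oprs" for S using T(4) by blast
  have Tm: "S \<in> ?T \<Longrightarrow> S' \<in> ?T \<Longrightarrow> opr_mult S S' \<in> ?T" for S S' by (rule star_closedD(6)[OF T(1)])
  have Ts: "S \<in> ?T \<Longrightarrow> opr_scale c S \<in> ?T" for S c by (rule star_closedD(4)[OF T(1)])
  have lin: "opr_linear_on ?T (\<lambda>S'. ampl f (opr_mult S S'))" "opr_linear_on ?T (\<lambda>S'. opr_mult (ampl f S) (ampl f S'))"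
    "opr_linear_on ?T (\<lambda>S'. ampl f (opr_mult S' S))" "opr_linear_on ?T (\<lambda>S'. opr_mult (ampl f S') (ampl f S))"
    if S: "S \<in> ?T" for S
    unfolding opr_linear_on_def using S
    by (intro conjI ballI allI; simp only: opr_mult_add_left opr_mult_add_right opr_mult_scale_left opr_mult_scale_right
        Tb Tm Ts add scale bd)+
  have elem: "ampl f (opr_mult s t) = opr_mult (ampl f s) (ampl f t)" if s: "s \<in> ?M" and t: "t \<in> ?M" for s t
  proof -
    from s obtain a b where *: "s = opr_tensor a b" "a \<in> A" "b \<in> Q" by blast
    from t obtain a' b' where **: "t = opr_tensor a' b'" "a' \<in> A" "b' \<in> Q" by blast
    have bda: "a \<in> bounded_oprs" "a' \<in> bounded_oprs" using * ** cstarD(4)[OF A] by blast+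
    have bdb: "b \<in> bounded_oprs" "b' \<in> bounded_oprs" using * ** cstarD(4)[OF Q] by blast+
    have bb: "opr_mult b b' \<in> Q" using star_closedD(6)[OF cstarD(1)[OF Q]] * ** by blast
    have fb: "f b \<in> bounded_oprs" "f b' \<in> bounded_oprs" using star_mapD(1)[OF fm] * ** by blast+
    show ?thesis
      unfolding *(1) **(1) opr_mult_tensor[OF bda bdb] ampl_tensor[OF fm bb] ampl_tensor[OF fm *(3)]
        ampl_tensor[OF fm **(3)] opr_mult_tensor[OF bda fb] star_mapD(4)[OF fm *(3) **(3)] ..
  qed
  have half: "ampl f (opr_mult s S) = opr_mult (ampl f s) (ampl f S)" if s: "s \<in> ?M" and S: "S \<in> ?T" for s S
  proof -
    have sT: "s \<in> ?T" using s elementary_subset_spatial by blast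
    obtain C where C: "opr_norm_le s C" using Tb[OF sT] unfolding bounded_oprs_def by blast
    show ?thesis
    proof (rule bounded_linear_eq_on_closure[OF T(5) elementary_subset_spatial elementary_spans_spatial
          lin(1)[OF sT] lin(2)[OF sT] _ _ elem[OF s] _ _ S, where K = C and L = C])
      fix S' D assume S': "S' \<in> ?T" "opr_norm_le S' D"
      show "opr_norm_le (ampl f (opr_mult s S')) (C * D)"
        by (intro nrm opr_norm_le_mult C S' Tm sT)
      show "opr_norm_le (opr_mult (ampl f s) (ampl f S')) (C * D)"
        by (intro nrm opr_norm_le_mult C S' sT)
    qed (simp_all add: opr_norm_le_nonneg[OF C])
  qed
  have mult: "ampl f (opr_mult R S) = opr_mult (ampl f R) (ampl f S)" if R: "R \<in> ?T" and S: "S \<in> ?T" for R S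
  proof -
    obtain C where C: "opr_norm_le S C" using Tb[OF S] unfolding bounded_oprs_def by blast
    show ?thesis
    proof (rule bounded_linear_eq_on_closure[OF T(5) elementary_subset_spatial elementary_spans_spatial
          lin(3)[OF S] lin(4)[OF S] _ _ half[OF _ S] _ _ R, where K = C and L = C])
      fix S' D assume S': "S' \<in> ?T" "opr_norm_le S' D"
      have "opr_norm_le (ampl f (opr_mult S' S)) (D * C)"
        by (intro nrm opr_norm_le_mult C S' Tm S)
      then show "opr_norm_le (ampl f (opr_mult S' S)) (C * D)" by (simp only: mult.commute)
      have "opr_norm_le (opr_mult (ampl f S') (ampl f S)) (D * C)"
        by (intro nrm opr_norm_le_mult C S' S)
      then show "opr_norm_le (opr_mult (ampl f S') (ampl f S)) (C * D)" by (simp only: mult.commute)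
    qed (simp_all add: opr_norm_le_nonneg[OF C])
  qed
  have one: "ampl f opr_one = (opr_one :: ('x \<times> 'r) opr)"
  proof -
    have "f opr_one = opr_one" using f unfolding star_hom_def by blast
    then show ?thesis using ampl_tensor[OF fm cstarD(3)[OF Q], of "opr_one :: 'x opr"]
      by (simp only: opr_tensor_one)
  qed
  show ?thesis unfolding star_hom_def using bd one add scale mult adj by blast
qed

text \<open>Any two *-homomorphisms that agree on elementary tensors agree on the spatial tensor product, so it
  does not matter which one is chosen.\<close>

lemma tensor_hom_eq:
  assumes A: "cstar_algebra A" and B: "cstar_algebra B"
    and h: "star_hom (spatial_tensor A B) bounded_oprs h"
    and ht: "\<And>a b. a \<in> A \<Longrightarrow> b \<in> B \<Longrightarrow> h (opr_tensor a b) = opr_tensor (f a) (g b)"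
    and T: "T \<in> spatial_tensor A B"
  shows "tensor_hom A B f g T = h T"
proof -
  let ?P = "\<lambda>h. star_hom (spatial_tensor A B) bounded_oprs h \<and>
     (\<forall>a\<in>A. \<forall>b\<in>B. h (opr_tensor a b) = opr_tensor (f a) (g b))"
  have "?P h" using h ht by blast
  from someI[of ?P, OF this] have P: "?P (tensor_hom A B f g)" unfolding tensor_hom_def .
  note S = cstarD[OF cstar_algebra_spatial_tensor[OF A B]]
  show ?thesis
  proof (rule star_map_eq_on_closure[OF S(1,2) elementary_subset_spatial elementary_spans_spatial _ _ _ T])
    show "star_map (spatial_tensor A B) (tensor_hom A B f g)"
      using P by (intro star_hom_imp_star_map[OF _ subset_refl]) blast
    show "star_map (spatial_tensor A B) h" by (rule star_hom_imp_star_map[OF h subset_refl])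
    fix t assume "t \<in> {opr_tensor a b |a b. a \<in> A \<and> b \<in> B}"
    then obtain a b where t: "t = opr_tensor a b" "a \<in> A" "b \<in> B" by blast
    have "tensor_hom A B f g (opr_tensor a b) = opr_tensor (f a) (g b)" using P t(2,3) by blast
    then show "tensor_hom A B f g t = h t" unfolding t(1) ht[OF t(2,3)] .
  qed
qed

lemma tensor_hom_id_eq_ampl:
  assumes "cstar_algebra A" "cstar_algebra Q" "star_hom Q R f" "R \<subseteq> bounded_oprs" "T \<in> spatial_tensor A Q"
  shows "tensor_hom A Q id f T = ampl f T"
proof (rule tensor_hom_eq[OF assms(1,2) star_hom_ampl[OF assms(1-4)] _ assms(5)])
  fix a b assume "b \<in> Q"
  then show "ampl f (opr_tensor a b) = opr_tensor (id a) (f b)"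
    unfolding id_apply by (rule ampl_tensor[OF star_hom_imp_star_map[OF assms(3,4)]])
qed

section \<open>Group algebras of free actions\<close>

text \<open>Freeness makes \<open>g\<close> a function of the pair of points \<open>(act g x, x)\<close>, so that the matrix entries of an
  operator in the group algebra are its Fourier coefficients.\<close>

definition free_action :: "('g::group_add \<Rightarrow> 'x \<Rightarrow> 'x) \<Rightarrow> bool" where
  "free_action act \<longleftrightarrow> (\<forall>x. act 0 x = x) \<and> (\<forall>g h x. act (g + h) x = act g (act h x)) \<and>
     (\<forall>g x. act g x = x \<longrightarrow> g = 0)"

lemma free_actionD:
  assumes "free_action act"
  shows "act 0 x = x" "act (g + h) x = act g (act h x)" "act g x = x \<Longrightarrow> g = 0"
    "act (- g) (act g x) = x" "act g (act (- g) x) = x"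
proof -
  show 1: "act 0 x = x" and 2: "act (g + h) x = act g (act h x)" for x g h
    using assms unfolding free_action_def by blast+
  show "act g x = x \<Longrightarrow> g = 0" using assms unfolding free_action_def by blast
  show "act (- g) (act g x) = x" "act g (act (- g) x) = x" by (simp_all add: 1 flip: 2)
qed

lemma free_action_inj:
  assumes "free_action act" "act g x = act h x" shows "g = h"
proof -
  have "act (- h + g) x = x" using assms by (simp add: free_actionD)
  then have "- h + g = 0" by (rule free_actionD(3)[OF assms(1)])
  then show ?thesis by (metis add.inverse_inverse add.right_neutral add_minus_cancel)
qed

definition perm_opr :: "('g \<Rightarrow> 'x \<Rightarrow> 'x) \<Rightarrow> 'g \<Rightarrow> 'x opr" where
  "perm_opr act g = (\<lambda>x y. if x = act g y then 1 else 0)"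

definition act_algebra :: "('g \<Rightarrow> 'x \<Rightarrow> 'x) \<Rightarrow> 'x opr set" where
  "act_algebra act = opr_closure (opr.span (range (perm_opr act)))"

lemma free_action_plus: "free_action (+)"
  unfolding free_action_def by (metis add.assoc add_0_left add_right_imp_eq)

lemma lam_eq_perm_opr: "lam = perm_opr (+)"
  by (simp add: lam_def perm_opr_def fun_eq_iff)

lemma reduced_group_algebra_eq: "reduced_group_algebra = act_algebra (+)"
  by (simp add: reduced_group_algebra_def act_algebra_def lam_eq_perm_opr)

lemma perm_opr_norm:
  assumes act: "free_action act" shows "opr_norm_le (perm_opr act g) 1"
  unfolding perm_opr_def
proof (rule opr_norm_le_partial_bijection)
  fix x y y' assume "x = act g y" "x = act g y'"
  then show "y = y'" using free_actionD(4)[OF act, of g y] free_actionD(4)[OF act, of g y'] by simp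
qed simp

lemma perm_opr_zero: "free_action act \<Longrightarrow> perm_opr act 0 = opr_one"
  by (simp add: perm_opr_def opr_one_def free_actionD fun_eq_iff)

lemma perm_opr_mult:
  assumes act: "free_action act" shows "opr_mult (perm_opr act g) (perm_opr act h) = perm_opr act (g + h)"
proof (rule opr_mult_eqI)
  fix x z
  show "((\<lambda>y. perm_opr act g x y * perm_opr act h y z) has_sum perm_opr act (g + h) x z) UNIV"
    by (rule has_sum_finite_neutralI[of "{act h z}"])
       (auto simp: perm_opr_def free_actionD[OF act] split: if_splits)
qed

lemma perm_opr_adj:
  assumes act: "free_action act" shows "opr_adj (perm_opr act g) = perm_opr act (- g)"
proof -
  have "y = act g x \<longleftrightarrow> x = act (- g) y" for x y
    by (auto simp: free_actionD(4,5)[OF act])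
  then show ?thesis by (simp add: opr_adj_def perm_opr_def fun_eq_iff)
qed

lemma star_closed_perm_span:
  assumes act: "free_action act" shows "star_closed (opr.span (range (perm_opr act)))"
proof (rule star_closed_span)
  show "range (perm_opr act) \<subseteq> bounded_oprs" using perm_opr_norm[OF act] bounded_oprsI by blast
  fix a b assume "a \<in> range (perm_opr act)" "b \<in> range (perm_opr act)"
  then obtain g h where *: "a = perm_opr act g" "b = perm_opr act h" by blast
  show "opr_mult a b \<in> opr.span (range (perm_opr act))"
    unfolding * perm_opr_mult[OF act] by (intro opr.span_base rangeI)
  show "opr_adj a \<in> opr.span (range (perm_opr act))"
    unfolding * perm_opr_adj[OF act] by (intro opr.span_base rangeI)
qed

lemma perm_opr_in: "perm_opr act g \<in> act_algebra act"
  unfolding act_algebra_def by (intro subsetD[OF opr_closure_subset] opr.span_base rangeI)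

lemma cstar_act_algebra:
  assumes act: "free_action act" shows "cstar_algebra (act_algebra act)"
  unfolding act_algebra_def
proof (rule cstar_algebra_closure[OF star_closed_perm_span[OF act]])
  show "opr_one \<in> opr.span (range (perm_opr act))"
    unfolding perm_opr_zero[OF act, symmetric] by (intro opr.span_base rangeI)
qed

text \<open>Matrix entries are continuous in the operator norm.\<close>

lemma opr_closure_entry_eq:
  assumes T: "T \<in> opr_closure M" and M: "\<And>a. a \<in> M \<Longrightarrow> a x y = a x' y'"
  shows "T x y = T x' y'"
proof (rule ccontr)
  assume "T x y \<noteq> T x' y'"
  then have e: "cmod (T x y - T x' y') / 3 > 0" by simp
  from opr_closureD[OF T this] obtain a where a: "a \<in> M" "opr_norm_le (T - a) (cmod (T x y - T x' y') / 3)" by blast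
  have "T x y - T x' y' = (T - a) x y - (T - a) x' y'" using M[OF a(1)] by simp
  then have "cmod (T x y - T x' y') = cmod ((T - a) x y - (T - a) x' y')" by (simp only:)
  then have "cmod (T x y - T x' y') \<le> cmod (T x y - T x' y') / 3 + cmod (T x y - T x' y') / 3"
    using norm_triangle_ineq4[of "(T - a) x y" "(T - a) x' y'"]
      opr_norm_le_entry[OF a(2), of x y] opr_norm_le_entry[OF a(2), of x' y'] by linarith
  then show False using e by linarith
qed

lemma opr_closure_entry_zero:
  assumes T: "T \<in> opr_closure M" and M: "\<And>a. a \<in> M \<Longrightarrow> a x y = 0"
  shows "T x y = 0"
proof (rule ccontr)
  assume "T x y \<noteq> 0"
  then have e: "cmod (T x y) / 2 > 0" by simp
  from opr_closureD[OF T this] obtain a where a: "a \<in> M" "opr_norm_le (T - a) (cmod (T x y) / 2)" by blast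
  show False using opr_norm_le_entry[OF a(2), of x y] M[OF a(1)] e by simp
qed

lemma opr_span_entry_zero:
  assumes "a \<in> opr.span M" "\<And>b. b \<in> M \<Longrightarrow> b x y = 0" shows "a x y = 0"
  using assms(1) by (induction rule: opr.span_induct_alt) (auto simp: assms(2) opr_scale_def)

lemma opr_span_entry_eq:
  assumes "a \<in> opr.span M" "\<And>b. b \<in> M \<Longrightarrow> b x y = b x' y'" shows "a x y = a x' y'"
  using assms(1) by (induction rule: opr.span_induct_alt) (auto simp: assms(2) opr_scale_def)

lemma act_algebra_support:
  assumes "a \<in> act_algebra act" "a x y \<noteq> 0" shows "\<exists>g. x = act g y"
proof (rule ccontr)
  assume n: "\<nexists>g. x = act g y"
  have "a x y = 0"
    by (rule opr_closure_entry_zero[OF assms(1)[unfolded act_algebra_def]], erule opr_span_entry_zero)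
       (use n in \<open>auto simp: perm_opr_def\<close>)
  then show False using assms(2) by simp
qed

lemma reduced_group_algebra_entry:
  assumes "b \<in> reduced_group_algebra" shows "b x y = b (x - y) 0"
  by (rule opr_closure_entry_eq[OF assms[unfolded reduced_group_algebra_def]], erule opr_span_entry_eq)
     (auto simp: lam_def algebra_simps eq_diff_eq)

lemma spatial_tensor_support:
  assumes T: "T \<in> spatial_tensor (act_algebra act) (act_algebra act')" and nz: "T (x, y) (x', y') \<noteq> 0"
  shows "\<exists>g. x = act g x'" "\<exists>g. y = act' g y'"
proof -
  have "T (x, y) (x', y') = 0" if *: "(\<nexists>g. x = act g x') \<or> (\<nexists>g. y = act' g y')"
  proof (rule opr_closure_entry_zero[OF T[unfolded spatial_tensor_def alg_tensor_def]], erule opr_span_entry_zero)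
    fix t assume "t \<in> {opr_tensor a b |a b. a \<in> act_algebra act \<and> b \<in> act_algebra act'}"
    then obtain a b where t: "t = opr_tensor a b" "a \<in> act_algebra act" "b \<in> act_algebra act'" by blast
    have "a x x' = 0 \<or> b y y' = 0"
      using * act_algebra_support[OF t(2), of x x'] act_algebra_support[OF t(3), of y y'] by blast
    then show "t (x, y) (x', y') = 0" by (auto simp: t(1) opr_tensor_def)
  qed
  then show "\<exists>g. x = act g x'" "\<exists>g. y = act' g y'" using nz by blast+
qed

lemma star_hom_block:
  assumes A: "cstar_algebra A" and inj: "\<And>p q. k p = k q \<Longrightarrow> f p = f q \<Longrightarrow> p = q"
    and supp: "\<And>S p y. S \<in> A \<Longrightarrow> S (f p) y \<noteq> 0 \<Longrightarrow> \<exists>q. k q = k p \<and> f q = y"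
  shows "star_hom A bounded_oprs (block_opr k f)"
  unfolding star_hom_def
proof (intro conjI ballI allI)
  fix a assume a: "a \<in> A"
  show "block_opr k f a \<in> bounded_oprs"
    by (rule bounded_block[OF inj]) (use a cstarD(4)[OF A] in auto)
  show "block_opr k f (opr_scale c a) = opr_scale c (block_opr k f a)" for c by (rule block_opr_scale)
  show "block_opr k f (opr_adj a) = opr_adj (block_opr k f a)" by (rule block_opr_adj)
  fix b assume "b \<in> A"
  show "block_opr k f (a + b) = block_opr k f a + block_opr k f b" by (rule block_opr_add)
  show "block_opr k f (opr_mult a b) = opr_mult (block_opr k f a) (block_opr k f b)"
    by (rule block_opr_mult[OF inj supp[OF a]])
qed (rule block_opr_one[OF inj])

definition diag_orbit :: "('g \<Rightarrow> 'x \<Rightarrow> 'x) \<Rightarrow> ('g \<Rightarrow> 'y \<Rightarrow> 'y) \<Rightarrow> 'x \<times> 'y \<Rightarrow> ('x \<times> 'y) set" where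
  "diag_orbit act act' p = {(act g (fst p), act' g (snd p)) | g. True}"

text \<open>The *-homomorphism \<open>\<lambda>\<^sub>g \<mapsto> \<lambda>\<^sub>g \<otimes> \<lambda>\<^sub>g\<close>: Fell absorption \<open>a \<mapsto> W (a \<otimes> 1) W\<^sup>*\<close>, written out in matrix entries. The
  entry of \<open>a\<close> is kept if the two points lie in the same orbit of the diagonal action.\<close>

definition diag_hom :: "('g \<Rightarrow> 'x \<Rightarrow> 'x) \<Rightarrow> ('g \<Rightarrow> 'y \<Rightarrow> 'y) \<Rightarrow> 'x opr \<Rightarrow> ('x \<times> 'y) opr" where
  "diag_hom act act' = block_opr (diag_orbit act act') fst"

lemma diag_orbit_eq_iff:
  fixes act :: "'g::group_add \<Rightarrow> 'x \<Rightarrow> 'x"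
  assumes a: "free_action act" "free_action act'"
  shows "diag_orbit act act' p = diag_orbit act act' q \<longleftrightarrow>
    (\<exists>g. fst p = act g (fst q) \<and> snd p = act' g (snd q))"
proof
  assume eq: "diag_orbit act act' p = diag_orbit act act' q"
  have "p = (act 0 (fst p), act' 0 (snd p))" by (simp add: free_actionD[OF a(1)] free_actionD[OF a(2)])
  then have "p \<in> diag_orbit act act' p" unfolding diag_orbit_def by blast
  then have "p \<in> diag_orbit act act' q" unfolding eq .
  then show "\<exists>g. fst p = act g (fst q) \<and> snd p = act' g (snd q)" unfolding diag_orbit_def by auto
next
  assume "\<exists>g. fst p = act g (fst q) \<and> snd p = act' g (snd q)"
  then obtain g where g: "fst p = act g (fst q)" "snd p = act' g (snd q)" by blast
  have 1: "(act h (fst p), act' h (snd p)) = (act (h + g) (fst q), act' (h + g) (snd q))" for h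
    by (simp add: g free_actionD[OF a(1)] free_actionD[OF a(2)])
  have 2: "(act h (fst q), act' h (snd q)) = (act (h - g) (fst p), act' (h - g) (snd p))" for h
    by (simp add: g flip: free_actionD(2)[OF a(1)] free_actionD(2)[OF a(2)])
  show "diag_orbit act act' p = diag_orbit act act' q"
    unfolding diag_orbit_def using 1 2 by blast
qed

lemma diag_orbit_inj:
  assumes a: "free_action act" "free_action act'"
    and eq: "diag_orbit act act' p = diag_orbit act act' q" and f: "fst p = fst q"
  shows "p = q"
proof -
  obtain g where g: "fst p = act g (fst q)" "snd p = act' g (snd q)"
    using eq unfolding diag_orbit_eq_iff[OF a] by blast
  then have "g = 0" using free_actionD(3)[OF a(1), of g "fst q"] f by simp
  then show ?thesis using g f by (simp add: prod_eq_iff free_actionD[OF a(2)])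
qed

lemma diag_orbit_move:
  assumes a: "free_action act" "free_action act'" and x: "fst p = act g x"
  shows "diag_orbit act act' (x, act' (- g) (snd p)) = diag_orbit act act' p"
proof -
  have "fst p = act g (fst (x, act' (- g) (snd p))) \<and> snd p = act' g (snd (x, act' (- g) (snd p)))"
    using x by (simp add: free_actionD[OF a(2)])
  then show ?thesis using diag_orbit_eq_iff[OF a] by metis
qed

lemma diag_hom_perm:
  assumes a: "free_action act" "free_action act'"
  shows "diag_hom act act' (perm_opr act g) = opr_tensor (perm_opr act g) (perm_opr act' g)"
proof (intro ext)
  fix p q
  show "diag_hom act act' (perm_opr act g) p q = opr_tensor (perm_opr act g) (perm_opr act' g) p q"
    using free_action_inj[OF a(1)]
    by (auto simp: diag_hom_def block_opr_def perm_opr_def opr_tensor_def diag_orbit_eq_iff[OF a]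
        split: prod.splits)
qed

lemma diag_hom_norm:
  assumes a: "free_action act" "free_action act'" and T: "opr_norm_le T C"
  shows "opr_norm_le (diag_hom act act' T) C"
  unfolding diag_hom_def by (rule opr_norm_le_block[OF diag_orbit_inj[OF a] T])

lemma diag_hom_linear: "opr_linear_on A (diag_hom act act')"
  unfolding opr_linear_on_def diag_hom_def by (intro conjI ballI allI block_opr_add block_opr_scale)

lemma diag_hom_star_hom:
  fixes act :: "'g::group_add \<Rightarrow> 'x \<Rightarrow> 'x" and act' :: "'g \<Rightarrow> 'y \<Rightarrow> 'y"
  assumes a: "free_action act" "free_action act'"
  shows "star_hom (act_algebra act) (spatial_tensor (act_algebra act) (act_algebra act')) (diag_hom act act')"
proof -
  have "star_hom (act_algebra act) bounded_oprs (diag_hom act act')"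
    unfolding diag_hom_def
  proof (rule star_hom_block[OF cstar_act_algebra[OF a(1)] diag_orbit_inj[OF a]])
    fix S and p :: "'x \<times> 'y" and y assume "S \<in> act_algebra act" "S (fst p) y \<noteq> 0"
    from act_algebra_support[OF this] obtain g where g: "fst p = act g y" by blast
    show "\<exists>q. diag_orbit act act' q = diag_orbit act act' p \<and> fst q = y"
      using diag_orbit_move[OF a g] by (intro exI[of _ "(y, act' (- g) (snd p))"]) simp
  qed
  moreover have "diag_hom act act' T \<in> spatial_tensor (act_algebra act) (act_algebra act')"
    if T: "T \<in> act_algebra act" for T
  proof (rule opr_linear_on_closure_image[OF opr.subspace_UNIV diag_hom_linear subset_UNIV _ UNIV_I T[unfolded act_algebra_def], where L = 1])
    note st = cstarD[OF cstar_algebra_spatial_tensor[OF cstar_act_algebra[OF a(1)] cstar_act_algebra[OF a(2)]]]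
    show "opr_closure (spatial_tensor (act_algebra act) (act_algebra act')) = spatial_tensor (act_algebra act) (act_algebra act')"
      by (rule st(2))
    fix b assume b: "b \<in> opr.span (range (perm_opr act))"
    show "diag_hom act act' b \<in> spatial_tensor (act_algebra act) (act_algebra act')"
    proof (rule opr_linear_on_span_image[OF opr.subspace_UNIV diag_hom_linear st(5) subset_UNIV _ b])
      fix m assume "m \<in> range (perm_opr act)"
      then obtain g where m: "m = perm_opr act g" by blast
      show "diag_hom act act' m \<in> spatial_tensor (act_algebra act) (act_algebra act')"
        unfolding m diag_hom_perm[OF a] by (intro opr_tensor_in_spatial perm_opr_in)
    qed
  qed (simp_all add: diag_hom_norm[OF a])
  ultimately show ?thesis unfolding star_hom_def by blast
qed

text \<open>Both tensor products of homomorphisms are block diagonal. The entries of either side at two triples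
  are those of \<open>T\<close> at the first components if a single group element moves all three components of
  the second triple to those of the first, and \<open>0\<close> otherwise.\<close>

lemma diag_hom_coassociative:
  fixes act :: "'g::group_add \<Rightarrow> 'x \<Rightarrow> 'x" and act' :: "'g \<Rightarrow> 'y \<Rightarrow> 'y"
  assumes a: "free_action act" "free_action act'" and T: "T \<in> act_algebra act"
  shows "opr_assoc (tensor_hom (act_algebra act) (act_algebra act') (diag_hom act act') id (diag_hom act act' T))
    = tensor_hom (act_algebra act) (act_algebra act') id (diag_hom act' act') (diag_hom act act' T)"
proof -
  let ?A = "act_algebra act" and ?B = "act_algebra act'"
  let ?L = "block_opr (\<lambda>p. diag_orbit act act' (fst p)) (\<lambda>p. (fst (fst p), snd p))"
  let ?R = "block_opr (\<lambda>p. diag_orbit act' act' (snd p)) (\<lambda>p. (fst p, fst (snd p)))"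
  note A = cstar_act_algebra[OF a(1)] and B = cstar_act_algebra[OF a(2)]
  have D: "diag_hom act act' T \<in> spatial_tensor ?A ?B"
    using diag_hom_star_hom[OF a] T unfolding star_hom_def by blast
  have "star_hom (spatial_tensor ?A ?B) bounded_oprs ?L"
  proof (rule star_hom_block[OF cstar_algebra_spatial_tensor[OF A B]])
    show "p = q" if "diag_orbit act act' (fst p) = diag_orbit act act' (fst q)"
      "(fst (fst p), snd p) = (fst (fst q), snd q)" for p q :: "('x \<times> 'y) \<times> 'y"
      using diag_orbit_inj[OF a that(1)] that(2) by (simp add: prod_eq_iff)
    fix S and p :: "('x \<times> 'y) \<times> 'y" and y
    assume S: "S \<in> spatial_tensor ?A ?B" "S (fst (fst p), snd p) y \<noteq> 0"
    obtain x z where y: "y = (x, z)" by (cases y)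
    from spatial_tensor_support(1)[OF S(1) S(2)[unfolded y]] obtain g where g: "fst (fst p) = act g x" by blast
    show "\<exists>q. diag_orbit act act' (fst q) = diag_orbit act act' (fst p) \<and> (fst (fst q), snd q) = y"
      using diag_orbit_move[OF a g] by (intro exI[of _ "((x, act' (- g) (snd (fst p))), z)"]) (simp add: y)
  qed
  then have L: "tensor_hom ?A ?B (diag_hom act act') id (diag_hom act act' T) = ?L (diag_hom act act' T)"
    by (rule tensor_hom_eq[OF A B _ _ D]) (auto simp: diag_hom_def block_opr_def opr_tensor_def fun_eq_iff)
  have "star_hom (spatial_tensor ?A ?B) bounded_oprs ?R"
  proof (rule star_hom_block[OF cstar_algebra_spatial_tensor[OF A B]])
    show "p = q" if "diag_orbit act' act' (snd p) = diag_orbit act' act' (snd q)"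
      "(fst p, fst (snd p)) = (fst q, fst (snd q))" for p q :: "'x \<times> 'y \<times> 'y"
      using diag_orbit_inj[OF a(2) a(2) that(1)] that(2) by (simp add: prod_eq_iff)
    fix S and p :: "'x \<times> 'y \<times> 'y" and y
    assume S: "S \<in> spatial_tensor ?A ?B" "S (fst p, fst (snd p)) y \<noteq> 0"
    obtain x z where y: "y = (x, z)" by (cases y)
    from spatial_tensor_support(2)[OF S(1) S(2)[unfolded y]] obtain g where g: "fst (snd p) = act' g z" by blast
    show "\<exists>q. diag_orbit act' act' (snd q) = diag_orbit act' act' (snd p) \<and> (fst q, fst (snd q)) = y"
      using diag_orbit_move[OF a(2) a(2) g] by (intro exI[of _ "(x, z, act' (- g) (snd (snd p)))"]) (simp add: y)
  qed
  then have R: "tensor_hom ?A ?B id (diag_hom act' act') (diag_hom act act' T) = ?R (diag_hom act act' T)"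
    by (rule tensor_hom_eq[OF A B _ _ D]) (auto simp: diag_hom_def block_opr_def opr_tensor_def fun_eq_iff)
  show ?thesis unfolding L R
  proof (intro ext)
    fix p q :: "'x \<times> 'y \<times> 'y"
    obtain x y z x' y' z' where pq: "p = (x, y, z)" "q = (x', y', z')" by (cases p, cases q) auto
    let ?c = "diag_orbit act act' (x, y) = diag_orbit act act' (x', y')"
    let ?d = "diag_orbit act act' (x, z) = diag_orbit act act' (x', z')"
    let ?e = "diag_orbit act' act' (y, z) = diag_orbit act' act' (y', z')"
    have 1: "g = h" if "x = act g x'" "x = act h x'" for g h
      using free_action_inj[OF a(1), of g x' h] that by simp
    have 2: "g = h" if "y = act' g y'" "y = act' h y'" for g h
      using free_action_inj[OF a(2), of g y' h] that by simp
    have "?c \<and> ?d \<longleftrightarrow> ?c \<and> ?e"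
      unfolding diag_orbit_eq_iff[OF a] diag_orbit_eq_iff[OF a(2) a(2)] fst_conv snd_conv
      using 1 2 by blast
    moreover have "opr_assoc (?L (diag_hom act act' T)) p q = (if ?c \<and> ?d then T x x' else 0)"
      by (simp add: pq opr_assoc_def block_opr_def diag_hom_def)
    moreover have "?R (diag_hom act act' T) p q = (if ?c \<and> ?e then T x x' else 0)"
      by (simp add: pq block_opr_def diag_hom_def)
    ultimately show "opr_assoc (?L (diag_hom act act' T)) p q = ?R (diag_hom act act' T) p q"
      by (simp only:)
  qed
qed

section \<open>The group algebra as an object of the category\<close>

text \<open>Approximate \<open>a \<otimes> b\<close> in one factor at a time.\<close>

lemma spatial_tensor_perm_dense:
  fixes act :: "'g::group_add \<Rightarrow> 'x \<Rightarrow> 'x" and act' :: "'g \<Rightarrow> 'y \<Rightarrow> 'y"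
  assumes a: "free_action act" "free_action act'"
    and G: "G \<subseteq> spatial_tensor (act_algebra act) (act_algebra act')"
    and perm: "\<And>g h. opr_tensor (perm_opr act g) (perm_opr act' h) \<in> G"
  shows "opr_closure (opr.span G) = spatial_tensor (act_algebra act) (act_algebra act')"
proof
  let ?T = "spatial_tensor (act_algebra act) (act_algebra act')"
  note T = cstarD[OF cstar_algebra_spatial_tensor[OF cstar_act_algebra[OF a(1)] cstar_act_algebra[OF a(2)]]]
  show "opr_closure (opr.span G) \<subseteq> ?T"
    by (rule opr_closure_minimal[OF opr.span_minimal[OF G T(5)] T(2)])
  let ?E = "range (\<lambda>(g, h). opr_tensor (perm_opr act g) (perm_opr act' h))"
  let ?K = "opr_closure (opr.span ?E)"
  have bd: "perm_opr act g \<in> bounded_oprs" "perm_opr act' g \<in> bounded_oprs" for g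
    using perm_opr_norm[OF a(1)] perm_opr_norm[OF a(2)] by (blast intro: bounded_oprsI)+
  have "star_closed (opr.span ?E)"
  proof (rule star_closed_span)
    show "?E \<subseteq> bounded_oprs" using bounded_tensor[OF bd] by auto
    fix s t assume "s \<in> ?E" "t \<in> ?E"
    then obtain g h g' h' where *: "s = opr_tensor (perm_opr act g) (perm_opr act' h)"
      "t = opr_tensor (perm_opr act g') (perm_opr act' h')" by auto
    have in_E: "opr_tensor (perm_opr act g) (perm_opr act' h) \<in> opr.span ?E" for g h
      by (rule opr.span_base) (rule range_eqI[of _ _ "(g, h)"], simp)
    show "opr_mult s t \<in> opr.span ?E"
      unfolding * opr_mult_tensor[OF bd(1) bd(1) bd(2) bd(2)] perm_opr_mult[OF a(1)] perm_opr_mult[OF a(2)]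
      by (rule in_E)
    show "opr_adj s \<in> opr.span ?E"
      unfolding * opr_adj_tensor perm_opr_adj[OF a(1)] perm_opr_adj[OF a(2)] by (rule in_E)
  qed
  then have K: "opr.subspace ?K" by (rule star_closed_subspace[OF star_closed_closure])
  have Kc: "opr_closure ?K = ?K" by (rule opr_closure_idem)
  have E: "opr_tensor (perm_opr act g) (perm_opr act' h) \<in> ?K" for g h
    by (rule subsetD[OF opr_closure_subset], rule opr.span_base) (rule range_eqI[of _ _ "(g, h)"], simp)
  have 1: "opr_tensor (perm_opr act g) b \<in> ?K" if b: "b \<in> act_algebra act'" for g b
  proof (rule opr_linear_on_closure_image[OF opr.subspace_UNIV opr_linear_tensor(2) subset_UNIV _ UNIV_I b[unfolded act_algebra_def] _ Kc, where L = 1])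
    fix m assume m: "m \<in> opr.span (range (perm_opr act'))"
    show "opr_tensor (perm_opr act g) m \<in> ?K"
      by (rule opr_linear_on_span_image[OF opr.subspace_UNIV opr_linear_tensor(2) K subset_UNIV _ m]) (elim rangeE, simp only: E)
  qed (simp_all only: opr_norm_le_tensor perm_opr_norm[OF a(1)] zero_le_one)
  have 2: "opr_tensor c b \<in> ?K" if c: "c \<in> act_algebra act" and b: "b \<in> act_algebra act'" for c b
  proof -
    obtain D where D: "opr_norm_le b D"
      using b cstarD(4)[OF cstar_act_algebra[OF a(2)]] unfolding bounded_oprs_def by blast
    show ?thesis
    proof (rule opr_linear_on_closure_image[OF opr.subspace_UNIV opr_linear_tensor(1) subset_UNIV _ UNIV_I c[unfolded act_algebra_def] _ Kc, where L = D])
      show "opr_norm_le (opr_tensor s b) (D * C)" if "opr_norm_le s C" for s :: "'x opr" and C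
        using opr_norm_le_tensor[OF that D] by (simp only: mult.commute)
      fix m assume m: "m \<in> opr.span (range (perm_opr act))"
      show "opr_tensor m b \<in> ?K"
        by (rule opr_linear_on_span_image[OF opr.subspace_UNIV opr_linear_tensor(1) K subset_UNIV _ m]) (elim rangeE, simp only: 1[OF b])
    qed (rule opr_norm_le_nonneg[OF D])
  qed
  have "alg_tensor (act_algebra act) (act_algebra act') \<subseteq> ?K"
    unfolding alg_tensor_def
  proof (rule opr.span_minimal[OF _ K], rule subsetI)
    fix t assume "t \<in> {opr_tensor c b |c b. c \<in> act_algebra act \<and> b \<in> act_algebra act'}"
    then obtain c b where t: "t = opr_tensor c b" "c \<in> act_algebra act" "b \<in> act_algebra act'" by blast
    show "t \<in> ?K" unfolding t(1) by (rule 2[OF t(2,3)])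
  qed
  then have "?T \<subseteq> ?K" unfolding spatial_tensor_def by (rule opr_closure_minimal[OF _ Kc])
  moreover have "?E \<subseteq> G" by (clarsimp simp only: image_subset_iff split_beta perm)
  ultimately show "?T \<subseteq> opr_closure (opr.span G)"
    using opr_closure_mono[OF opr.span_mono] by blast
qed

text \<open>\<open>\<Delta>(\<lambda>\<^sub>g) (1 \<otimes> \<lambda>\<^sub>-\<^sub>g\<^sub>+\<^sub>h) = \<lambda>\<^sub>g \<otimes> \<lambda>\<^sub>h\<close>\<close>

lemma diag_hom_dense_right:
  assumes a: "free_action act" "free_action act'"
  shows "opr_closure (opr.span {opr_mult (diag_hom act act' b) (opr_tensor opr_one q) | b q.
      b \<in> act_algebra act \<and> q \<in> act_algebra act'}) = spatial_tensor (act_algebra act) (act_algebra act')"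
    (is "opr_closure (opr.span ?G) = ?T")
proof (rule spatial_tensor_perm_dense[OF a])
  note A = cstarD[OF cstar_act_algebra[OF a(1)]] and B = cstarD[OF cstar_act_algebra[OF a(2)]]
  note T = cstarD[OF cstar_algebra_spatial_tensor[OF cstar_act_algebra[OF a(1)] cstar_act_algebra[OF a(2)]]]
  have "diag_hom act act' b \<in> ?T" if "b \<in> act_algebra act" for b
    using diag_hom_star_hom[OF a] that unfolding star_hom_def by blast
  then show "?G \<subseteq> ?T" using star_closedD(6)[OF T(1)] opr_tensor_in_spatial[OF A(3)] by blast
  fix g h
  have bd: "perm_opr act g \<in> bounded_oprs" "opr_one \<in> bounded_oprs"
    "perm_opr act' g \<in> bounded_oprs" "perm_opr act' (- g + h) \<in> bounded_oprs"
    using perm_opr_norm[OF a(1)] perm_opr_norm[OF a(2)] opr_norm_le_one by (blast intro: bounded_oprsI)+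
  have "opr_mult (diag_hom act act' (perm_opr act g)) (opr_tensor opr_one (perm_opr act' (- g + h)))
     = opr_tensor (perm_opr act g) (perm_opr act' h)"
    unfolding diag_hom_perm[OF a] opr_mult_tensor[OF bd] opr_mult_one_right perm_opr_mult[OF a(2)]
    by (simp add: add.assoc[symmetric])
  then show "opr_tensor (perm_opr act g) (perm_opr act' h) \<in> ?G"
    using perm_opr_in[of act g] perm_opr_in[of act' "- g + h"] by (metis (mono_tags, lifting) mem_Collect_eq)
qed

text \<open>\<open>\<Delta>(\<lambda>\<^sub>h) (\<lambda>\<^sub>-\<^sub>h\<^sub>+\<^sub>g \<otimes> 1) = \<lambda>\<^sub>g \<otimes> \<lambda>\<^sub>h\<close>\<close>

lemma diag_hom_dense_left:
  assumes a: "free_action act"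
  shows "opr_closure (opr.span {opr_mult (diag_hom act act b) (opr_tensor q opr_one) | b q.
      b \<in> act_algebra act \<and> q \<in> act_algebra act}) = spatial_tensor (act_algebra act) (act_algebra act)"
    (is "opr_closure (opr.span ?G) = ?T")
proof (rule spatial_tensor_perm_dense[OF a a])
  note A = cstarD[OF cstar_act_algebra[OF a]]
  note T = cstarD[OF cstar_algebra_spatial_tensor[OF cstar_act_algebra[OF a] cstar_act_algebra[OF a]]]
  have "diag_hom act act b \<in> ?T" if "b \<in> act_algebra act" for b
    using diag_hom_star_hom[OF a a] that unfolding star_hom_def by blast
  then show "?G \<subseteq> ?T" using star_closedD(6)[OF T(1)] opr_tensor_in_spatial[OF _ A(3)] by blast
  fix g h
  have bd: "perm_opr act h \<in> bounded_oprs" "perm_opr act (- h + g) \<in> bounded_oprs"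
    "perm_opr act h \<in> bounded_oprs" "opr_one \<in> bounded_oprs"
    using perm_opr_norm[OF a] opr_norm_le_one by (blast intro: bounded_oprsI)+
  have "opr_mult (diag_hom act act (perm_opr act h)) (opr_tensor (perm_opr act (- h + g)) opr_one)
     = opr_tensor (perm_opr act g) (perm_opr act h)"
    unfolding diag_hom_perm[OF a a] opr_mult_tensor[OF bd] opr_mult_one_right perm_opr_mult[OF a]
    by (simp add: add.assoc[symmetric])
  then show "opr_tensor (perm_opr act g) (perm_opr act h) \<in> ?G"
    using perm_opr_in[of act h] perm_opr_in[of act "- h + g"] by (metis (mono_tags, lifting) mem_Collect_eq)
qed

lemma cqg_act_algebra:
  assumes a: "free_action act" shows "cqg (act_algebra act) (diag_hom act act)"
  unfolding cqg_def
  using cstar_act_algebra[OF a] diag_hom_star_hom[OF a a] diag_hom_coassociative[OF a a]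
    diag_hom_dense_right[OF a a] diag_hom_dense_left[OF a] by blast

text \<open>The dual of \<open>\<Gamma>\<close> acts on the reduced group algebra by the comultiplication. The image of \<open>\<lambda>\<^sub>g\<close> is \<open>\<lambda>\<^sub>g\<close>
  itself with coefficient \<open>\<lambda>\<^sub>g\<close>, so that spheres and the trace are preserved.\<close>

lemma qiso_object_act_algebra:
  fixes act :: "'g::group_add \<Rightarrow> 'q \<Rightarrow> 'q" and S :: "'g set"
  assumes a: "free_action act"
  shows "qiso_object S (act_algebra act) (diag_hom act act) (diag_hom (+) act)"
  unfolding qiso_object_def
proof (intro conjI allI ballI)
  show "cqg (act_algebra act) (diag_hom act act)" by (rule cqg_act_algebra[OF a])
  show "cqg_action (act_algebra act) (diag_hom act act) reduced_group_algebra (diag_hom (+) act)"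
    unfolding cqg_action_def reduced_group_algebra_eq
    using diag_hom_star_hom[OF free_action_plus a] diag_hom_coassociative[OF free_action_plus a]
      diag_hom_dense_right[OF free_action_plus a] by blast
  show "trace_slice (diag_hom (+) act b) = opr_scale (canonical_trace b) opr_one" for b :: "'g opr"
  proof (intro ext)
    fix y y' :: 'q
    have "diag_orbit (+) act (0, y) = diag_orbit (+) act (0, y') \<longleftrightarrow> y = y'"
      unfolding diag_orbit_eq_iff[OF free_action_plus a] by (simp add: free_actionD(1)[OF a])
    then show "trace_slice (diag_hom (+) act b) y y' = opr_scale (canonical_trace b) opr_one y y'"
      by (simp add: trace_slice_def diag_hom_def block_opr_def opr_scale_def opr_one_def canonical_trace_def)
  qed
  fix r and b :: "'g opr" assume b: "b \<in> length_sphere_span S r"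
  show "diag_hom (+) act b \<in> alg_tensor (length_sphere_span S r) (act_algebra act)"
    unfolding alg_tensor_def
  proof (rule opr_linear_on_span_image[OF opr.subspace_UNIV diag_hom_linear opr.subspace_span subset_UNIV _ b[unfolded length_sphere_span_def]])
    fix m :: "'g opr" assume "m \<in> lam ` {g. word_length S g = r}"
    then obtain g where g: "m = lam g" "word_length S g = r" by blast
    have "opr_tensor (lam g) (perm_opr act g) \<in> alg_tensor (length_sphere_span S r) (act_algebra act)"
      unfolding length_sphere_span_def using g(2) by (intro opr_tensor_in_alg perm_opr_in opr.span_base imageI CollectI)
    then show "diag_hom (+) act m \<in> opr.span {opr_tensor a b |a b. a \<in> length_sphere_span S r \<and> b \<in> act_algebra act}"
      unfolding g(1) lam_eq_perm_opr diag_hom_perm[OF free_action_plus a] alg_tensor_def .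
  qed
qed

text \<open>Since \<open>'g\<close> is countable, \<open>'q\<close> is in bijection with \<open>'g \<times> 'q\<close>, on which the group
  acts freely by translating the first factor.\<close>

lemma free_action_exists:
  fixes S :: "'g::group_add set"
  assumes inf: "infinite (UNIV :: 'q set)" and S: "finite S" "symmetric_generating_set S"
  obtains act :: "'g \<Rightarrow> 'q \<Rightarrow> 'q" where "free_action act"
proof -
  have "(UNIV :: 'g set) \<subseteq> sum_list ` lists S"
  proof
    fix g :: 'g
    from S(2) obtain ws where "set ws \<subseteq> S" "sum_list ws = g" unfolding symmetric_generating_set_def by blast
    then show "g \<in> sum_list ` lists S" by (auto simp: lists_eq_set image_iff)
  qed
  moreover have "countable (sum_list ` lists S)" using S(1) by (intro countable_image countable_lists countable_finite)
  ultimately have "countable (UNIV :: 'g set)" by (rule countable_subset)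
  then obtain f1 :: "'g \<Rightarrow> nat" where f1: "inj f1" unfolding countable_def by blast
  obtain f2 :: "nat \<Rightarrow> 'q" where f2: "inj f2" using infinite_countable_subset[OF inf] by blast
  have "inj (f2 \<circ> f1)" using f1 f2 by (rule inj_compose[rotated])
  then have "\<exists>f. inj_on f (UNIV :: 'g set) \<and> f ` UNIV \<subseteq> (UNIV :: 'q set)" by blast
  from card_of_Times_infinite[OF inf UNIV_not_empty this[unfolded card_of_ordLeq]]
  have "\<exists>f. bij_betw f ((UNIV :: 'g set) \<times> (UNIV :: 'q set)) (UNIV :: 'q set)"
    unfolding card_of_ordIso by blast
  then obtain b :: "'g \<times> 'q \<Rightarrow> 'q" where b: "bij b" by auto
  define act where "act g y = b (g + fst (inv b y), snd (inv b y))" for g y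
  have ib: "inv b (b x) = x" for x by (simp add: inv_f_f bij_is_inj[OF b])
  have bi: "b (inv b y) = y" for y by (simp add: surj_f_inv_f bij_is_surj[OF b])
  have "free_action act"
    unfolding free_action_def
  proof (intro conjI allI impI)
    show "act 0 x = x" for x by (simp add: act_def bi)
    show "act (g + h) x = act g (act h x)" for g h x by (simp add: act_def ib add.assoc)
    fix g x assume "act g x = x"
    then have "b (g + fst (inv b x), snd (inv b x)) = b (inv b x)" by (simp add: act_def bi)
    then have "(g + fst (inv b x), snd (inv b x)) = inv b x" using bij_is_inj[OF b] by (simp add: inj_eq)
    then have "g + fst (inv b x) = 0 + fst (inv b x)" by (simp add: prod_eq_iff)
    then show "g = 0" by (rule add_right_imp_eq)
  qed
  then show ?thesis by (rule that)
qed

section \<open>The coefficients of the action\<close>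

text \<open>The entry \<open>q\<^bsub>h,g\<^esub>\<close> in \<open>\<alpha>(\<lambda>\<^sub>g) = \<Sum>\<^sub>h \<lambda>\<^sub>h \<otimes> q\<^bsub>h,g\<^esub>\<close>: the matrix of \<open>\<lambda>\<^sub>k\<close> has the entry \<open>1\<close> at \<open>(h, 0)\<close> exactly if
  \<open>k = h\<close>.\<close>

definition action_coeff :: "('g::group_add opr \<Rightarrow> ('g \<times> 'q) opr) \<Rightarrow> 'g \<Rightarrow> 'g \<Rightarrow> 'q opr" where
  "action_coeff \<alpha> h g = opr_slice (\<alpha> (lam g)) h 0"

lemma lam_in: "lam g \<in> reduced_group_algebra"
  unfolding reduced_group_algebra_eq lam_eq_perm_opr by (rule perm_opr_in)

lemma cstar_reduced_group_algebra: "cstar_algebra reduced_group_algebra"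
  unfolding reduced_group_algebra_eq by (rule cstar_act_algebra[OF free_action_plus])

lemma qiso_objectD:
  assumes "qiso_object S Q \<Delta> \<alpha>"
  shows "cstar_algebra Q" "star_hom Q (spatial_tensor Q Q) \<Delta>"
    "star_hom reduced_group_algebra (spatial_tensor reduced_group_algebra Q) \<alpha>"
  using assms unfolding qiso_object_def cqg_def cqg_action_def by blast+

lemma action_sliced:
  assumes o: "qiso_object S Q \<Delta> \<alpha>" and b: "b \<in> reduced_group_algebra"
  shows "\<alpha> b \<in> spatial_tensor reduced_group_algebra Q" "opr_slice (\<alpha> b) h g \<in> Q"
proof -
  show 1: "\<alpha> b \<in> spatial_tensor reduced_group_algebra Q"
    using qiso_objectD(3)[OF o] b unfolding star_hom_def by blast
  show "opr_slice (\<alpha> b) h g \<in> Q"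
    using 1 spatial_tensor_sliced[OF cstarD(1)[OF cstar_reduced_group_algebra] cstarD(1,2)[OF qiso_objectD(1)[OF o]]]
    unfolding sliced_def by blast
qed

lemma action_coeff_in:
  assumes "qiso_object S Q \<Delta> \<alpha>" shows "action_coeff \<alpha> h g \<in> Q"
  unfolding action_coeff_def by (rule action_sliced(2)[OF assms lam_in])

lemma action_coeff_zero:
  assumes o: "qiso_object S Q \<Delta> \<alpha>" and l: "word_length S h \<noteq> word_length S g"
  shows "action_coeff \<alpha> h g = 0"
proof (intro ext)
  fix y y'
  have "lam g \<in> length_sphere_span S (word_length S g)"
    unfolding length_sphere_span_def by (intro opr.span_base imageI CollectI refl)
  then have "\<alpha> (lam g) \<in> alg_tensor (length_sphere_span S (word_length S g)) Q"
    using o unfolding qiso_object_def by blast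
  then have "\<alpha> (lam g) (h, y) (0, y') = 0"
    unfolding alg_tensor_def
  proof (rule opr_span_entry_zero)
    fix t assume "t \<in> {opr_tensor a b |a b. a \<in> length_sphere_span S (word_length S g) \<and> b \<in> Q}"
    then obtain a b where t: "t = opr_tensor a b" "a \<in> length_sphere_span S (word_length S g)" by blast
    have "a h 0 = 0"
      by (rule opr_span_entry_zero[OF t(2)[unfolded length_sphere_span_def]])
         (use l in \<open>auto simp: lam_def\<close>)
    then show "t (h, y) (0, y') = 0" by (simp add: t(1) opr_tensor_def)
  qed
  then show "action_coeff \<alpha> h g y y' = 0 y y'" by (simp add: action_coeff_def opr_slice_def)
qed

text \<open>The entry \<open>(h, 0)\<close> picks out the coefficient of \<open>\<lambda>\<^sub>h\<close>. Both sides
  are bounded and linear in \<open>b\<close>, so \<open>b\<close> may be taken to be a group element.\<close>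

lemma action_slice:
  fixes S :: "'g::group_add set"
  assumes o: "qiso_object S Q \<Delta> \<alpha>" and b: "b \<in> reduced_group_algebra"
    and F: "finite F" "\<And>g. word_length S g = word_length S h \<Longrightarrow> g \<in> F"
  shows "opr_slice (\<alpha> b) h 0 = (\<Sum>g\<in>F. opr_scale (b g 0) (action_coeff \<alpha> h g))"
proof -
  note B = cstarD[OF cstar_reduced_group_algebra] and T = cstarD[OF cstar_algebra_spatial_tensor[OF cstar_reduced_group_algebra qiso_objectD(1)[OF o]]]
  have \<alpha>: "star_map reduced_group_algebra \<alpha>" by (rule star_hom_imp_star_map[OF qiso_objectD(3)[OF o] T(4)])
  have "\<forall>g. \<exists>C. opr_norm_le (action_coeff \<alpha> h g) C"
    using action_coeff_in[OF o] cstarD(4)[OF qiso_objectD(1)[OF o]] unfolding bounded_oprs_def by blast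
  then obtain C where C: "\<And>g. opr_norm_le (action_coeff \<alpha> h g) (C g)" by metis
  have C0: "0 \<le> C g" for g by (rule opr_norm_le_nonneg[OF C])
  show ?thesis
  proof (rule bounded_linear_eq_on_closure[where A = reduced_group_algebra and M = "range lam"
        and f = "\<lambda>b. opr_slice (\<alpha> b) h 0" and g = "\<lambda>b. \<Sum>g\<in>F. opr_scale (b g 0) (action_coeff \<alpha> h g)"
        and K = 1 and L = "\<Sum>g\<in>F. C g" and a = b])
    show "opr.subspace reduced_group_algebra" by (rule B(5))
    show "range lam \<subseteq> reduced_group_algebra" using lam_in by blast
    show "reduced_group_algebra \<subseteq> opr_closure (opr.span (range lam))" by (simp add: reduced_group_algebra_def)
    show "opr_linear_on reduced_group_algebra (\<lambda>b. opr_slice (\<alpha> b) h 0)"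
      unfolding opr_linear_on_def
      by (intro conjI ballI allI; simp only: star_mapD(2,3)[OF \<alpha>] opr_slice_add opr_slice_scale)
    show "opr_linear_on reduced_group_algebra (\<lambda>b. \<Sum>g\<in>F. opr_scale (b g 0) (action_coeff \<alpha> h g))"
      unfolding opr_linear_on_def
      by (intro conjI ballI allI ext)
         (simp_all add: opr_sum_apply opr_scale_def distrib_right sum.distrib sum_distrib_left mult.assoc)
    show "opr_norm_le (opr_slice (\<alpha> a) h 0) (1 * D)" if "a \<in> reduced_group_algebra" "opr_norm_le a D" for a D
      unfolding mult_1 by (rule opr_norm_le_slice[OF star_map_contractive[OF B(1,2) \<alpha> that]])
    show "opr_norm_le (\<Sum>g\<in>F. opr_scale (a g 0) (action_coeff \<alpha> h g)) ((\<Sum>g\<in>F. C g) * D)"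
      if a: "opr_norm_le a D" for a :: "'g opr" and D
      using F(1)
    proof (induction F rule: finite_induct)
      case empty
      show ?case unfolding sum.empty opr_norm_le_zero by simp
    next
      case (insert g F)
      have "opr_norm_le (opr_scale (a g 0) (action_coeff \<alpha> h g)) (C g * D)"
        by (rule opr_norm_le_mono[OF opr_norm_le_scale[OF C]])
           (simp add: mult.commute[of "C g"] mult_right_mono opr_norm_le_entry[OF a] C0)
      from opr_norm_le_add[OF this insert.IH] show ?case
        unfolding sum.insert[OF insert(1,2)] distrib_right .
    qed
    show "0 \<le> (\<Sum>g\<in>F. C g)" by (rule sum_nonneg) (rule C0)
    fix a :: "'g opr" assume "a \<in> range lam"
    then obtain k where k: "a = lam k" by blast
    show "opr_slice (\<alpha> a) h 0 = (\<Sum>g\<in>F. opr_scale (a g 0) (action_coeff \<alpha> h g))"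
    proof (cases "k \<in> F")
      case True
      have "(\<Sum>g\<in>F. opr_scale (a g 0) (action_coeff \<alpha> h g)) = (\<Sum>g\<in>F. if g = k then action_coeff \<alpha> h g else 0)"
        by (intro sum.cong refl) (auto simp: k lam_def opr_scale_def fun_eq_iff)
      also have "\<dots> = action_coeff \<alpha> h k" using True F(1) by (simp only: sum.delta if_True)
      finally show ?thesis unfolding k action_coeff_def ..
    next
      case False
      then have "word_length S h \<noteq> word_length S k" using F(2)[of k] by fastforce
      from action_coeff_zero[OF o this] have "opr_slice (\<alpha> a) h 0 = 0" unfolding k action_coeff_def .
      moreover have "(\<Sum>g\<in>F. opr_scale (a g 0) (action_coeff \<alpha> h g)) = 0"
        using False by (intro sum.neutral ballI) (auto simp: k lam_def opr_scale_def fun_eq_iff)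
      ultimately show ?thesis by (simp only:)
    qed
  qed (simp_all add: b)
qed

text \<open>Compare the \<open>\<lambda>\<^sub>h\<close>-coefficients of the two sides of \<open>(id \<otimes> \<phi>)(\<alpha>(\<lambda>\<^sub>g)) = \<lambda>\<^sub>g \<otimes> \<lambda>\<^sub>g\<close>.\<close>

lemma qiso_morphism_coeff:
  fixes act :: "'g::group_add \<Rightarrow> 'r \<Rightarrow> 'r"
  assumes o: "qiso_object S Q \<Delta> \<alpha>" and a: "free_action act"
    and \<phi>: "qiso_morphism Q \<Delta> \<alpha> (act_algebra act) (diag_hom act act) (diag_hom (+) act) \<phi>"
  shows "\<phi> (action_coeff \<alpha> h g) = (if h = g then perm_opr act g else 0)"
proof -
  have hom: "star_hom Q (act_algebra act) \<phi>" using \<phi> unfolding qiso_morphism_def cqg_morphism_def by blast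
  have "tensor_hom reduced_group_algebra Q id \<phi> (\<alpha> (lam g)) = diag_hom (+) act (lam g)"
    using \<phi> lam_in unfolding qiso_morphism_def by blast
  moreover have "tensor_hom reduced_group_algebra Q id \<phi> (\<alpha> (lam g)) = ampl \<phi> (\<alpha> (lam g))"
    by (rule tensor_hom_id_eq_ampl[OF cstar_reduced_group_algebra qiso_objectD(1)[OF o] hom
          cstarD(4)[OF cstar_act_algebra[OF a]] action_sliced(1)[OF o lam_in]])
  ultimately have "ampl \<phi> (\<alpha> (lam g)) = opr_tensor (lam g) (perm_opr act g)"
    unfolding lam_eq_perm_opr diag_hom_perm[OF free_action_plus a] by (simp only:)
  then have "opr_slice (ampl \<phi> (\<alpha> (lam g))) h 0 = opr_slice (opr_tensor (lam g) (perm_opr act g)) h 0"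
    by (simp only:)
  then have "\<phi> (action_coeff \<alpha> h g) = opr_scale (lam g h 0) (perm_opr act g)"
    unfolding slice_ampl opr_slice_tensor action_coeff_def .
  then show ?thesis by (auto simp: lam_def opr_scale_def fun_eq_iff)
qed

section \<open>Invariant subspaces and Schur's lemma\<close>

text \<open>For fixed \<open>y\<close>, \<open>y'\<close> the entries \<open>u i j y y'\<close> form a complex matrix. In this way a representation is a
  family of complex matrices indexed by the pairs \<open>(y, y')\<close>, i.e. a module over a free algebra, and
  intertwiners and invariant subspaces are those of modules. Irreducibility, which is defined
  by orthogonal projections, becomes simplicity of the module.\<close>

lemma sum_delta_mult:
  fixes f :: "'i \<Rightarrow> complex"
  assumes "finite I" "i \<in> I"
  shows "(\<Sum>j\<in>I. (if i = j then 1 else 0) * f j) = f i" "(\<Sum>j\<in>I. f j * (if j = i then 1 else 0)) = f i"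
proof -
  have "(\<Sum>j\<in>I. (if i = j then 1 else 0) * f j) = (\<Sum>j\<in>I. if i = j then f j else 0)"
    by (intro sum.cong) auto
  then show "(\<Sum>j\<in>I. (if i = j then 1 else 0) * f j) = f i" using assms by simp
  have "(\<Sum>j\<in>I. f j * (if j = i then 1 else 0)) = (\<Sum>j\<in>I. if j = i then f j else 0)"
    by (intro sum.cong) auto
  then show "(\<Sum>j\<in>I. f j * (if j = i then 1 else 0)) = f i" using assms by simp
qed

text \<open>Vectors in \<open>\<complex>\<^sup>I\<close> are extended by zero, so that equal vectors are equal functions.\<close>

definition coord_subspace :: "'i set \<Rightarrow> ('i \<Rightarrow> complex) set \<Rightarrow> bool" where
  "coord_subspace I K \<longleftrightarrow> (\<forall>v\<in>K. \<forall>i. i \<notin> I \<longrightarrow> v i = 0) \<and> (\<lambda>i. 0) \<in> K \<and>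
     (\<forall>v\<in>K. \<forall>w\<in>K. (\<lambda>i. v i + w i) \<in> K) \<and> (\<forall>c. \<forall>v\<in>K. (\<lambda>i. c * v i) \<in> K)"

lemma coord_subspaceD:
  assumes "coord_subspace I K"
  shows "v \<in> K \<Longrightarrow> i \<notin> I \<Longrightarrow> v i = 0" "(\<lambda>i. 0) \<in> K"
    "v \<in> K \<Longrightarrow> w \<in> K \<Longrightarrow> (\<lambda>i. v i + w i) \<in> K" "v \<in> K \<Longrightarrow> (\<lambda>i. c * v i) \<in> K"
  using assms by (simp_all add: coord_subspace_def)

lemma coord_subspace_sum:
  assumes K: "coord_subspace I K" and F: "finite F" "\<And>e. e \<in> F \<Longrightarrow> v e \<in> K"
  shows "(\<lambda>i. \<Sum>e\<in>F. c e * v e i) \<in> K"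
  using F
proof (induction F rule: finite_induct)
  case empty
  show ?case using K unfolding coord_subspace_def by simp
next
  case (insert e F)
  have "(\<lambda>i. c e * v e i) \<in> K" "(\<lambda>i. \<Sum>e\<in>F. c e * v e i) \<in> K"
    using K insert unfolding coord_subspace_def by auto
  then have "(\<lambda>i. c e * v e i + (\<Sum>e\<in>F. c e * v e i)) \<in> K"
    by (rule coord_subspaceD(3)[OF K])
  then show ?case using insert(1,2) by simp
qed

text \<open>The projection is \<open>\<Sum>\<^sub>e e e\<^sup>*\<close> for an orthonormal family in \<open>K\<close> of maximal size. The trace of
  this matrix is the size of the family, and its diagonal entries are at most \<open>1\<close>, so that the size
  is bounded.\<close>

lemma orthogonal_projection_exists:
  assumes I: "finite I" and K: "coord_subspace I K"
  obtains p where "\<And>i j. p i j = cnj (p j i)" "\<And>j. (\<lambda>i. p i j) \<in> K"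
    "\<And>v i. v \<in> K \<Longrightarrow> (\<Sum>j\<in>I. p i j * v j) = v i"
proof -
  define ip where "ip v w = (\<Sum>i\<in>I. cnj (v i) * w i)" for v w :: "'a \<Rightarrow> complex"
  define orth where "orth E \<longleftrightarrow> finite E \<and> E \<subseteq> K \<and> (\<forall>e\<in>E. \<forall>e'\<in>E. ip e e' = (if e = e' then 1 else 0))" for E
  define p where "p E i j = (\<Sum>e\<in>E. e i * cnj (e j))" for E i and j :: 'a
  have p_adj: "p E i j = cnj (p E j i)" for E i j
    by (simp add: p_def mult.commute)
  have p_apply: "(\<Sum>j\<in>I. p E i j * v j) = (\<Sum>e\<in>E. ip e v * e i)" for E i v
    unfolding p_def ip_def sum_distrib_right
    by (subst sum.swap) (simp add: mult_ac sum_distrib_left)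
  have p_idem: "(\<Sum>k\<in>I. p E i k * p E k j) = p E i j" if E: "orth E" for E i j
  proof -
    have "ip e (\<lambda>k. p E k j) = cnj (e j)" if e: "e \<in> E" for e
    proof -
      have "ip e (\<lambda>k. p E k j) = (\<Sum>e'\<in>E. ip e e' * cnj (e' j))"
        unfolding ip_def p_def sum_distrib_left sum_distrib_right
        by (subst sum.swap) (simp add: mult_ac)
      also have "\<dots> = (\<Sum>e'\<in>E. (if e = e' then 1 else 0) * cnj (e' j))"
        using E e by (intro sum.cong refl) (simp add: orth_def)
      also have "\<dots> = cnj (e j)" using E e by (intro sum_delta_mult) (simp_all add: orth_def)
      finally show ?thesis .
    qed
    then have "(\<Sum>k\<in>I. p E i k * p E k j) = (\<Sum>e\<in>E. cnj (e j) * e i)"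
      unfolding p_apply by (intro sum.cong refl) simp
    then show ?thesis by (simp add: p_def mult.commute)
  qed
  have diag: "Re (p E i i) \<le> 1" if E: "orth E" and i: "i \<in> I" for E i
  proof -
    have pii: "p E i i = of_real (\<Sum>e\<in>E. (cmod (e i))\<^sup>2)"
      by (simp add: p_def complex_norm_square del: of_real_power)
    let ?a = "\<Sum>e\<in>E. (cmod (e i))\<^sup>2"
    have "p E i i = (\<Sum>k\<in>I. p E i k * p E k i)" by (rule p_idem[OF E, symmetric])
    also have "\<dots> = (\<Sum>k\<in>I. p E i k * cnj (p E i k))"
      by (intro sum.cong refl arg_cong2[where f = times] p_adj)
    finally have "p E i i = of_real (\<Sum>k\<in>I. (cmod (p E i k))\<^sup>2)"
      by (simp add: complex_norm_square del: of_real_power)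
    then have "?a = (\<Sum>k\<in>I. (cmod (p E i k))\<^sup>2)" unfolding pii of_real_eq_iff .
    also have "\<dots> \<ge> (cmod (p E i i))\<^sup>2" using i I by (intro member_le_sum) auto
    finally have "?a\<^sup>2 \<le> ?a" unfolding pii norm_of_real by (simp add: sum_nonneg)
    then have "?a * ?a \<le> 1 * ?a" by (simp add: power2_eq_square)
    then have "?a \<le> 1" by (cases "?a = 0") (auto dest: mult_right_le_imp_le simp: less_le sum_nonneg)
    then show ?thesis by (simp add: pii)
  qed
  have bound: "card E \<le> card I" if E: "orth E" for E
  proof -
    have "of_nat (card E) = (\<Sum>e\<in>E. ip e e)" using E by (simp add: orth_def)
    also have "\<dots> = (\<Sum>i\<in>I. p E i i)"
      unfolding ip_def p_def by (subst sum.swap) (simp add: mult.commute)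
    finally have "real (card E) = (\<Sum>i\<in>I. Re (p E i i))" by (metis Re_complex_of_real of_real_of_nat_eq Re_sum)
    also have "\<dots> \<le> (\<Sum>i\<in>I. 1)" by (intro sum_mono diag E)
    finally show ?thesis by simp
  qed
  have "orth {}" by (simp add: orth_def)
  then have "\<exists>E. orth E \<and> (\<forall>E'. orth E' \<longrightarrow> card E' \<le> card E)"
    by (rule ex_has_greatest_nat[where b = "Suc (card I)"]) (auto simp: less_Suc_eq_le bound)
  then obtain E where E: "orth E" and mx: "\<And>E'. orth E' \<Longrightarrow> card E' \<le> card E" by blast
  have finE: "finite E" and EK: "\<And>e. e \<in> E \<Longrightarrow> e \<in> K"
    and on: "\<And>e e'. e \<in> E \<Longrightarrow> e' \<in> E \<Longrightarrow> ip e e' = (if e = e' then 1 else 0)"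
    using E unfolding orth_def by auto
  show ?thesis
  proof (rule that[of "p E"])
    show "p E i j = cnj (p E j i)" for i j by (rule p_adj)
    show "(\<lambda>i. p E i j) \<in> K" for j
      using coord_subspace_sum[OF K finE, where v = "\<lambda>e. e" and c = "\<lambda>e. cnj (e j)", OF EK] by (simp add: p_def mult.commute)
    fix v i assume v: "v \<in> K"
    define w where "w i = v i + (\<Sum>e\<in>E. (- ip e v) * e i)" for i
    have wK: "w \<in> K"
    proof -
      have "(\<lambda>i. \<Sum>e\<in>E. (- ip e v) * e i) \<in> K" by (rule coord_subspace_sum[OF K finE, where v = "\<lambda>e. e", OF EK])
      from coord_subspaceD(3)[OF K v this] show ?thesis unfolding w_def .
    qed
    have ew: "ip e w = 0" if e: "e \<in> E" for e
    proof -
      have "ip e w = ip e v + (\<Sum>e'\<in>E. (- ip e' v) * ip e e')"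
        unfolding ip_def[of e] w_def distrib_left sum.distrib sum_distrib_left
        by (subst (2) sum.swap) (simp add: mult_ac)
      also have "(\<Sum>e'\<in>E. (- ip e' v) * ip e e') = (\<Sum>e'\<in>E. (- ip e' v) * (if e' = e then 1 else 0))"
        by (intro sum.cong refl) (simp add: on[OF e])
      also have "\<dots> = - ip e v" using finE e by (rule sum_delta_mult)
      finally show ?thesis by simp
    qed
    have "w i = 0"
    proof (rule ccontr)
      assume nz: "w i \<noteq> 0"
      then have i: "i \<in> I" using coord_subspaceD(1)[OF K wK] by auto
      define N where "N = (\<Sum>i\<in>I. (cmod (w i))\<^sup>2)"
      have "0 < (cmod (w i))\<^sup>2" using nz by simp
      also have "\<dots> \<le> N" unfolding N_def using i I by (intro member_le_sum) auto
      finally have N: "0 < N" .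
      have ww: "ip w w = of_real N"
        by (simp add: ip_def N_def complex_norm_square mult.commute del: of_real_power)
      \<comment> \<open>\<open>c w\<close> is a unit vector in \<open>K\<close> orthogonal to \<open>E\<close>, contradicting maximality\<close>
      define c where "c = complex_of_real (1 / sqrt N)"
      have cc: "cnj c * c * of_real N = 1"
      proof -
        have "cnj c * c * of_real N = of_real (1 / sqrt N * (1 / sqrt N) * N)"
          unfolding c_def complex_cnj_complex_of_real of_real_mult ..
        moreover have "1 / sqrt N * (1 / sqrt N) * N = 1"
          using N by (simp add: field_simps flip: power2_eq_square)
        ultimately show ?thesis by (simp only: of_real_1)
      qed
      define f where "f i = c * w i" for i
      have ff: "ip f f = 1"
      proof -
        have "ip f f = cnj c * c * ip w w" by (simp add: ip_def f_def sum_distrib_left mult_ac)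
        then show ?thesis using cc ww by simp
      qed
      have ef: "ip e f = 0" if "e \<in> E" for e
      proof -
        have "ip e f = c * ip e w" by (simp add: ip_def f_def sum_distrib_left mult_ac)
        then show ?thesis using ew[OF that] by simp
      qed
      have fe: "ip f e = 0" if "e \<in> E" for e
      proof -
        have "ip f e = cnj (ip e f)" by (simp add: ip_def mult.commute)
        then show ?thesis using ef[OF that] by simp
      qed
      have fE: "f \<notin> E" using ff ef by force
      have fK: "f \<in> K" unfolding f_def by (rule coord_subspaceD(4)[OF K wK])
      have "orth (insert f E)"
        unfolding orth_def using finE EK fK ff ef fe on fE by (auto)
      from mx[OF this] fE finE show False by simp
    qed
    then show "(\<Sum>j\<in>I. p E i j * v j) = v i"
      unfolding p_apply by (simp add: w_def sum_negf)
  qed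
qed

text \<open>The orthogonal projection onto an invariant subspace is an invariant projection.\<close>

lemma irreducible_invariant_subspace:
  assumes irr: "irreducible_rep Q \<Delta> I u" and K: "coord_subspace I K"
    and inv: "\<And>v y y'. v \<in> K \<Longrightarrow> (\<lambda>i. if i \<in> I then \<Sum>j\<in>I. u i j y y' * v j else 0) \<in> K"
  shows "(\<forall>v\<in>K. \<forall>i. v i = 0) \<or> (\<forall>v. (\<forall>i. i \<notin> I \<longrightarrow> v i = 0) \<longrightarrow> v \<in> K)"
proof -
  have I: "finite I" using irr unfolding irreducible_rep_def unitary_rep_def by blast
  obtain p where adj: "\<And>i j. p i j = cnj (p j i)" and pK: "\<And>j. (\<lambda>i. p i j) \<in> K"
    and pv: "\<And>v i. v \<in> K \<Longrightarrow> (\<Sum>j\<in>I. p i j * v j) = v i"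
    by (rule orthogonal_projection_exists[OF I K]) blast
  have "invariant_proj I u p"
    unfolding invariant_proj_def
  proof (intro conjI ballI)
    fix i j assume ij: "i \<in> I" "j \<in> I"
    show "p i j = cnj (p j i)" by (rule adj)
    show "(\<Sum>k\<in>I. p i k * p k j) = p i j" by (rule pv[OF pK])
    show "(\<Sum>l\<in>I. opr_scale (p l j) (u i l)) = (\<Sum>k\<in>I. \<Sum>l\<in>I. opr_scale (p i k * p l j) (u k l))"
    proof (intro ext)
      fix y y'
      let ?w = "\<lambda>i. if i \<in> I then \<Sum>l\<in>I. u i l y y' * p l j else 0"
      have "(\<Sum>k\<in>I. p i k * ?w k) = ?w i" by (rule pv[OF inv[OF pK]])
      moreover have "(\<Sum>k\<in>I. p i k * ?w k) = (\<Sum>k\<in>I. \<Sum>l\<in>I. p i k * p l j * u k l y y')"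
        by (intro sum.cong refl) (simp add: sum_distrib_left mult_ac)
      ultimately show "(\<Sum>l\<in>I. opr_scale (p l j) (u i l)) y y'
        = (\<Sum>k\<in>I. \<Sum>l\<in>I. opr_scale (p i k * p l j) (u k l)) y y'"
        using ij by (simp add: opr_sum_apply opr_scale_def mult.commute)
    qed
  qed
  then consider "\<forall>i\<in>I. \<forall>j\<in>I. p i j = 0" | "\<forall>i\<in>I. \<forall>j\<in>I. p i j = (if i = j then 1 else 0)"
    using irr unfolding irreducible_rep_def by blast
  then show ?thesis
  proof cases
    case 1
    have "v i = 0" if v: "v \<in> K" for v i
    proof (cases "i \<in> I")
      case True
      then show ?thesis using pv[OF v, of i] 1 by (simp cong: sum.cong)
    next
      case False
      then show ?thesis by (rule coord_subspaceD(1)[OF K v])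
    qed
    then show ?thesis by blast
  next
    case 2
    have "v \<in> K" if v: "\<forall>i. i \<notin> I \<longrightarrow> v i = 0" for v
    proof -
      have "(\<lambda>i. \<Sum>j\<in>I. v j * p i j) \<in> K" by (rule coord_subspace_sum[OF K I pK])
      moreover have "(\<Sum>j\<in>I. v j * p i j) = v i" for i
      proof (cases "i \<in> I")
        case True
        then have "(\<Sum>j\<in>I. v j * p i j) = (\<Sum>j\<in>I. (if i = j then 1 else 0) * v j)"
          using 2 by (intro sum.cong) auto
        then show ?thesis using sum_delta_mult(1)[OF I True] by simp
      next
        case False
        then have "p i j = 0" for j using coord_subspaceD(1)[OF K pK[of j]] by blast
        then show ?thesis using v False by simp
      qed
      ultimately show ?thesis by simp
    qed
    then show ?thesis by blast
  qed
qed

definition intertwines ::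
  "'i set \<Rightarrow> ('i \<Rightarrow> 'i \<Rightarrow> 'q opr) \<Rightarrow> 'j set \<Rightarrow> ('j \<Rightarrow> 'j \<Rightarrow> 'q opr) \<Rightarrow> ('j \<Rightarrow> 'i \<Rightarrow> complex) \<Rightarrow> bool" where
  "intertwines I u J v T \<longleftrightarrow> (\<forall>j\<in>J. \<forall>i\<in>I. \<forall>y y'.
     (\<Sum>k\<in>I. T j k * u k i y y') = (\<Sum>l\<in>J. v j l y y' * T l i))"

lemma intertwiner_iff: "intertwiner I u J v T \<longleftrightarrow> intertwines I u J v T"
  by (simp add: intertwiner_def intertwines_def fun_eq_iff opr_sum_apply opr_scale_def mult.commute)

lemma intertwinesD:
  assumes "intertwines I u J v T" "j \<in> J" "i \<in> I"
  shows "(\<Sum>k\<in>I. T j k * u k i y y') = (\<Sum>l\<in>J. v j l y y' * T l i)"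
  using assms unfolding intertwines_def by blast

text \<open>\<open>T (u w) = v (T w)\<close>\<close>

lemma intertwines_apply:
  assumes T: "intertwines I u J v T" and j: "j \<in> J"
  shows "(\<Sum>k\<in>I. T j k * (\<Sum>i\<in>I. u k i y y' * w i)) = (\<Sum>l\<in>J. v j l y y' * (\<Sum>i\<in>I. T l i * w i))"
proof -
  have "(\<Sum>k\<in>I. T j k * (\<Sum>i\<in>I. u k i y y' * w i)) = (\<Sum>i\<in>I. (\<Sum>k\<in>I. T j k * u k i y y') * w i)"
    unfolding sum_distrib_left sum_distrib_right by (subst sum.swap) (simp add: mult.assoc)
  also have "\<dots> = (\<Sum>i\<in>I. (\<Sum>l\<in>J. v j l y y' * T l i) * w i)"
    by (intro sum.cong refl) (simp add: intertwinesD[OF T j])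
  also have "\<dots> = (\<Sum>l\<in>J. v j l y y' * (\<Sum>i\<in>I. T l i * w i))"
    unfolding sum_distrib_left sum_distrib_right by (subst sum.swap) (simp add: mult.assoc)
  finally show ?thesis .
qed

text \<open>The kernel of an intertwiner is an invariant subspace.\<close>

lemma intertwiner_injective:
  assumes irr: "irreducible_rep Q \<Delta> I u" and T: "intertwines I u J v T"
    and nz: "j0 \<in> J" "i0 \<in> I" "T j0 i0 \<noteq> 0"
    and w: "\<And>j. j \<in> J \<Longrightarrow> (\<Sum>k\<in>I. T j k * w k) = 0" and i: "i \<in> I"
  shows "w i = 0"
proof -
  have I: "finite I" using irr unfolding irreducible_rep_def unitary_rep_def by blast
  define K where "K = {w. (\<forall>i. i \<notin> I \<longrightarrow> w i = 0) \<and> (\<forall>j\<in>J. (\<Sum>k\<in>I. T j k * w k) = 0)}"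
  have "coord_subspace I K"
    unfolding coord_subspace_def K_def
    by (auto simp: distrib_left sum.distrib mult.left_commute[of _ c for c] simp flip: sum_distrib_left)
  moreover have "(\<lambda>i. if i \<in> I then \<Sum>j\<in>I. u i j y y' * x j else 0) \<in> K" if "x \<in> K" for x y y'
    using that intertwines_apply[OF T, of _ y y' x] by (auto simp: K_def cong: sum.cong)
  ultimately have "(\<forall>v\<in>K. \<forall>i. v i = 0) \<or> (\<forall>v. (\<forall>i. i \<notin> I \<longrightarrow> v i = 0) \<longrightarrow> v \<in> K)"
    by (rule irreducible_invariant_subspace[OF irr])
  moreover have "(\<lambda>i. if i = i0 then 1 else 0) \<notin> K"
  proof
    assume "(\<lambda>i. if i = i0 then 1 else 0) \<in> K"
    then have "(\<Sum>k\<in>I. T j0 k * (if k = i0 then 1 else 0)) = 0" using nz(1) unfolding K_def by blast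
    then show False using sum_delta_mult(2)[OF I nz(2), of "T j0"] nz(3) by simp
  qed
  ultimately have z: "\<forall>v\<in>K. \<forall>i. v i = 0" using nz(2) by fastforce
  have "(\<lambda>i. if i \<in> I then w i else 0) \<in> K" unfolding K_def using w by (simp cong: sum.cong)
  from z[rule_format, OF this, of i] show ?thesis using i by simp
qed

text \<open>The range of an intertwiner is an invariant subspace.\<close>

lemma intertwiner_surjective:
  assumes irr: "irreducible_rep Q \<Delta> J v" and T: "intertwines I u J v T" and I: "finite I"
    and nz: "j0 \<in> J" "i0 \<in> I" "T j0 i0 \<noteq> 0"
  obtains w where "\<And>j. j \<in> J \<Longrightarrow> (\<Sum>k\<in>I. T j k * w k) = x j"
proof -
  define K where "K = {z. (\<forall>j. j \<notin> J \<longrightarrow> z j = 0) \<and> (\<exists>w. \<forall>j\<in>J. (\<Sum>k\<in>I. T j k * w k) = z j)}"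
  have "coord_subspace J K"
    unfolding coord_subspace_def
  proof (intro conjI ballI allI impI)
    show "z j = 0" if "z \<in> K" "j \<notin> J" for z j using that by (simp add: K_def)
    show "(\<lambda>j. 0) \<in> K" unfolding K_def by (auto intro!: exI[of _ "\<lambda>k. 0"])
    fix z assume z: "z \<in> K"
    then obtain a where a: "\<forall>j\<in>J. (\<Sum>k\<in>I. T j k * a k) = z j" unfolding K_def by blast
    show "(\<lambda>j. c * z j) \<in> K" for c
    proof -
      have "\<forall>j\<in>J. (\<Sum>k\<in>I. T j k * (c * a k)) = c * z j"
        using a by (simp add: mult.left_commute flip: sum_distrib_left)
      then show ?thesis using z unfolding K_def by auto
    qed
    fix z' assume z': "z' \<in> K"
    then obtain b where b: "\<forall>j\<in>J. (\<Sum>k\<in>I. T j k * b k) = z' j" unfolding K_def by blast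
    have "\<forall>j\<in>J. (\<Sum>k\<in>I. T j k * (a k + b k)) = z j + z' j" using a b by (simp add: distrib_left sum.distrib)
    then show "(\<lambda>j. z j + z' j) \<in> K" using z z' unfolding K_def by auto
  qed
  moreover have "(\<lambda>j. if j \<in> J then \<Sum>l\<in>J. v j l y y' * z l else 0) \<in> K" if z: "z \<in> K" for z y y'
  proof -
    from z obtain a where a: "\<forall>j\<in>J. (\<Sum>k\<in>I. T j k * a k) = z j" unfolding K_def by blast
    have "\<forall>j\<in>J. (\<Sum>k\<in>I. T j k * (\<Sum>i\<in>I. u k i y y' * a i)) = (\<Sum>l\<in>J. v j l y y' * z l)"
      using a by (simp add: intertwines_apply[OF T] cong: sum.cong)
    then show ?thesis unfolding K_def by auto
  qed
  ultimately have "(\<forall>v\<in>K. \<forall>i. v i = 0) \<or> (\<forall>v. (\<forall>i. i \<notin> J \<longrightarrow> v i = 0) \<longrightarrow> v \<in> K)"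
    by (rule irreducible_invariant_subspace[OF irr])
  moreover have "\<exists>v\<in>K. v j0 \<noteq> 0"
  proof
    show "(\<lambda>j. if j \<in> J then T j i0 else 0) \<in> K"
      unfolding K_def using sum_delta_mult(2)[OF I nz(2), of "T _"]
      by (auto intro!: exI[of _ "\<lambda>k. if k = i0 then 1 else 0"])
    show "(if j0 \<in> J then T j0 i0 else 0) \<noteq> 0" using nz by simp
  qed
  ultimately have "(\<lambda>j. if j \<in> J then x j else 0) \<in> K" by auto
  then obtain w where "\<forall>j\<in>J. (\<Sum>k\<in>I. T j k * w k) = (if j \<in> J then x j else 0)" unfolding K_def by blast
  then show ?thesis by (intro that) auto
qed

text \<open>A right inverse exists by surjectivity, and it is a left inverse by injectivity.\<close>

lemma schur:
  assumes u: "irreducible_rep Q \<Delta> I u" and v: "irreducible_rep Q' \<Delta>' J v" and T: "intertwines I u J v T"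
    and nz: "j0 \<in> J" "i0 \<in> I" "T j0 i0 \<noteq> 0"
  shows "rep_equiv I u J v"
proof -
  have I: "finite I" and J: "finite J" using u v unfolding irreducible_rep_def unitary_rep_def by blast+
  have "\<exists>w. \<forall>j\<in>J. (\<Sum>k\<in>I. T j k * w k) = (if j = j' then 1 else 0)" for j'
    by (rule intertwiner_surjective[OF v T I nz, of "\<lambda>j. if j = j' then 1 else 0"]) blast
  then have "\<forall>j'. \<exists>w. \<forall>j\<in>J. (\<Sum>k\<in>I. T j k * w k) = (if j = j' then 1 else 0)" ..
  from choice[OF this] obtain R' where R': "\<forall>j'. \<forall>j\<in>J. (\<Sum>k\<in>I. T j k * R' j' k) = (if j = j' then 1 else 0)" ..
  define R where "R k j' = R' j' k" for k j'
  have R: "(\<Sum>k\<in>I. T j k * R k j') = (if j = j' then 1 else 0)" if "j \<in> J" for j j'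
    unfolding R_def using R' that by blast
  have L: "(\<Sum>j\<in>J. R i j * T j i') = (if i = i' then 1 else 0)" if i: "i \<in> I" "i' \<in> I" for i i'
  proof -
    have "(\<Sum>j\<in>J. R i j * T j i') - (if i = i' then 1 else 0) = 0"
    proof (rule intertwiner_injective[OF u T nz _ i(1), where w = "\<lambda>i. (\<Sum>j\<in>J. R i j * T j i') - (if i = i' then 1 else 0)"])
      fix l assume l: "l \<in> J"
      have "(\<Sum>k\<in>I. T l k * (\<Sum>j\<in>J. R k j * T j i')) = (\<Sum>j\<in>J. (\<Sum>k\<in>I. T l k * R k j) * T j i')"
        unfolding sum_distrib_left sum_distrib_right by (subst sum.swap) (simp add: mult.assoc)
      also have "\<dots> = (\<Sum>j\<in>J. (if l = j then 1 else 0) * T j i')" by (simp add: R[OF l])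
      also have "\<dots> = T l i'" using sum_delta_mult(1)[OF J l, of "\<lambda>j. T j i'"] .
      finally show "(\<Sum>k\<in>I. T l k * ((\<Sum>j\<in>J. R k j * T j i') - (if k = i' then 1 else 0))) = 0"
        using sum_delta_mult(2)[OF I i(2), of "T l"] by (simp add: right_diff_distrib sum_subtractf)
    qed
    then show ?thesis by simp
  qed
  show ?thesis unfolding rep_equiv_def intertwiner_iff using T L R by blast
qed

text \<open>Pairwise inequivalent simple modules, each mapped nontrivially into the same module \<open>q\<close>: the sum
  of the maps is injective. For the induction step consider the submodule of those \<open>w\<close> in the new
  module whose image lies in the sum of the others. It is zero or everything. In the latter case,
  expressing the image of \<open>w\<close> through the other modules gives intertwiners \<open>S\<^sub>c\<close>, one of which is
  nonzero, contradicting Schur's lemma.\<close>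

lemma inequivalent_irreducibles_independent:
  fixes d :: "'c \<Rightarrow> nat" and U :: "'c \<Rightarrow> nat \<Rightarrow> nat \<Rightarrow> 'q opr" and T :: "'c \<Rightarrow> 'g \<Rightarrow> nat \<Rightarrow> complex"
  assumes "finite C" and G: "finite G"
    and irr: "\<And>c. c \<in> C \<Longrightarrow> irreducible_rep Q \<Delta> {..<d c} (U c)"
    and T: "\<And>c. c \<in> C \<Longrightarrow> intertwines {..<d c} (U c) G q (T c)"
    and nz: "\<And>c. c \<in> C \<Longrightarrow> \<exists>g\<in>G. \<exists>k<d c. T c g k \<noteq> 0"
    and ne: "\<And>c c'. c \<in> C \<Longrightarrow> c' \<in> C \<Longrightarrow> c \<noteq> c' \<Longrightarrow> \<not> rep_equiv {..<d c} (U c) {..<d c'} (U c')"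
    and a: "\<And>g. g \<in> G \<Longrightarrow> (\<Sum>c\<in>C. \<Sum>k<d c. T c g k * a c k) = 0"
    and ck: "c \<in> C" "k < d c"
  shows "a c k = 0"
  using assms(1) irr T nz ne a ck
proof (induction C arbitrary: a c k rule: finite_induct)
  case (insert c0 C)
  note irr = insert.prems(1) and T = insert.prems(2) and nz = insert.prems(3) and ne = insert.prems(4)
  have IH: "b c k = 0" if "\<And>g. g \<in> G \<Longrightarrow> (\<Sum>c\<in>C. \<Sum>k<d c. T c g k * b c k) = 0" "c \<in> C" "k < d c" for b c k
    by (rule insert.IH) (use irr T nz ne that in auto)
  define rest where "rest b g = (\<Sum>c\<in>C. \<Sum>k<d c. T c g k * b c k)" for b g
  have rest_move: "(\<Sum>l\<in>G. q g l y y' * rest b l) = rest (\<lambda>c k. \<Sum>i<d c. U c k i y y' * b c i) g"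
    if g: "g \<in> G" for b g y y'
  proof -
    have "(\<Sum>l\<in>G. q g l y y' * rest b l) = (\<Sum>c\<in>C. \<Sum>l\<in>G. q g l y y' * (\<Sum>k<d c. T c l k * b c k))"
      unfolding rest_def sum_distrib_left[of _ _ C] by (rule sum.swap)
    also have "\<dots> = rest (\<lambda>c k. \<Sum>i<d c. U c k i y y' * b c i) g"
      unfolding rest_def using T g by (intro sum.cong refl intertwines_apply[symmetric]) auto
    finally show ?thesis .
  qed
  have T0: "intertwines {..<d c0} (U c0) G q (T c0)" and irr0: "irreducible_rep Q \<Delta> {..<d c0} (U c0)"
    using T irr by auto
  \<comment> \<open>the vectors of the new module whose image lies in the sum of the images of the others\<close>
  define K where "K = {w. (\<forall>k. k \<notin> {..<d c0} \<longrightarrow> w k = 0) \<and>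
    (\<exists>b. \<forall>g\<in>G. (\<Sum>k<d c0. T c0 g k * w k) + rest b g = 0)}"
  have sub: "coord_subspace {..<d c0} K"
    unfolding coord_subspace_def
  proof (intro conjI ballI allI impI)
    show "z j = 0" if "z \<in> K" "j \<notin> {..<d c0}" for z j using that unfolding K_def by blast
    show "(\<lambda>j. 0) \<in> K" unfolding K_def by (auto intro!: exI[of _ "\<lambda>c k. 0"] simp: rest_def)
    fix z assume z: "z \<in> K"
    then obtain b where b: "\<forall>g\<in>G. (\<Sum>k<d c0. T c0 g k * z k) + rest b g = 0" unfolding K_def by blast
    show "(\<lambda>j. x * z j) \<in> K" for x
    proof -
      have "(\<Sum>k<d c0. T c0 g k * (x * z k)) + rest (\<lambda>c k. x * b c k) g
        = x * ((\<Sum>k<d c0. T c0 g k * z k) + rest b g)" for g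
        by (simp add: rest_def distrib_left sum_distrib_left mult_ac)
      then show ?thesis using z b unfolding K_def by (auto intro!: exI[of _ "\<lambda>c k. x * b c k"])
    qed
    fix z' assume z': "z' \<in> K"
    then obtain b' where b': "\<forall>g\<in>G. (\<Sum>k<d c0. T c0 g k * z' k) + rest b' g = 0" unfolding K_def by blast
    have "(\<Sum>k<d c0. T c0 g k * (z k + z' k)) + rest (\<lambda>c k. b c k + b' c k) g
        = ((\<Sum>k<d c0. T c0 g k * z k) + rest b g) + ((\<Sum>k<d c0. T c0 g k * z' k) + rest b' g)" for g
      by (simp add: rest_def distrib_left sum.distrib)
    then show "(\<lambda>j. z j + z' j) \<in> K"
      using z z' b b' unfolding K_def by (auto intro!: exI[of _ "\<lambda>c k. b c k + b' c k"])
  qed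
  have "(\<lambda>i. if i \<in> {..<d c0} then \<Sum>j<d c0. U c0 i j y y' * z j else 0) \<in> K" if z: "z \<in> K" for z y y'
  proof -
    from z obtain b where b: "\<forall>g\<in>G. (\<Sum>k<d c0. T c0 g k * z k) + rest b g = 0" unfolding K_def by blast
    have "(\<Sum>k<d c0. T c0 g k * (\<Sum>j<d c0. U c0 k j y y' * z j))
        + rest (\<lambda>c k. \<Sum>i<d c. U c k i y y' * b c i) g = 0" if g: "g \<in> G" for g
    proof -
      have "(\<Sum>k<d c0. T c0 g k * (\<Sum>j<d c0. U c0 k j y y' * z j))
        + rest (\<lambda>c k. \<Sum>i<d c. U c k i y y' * b c i) g
        = (\<Sum>l\<in>G. q g l y y' * ((\<Sum>k<d c0. T c0 l k * z k) + rest b l))"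
        unfolding intertwines_apply[OF T0 g] rest_move[OF g, symmetric] distrib_left sum.distrib ..
      also have "\<dots> = 0" using b by (intro sum.neutral) simp
      finally show ?thesis .
    qed
    moreover have "(\<Sum>k<d c0. T c0 g k * (if k \<in> {..<d c0} then \<Sum>j<d c0. U c0 k j y y' * z j else 0))
      = (\<Sum>k<d c0. T c0 g k * (\<Sum>j<d c0. U c0 k j y y' * z j))" for g
      by (intro sum.cong) auto
    ultimately have "\<forall>g\<in>G. (\<Sum>k<d c0. T c0 g k * (if k \<in> {..<d c0} then \<Sum>j<d c0. U c0 k j y y' * z j else 0))
      + rest (\<lambda>c k. \<Sum>i<d c. U c k i y y' * b c i) g = 0" by simp
    then show ?thesis unfolding K_def by (intro CollectI conjI exI) auto
  qed
  from irreducible_invariant_subspace[OF irr0 sub this]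
  show ?case
  proof
    assume K0: "\<forall>v\<in>K. \<forall>i. v i = 0"
    have split: "(\<Sum>k<d c0. T c0 g k * a c0 k) + rest a g = 0" if "g \<in> G" for g
      using insert.prems(5)[OF that] insert(1,2) by (simp add: rest_def)
    moreover have "(\<Sum>k<d c0. T c0 g k * (if k \<in> {..<d c0} then a c0 k else 0)) = (\<Sum>k<d c0. T c0 g k * a c0 k)" for g
      by (intro sum.cong) auto
    ultimately have "\<forall>g\<in>G. (\<Sum>k<d c0. T c0 g k * (if k \<in> {..<d c0} then a c0 k else 0)) + rest a g = 0"
      by simp
    then have "(\<lambda>k. if k \<in> {..<d c0} then a c0 k else 0) \<in> K"
      unfolding K_def by (intro CollectI conjI exI) auto
    from K0[rule_format, OF this] have z: "a c0 k = 0" if "k < d c0" for k using that by (metis lessThan_iff)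
    then have "rest a g = 0" if "g \<in> G" for g using split[OF that] by simp
    then show ?thesis using IH[of a c k] z insert.prems(6,7) unfolding rest_def by auto
  next
    assume all: "\<forall>v. (\<forall>i. i \<notin> {..<d c0} \<longrightarrow> v i = 0) \<longrightarrow> v \<in> K"
    have "\<exists>b. \<forall>g\<in>G. (\<Sum>k<d c0. T c0 g k * (if k = j then 1 else 0)) + rest b g = 0" if "j < d c0" for j
    proof -
      have "(\<lambda>k. if k = j then 1 else 0) \<in> K" using all that by auto
      then show ?thesis unfolding K_def by blast
    qed
    then have "\<forall>j. \<exists>b. j < d c0 \<longrightarrow> (\<forall>g\<in>G. (\<Sum>k<d c0. T c0 g k * (if k = j then 1 else 0)) + rest b g = 0)" by blast
    from choice[OF this] obtain A where "\<forall>j. j < d c0 \<longrightarrow>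
      (\<forall>g\<in>G. (\<Sum>k<d c0. T c0 g k * (if k = j then 1 else 0)) + rest (A j) g = 0)" ..
    then have A: "(\<Sum>k<d c0. T c0 g k * (if k = j then 1 else 0)) + rest (A j) g = 0"
      if "j < d c0" "g \<in> G" for j g using that by blast
    have A': "rest (A j) g = - T c0 g j" if "j < d c0" "g \<in> G" for j g
      using A[OF that] sum_delta_mult(2)[of "{..<d c0}" j "T c0 g"] that(1) by (simp add: eq_neg_iff_add_eq_0 add.commute)
    have S: "intertwines {..<d c0} (U c0) {..<d c} (U c) (\<lambda>k j. A j c k)" if c: "c \<in> C" for c
      unfolding intertwines_def
    proof (intro ballI allI)
      fix k j y y' assume k: "k \<in> {..<d c}" and j: "j \<in> {..<d c0}"
      \<comment> \<open>the defect \<open>S u - u S\<close>, which is mapped to zero and hence vanishes by the induction hypothesis\<close>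
      define b where "b c k = (\<Sum>i<d c0. A i c k * U c0 i j y y') - (\<Sum>l<d c. U c k l y y' * A j c l)" for c k
      have "rest b g = 0" if g: "g \<in> G" for g
      proof -
        have "rest b g = (\<Sum>i<d c0. rest (A i) g * U c0 i j y y')
           - rest (\<lambda>c k. \<Sum>l<d c. U c k l y y' * A j c l) g"
        proof -
          have "(\<Sum>i<d c0. rest (A i) g * U c0 i j y y')
            = (\<Sum>c\<in>C. \<Sum>i<d c0. \<Sum>k<d c. T c g k * A i c k * U c0 i j y y')"
            unfolding rest_def sum_distrib_right by (rule sum.swap)
          also have "\<dots> = (\<Sum>c\<in>C. \<Sum>k<d c. \<Sum>i<d c0. T c g k * A i c k * U c0 i j y y')"
            by (intro sum.cong refl sum.swap)
          finally show ?thesis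
            by (simp add: rest_def b_def right_diff_distrib sum_subtractf sum_distrib_left mult.assoc)
        qed
        also have "\<dots> = (\<Sum>i<d c0. - T c0 g i * U c0 i j y y') - (\<Sum>l\<in>G. q g l y y' * (- T c0 l j))"
          unfolding rest_move[OF g, symmetric]
          by (intro arg_cong2[where f = minus] sum.cong refl) (use g j in \<open>simp_all add: A'\<close>)
        also have "\<dots> = 0" using intertwinesD[OF T0 g j, of y y'] by (simp add: sum_negf)
        finally show ?thesis .
      qed
      then have "b c k = 0" using IH[of b c k] c k unfolding rest_def by auto
      then show "(\<Sum>i<d c0. A i c k * U c0 i j y y') = (\<Sum>l<d c. U c k l y y' * A j c l)" by (simp add: b_def)
    qed
    obtain g j where gj: "g \<in> G" "j < d c0" "T c0 g j \<noteq> 0" using nz[of c0] by auto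
    then have "rest (A j) g \<noteq> 0" using A' by simp
    then obtain c k where c: "c \<in> C" "k < d c" "A j c k \<noteq> 0"
      unfolding rest_def by (metis (no_types, lifting) lessThan_iff mult_zero_right sum.neutral)
    have "rep_equiv {..<d c0} (U c0) {..<d c} (U c)"
      by (rule schur[OF irr0 irr[of c] S[OF c(1)], of k j]) (use c gj in auto)
    moreover have "c0 \<noteq> c" using c(1) insert(2) by auto
    ultimately show ?thesis using ne[of c0 c] c(1) by auto
  qed
qed simp

text \<open>More unknowns than equations: if \<open>M g p0 \<noteq> 0\<close>, the equation \<open>g\<close> is used to eliminate \<open>a p0\<close>.\<close>

lemma homogeneous_system_solution:
  fixes M :: "'g \<Rightarrow> 'p \<Rightarrow> complex"
  assumes "finite G" "finite P" "card G < card P"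
  shows "\<exists>a. (\<exists>p\<in>P. a p \<noteq> 0) \<and> (\<forall>g\<in>G. (\<Sum>p\<in>P. M g p * a p) = 0)"
  using assms
proof (induction G arbitrary: P M rule: finite_induct)
  case empty
  then obtain p where "p \<in> P" by fastforce
  then show ?case by (intro exI[of _ "\<lambda>_. 1"]) auto
next
  case (insert g G)
  show ?case
  proof (cases "\<forall>p\<in>P. M g p = 0")
    case True
    obtain a where "\<exists>p\<in>P. a p \<noteq> 0" "\<forall>g\<in>G. (\<Sum>p\<in>P. M g p * a p) = 0"
      using insert.IH[of P M] insert.prems insert.hyps by auto
    then show ?thesis using True by (intro exI[of _ a]) auto
  next
    case False
    then obtain p0 where p0: "p0 \<in> P" "M g p0 \<noteq> 0" by blast
    let ?P = "P - {p0}"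
    have "card G < card ?P" using insert p0 by (simp add: card_Diff_singleton)
    then obtain a where a: "\<exists>p\<in>?P. a p \<noteq> 0"
      "\<forall>h\<in>G. (\<Sum>p\<in>?P. (M h p - M h p0 * M g p / M g p0) * a p) = 0"
      using insert.IH[of ?P "\<lambda>h p. M h p - M h p0 * M g p / M g p0"] insert.prems by auto
    define s where "s = (\<Sum>p\<in>?P. M g p * a p)"
    define a' where "a' = a(p0 := - s / M g p0)"
    have eq: "(\<Sum>p\<in>P. M h p * a' p) = (\<Sum>p\<in>?P. M h p * a p) - M h p0 * s / M g p0" for h
    proof -
      have "(\<Sum>p\<in>P. M h p * a' p) = M h p0 * a' p0 + (\<Sum>p\<in>?P. M h p * a' p)"
        by (rule sum.remove[OF insert.prems(1) p0(1)])
      also have "(\<Sum>p\<in>?P. M h p * a' p) = (\<Sum>p\<in>?P. M h p * a p)" by (intro sum.cong) (auto simp: a'_def)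
      finally show ?thesis by (simp add: a'_def)
    qed
    have "(\<Sum>p\<in>P. M h p * a' p) = 0" if "h \<in> insert g G" for h
    proof (cases "h = g")
      case True
      then show ?thesis unfolding eq True s_def[symmetric] using p0(2) by simp
    next
      case False
      then have "h \<in> G" using that by simp
      then have "(\<Sum>p\<in>?P. (M h p - M h p0 * M g p / M g p0) * a p) = 0" using a(2) by blast
      moreover have "(\<Sum>p\<in>?P. (M h p - M h p0 * M g p / M g p0) * a p)
        = (\<Sum>p\<in>?P. M h p * a p) - M h p0 * s / M g p0"
        by (simp add: s_def left_diff_distrib sum_subtractf sum_distrib_left sum_divide_distrib mult.assoc)
      ultimately show ?thesis unfolding eq by simp
    qed
    moreover have "\<exists>p\<in>P. a' p \<noteq> 0" using a(1) by (auto simp: a'_def)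
    ultimately show ?thesis by blast
  qed
qed

lemma inequivalent_irreducibles_dim_le:
  fixes d :: "'c \<Rightarrow> nat" and U :: "'c \<Rightarrow> nat \<Rightarrow> nat \<Rightarrow> 'q opr" and T :: "'c \<Rightarrow> 'g \<Rightarrow> nat \<Rightarrow> complex"
  assumes C: "finite C" and G: "finite G"
    and irr: "\<And>c. c \<in> C \<Longrightarrow> irreducible_rep Q \<Delta> {..<d c} (U c)"
    and T: "\<And>c. c \<in> C \<Longrightarrow> intertwines {..<d c} (U c) G q (T c)"
    and nz: "\<And>c. c \<in> C \<Longrightarrow> \<exists>g\<in>G. \<exists>k<d c. T c g k \<noteq> 0"
    and ne: "\<And>c c'. c \<in> C \<Longrightarrow> c' \<in> C \<Longrightarrow> c \<noteq> c' \<Longrightarrow> \<not> rep_equiv {..<d c} (U c) {..<d c'} (U c')"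
  shows "(\<Sum>c\<in>C. d c) \<le> card G"
proof (rule ccontr)
  let ?P = "SIGMA c:C. {..<d c}"
  assume "\<not> (\<Sum>c\<in>C. d c) \<le> card G"
  then have "card G < card ?P" using C by (simp add: card_SigmaI)
  from homogeneous_system_solution[OF G _ this, of "\<lambda>g (c, k). T c g k"] C
  obtain a where a: "\<exists>p\<in>?P. a p \<noteq> 0" "\<forall>g\<in>G. (\<Sum>p\<in>?P. (case p of (c, k) \<Rightarrow> T c g k) * a p) = 0"
    by auto
  have "(\<Sum>c\<in>C. \<Sum>k<d c. T c g k * a (c, k)) = 0" if "g \<in> G" for g
    using a(2) that C by (simp add: sum.Sigma split_beta)
  from inequivalent_irreducibles_independent[OF C G irr T nz ne this] a(1) show False by auto
qed

section \<open>Equivalence of representations\<close>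

lemma intertwines_compose:
  assumes T: "intertwines I u J v T" and S: "intertwines J v K w S" 
  shows "intertwines I u K w (\<lambda>k i. \<Sum>j\<in>J. S k j * T j i)"
  unfolding intertwines_def
proof (intro ballI allI)
  fix k i y y' assume k: "k \<in> K" and i: "i \<in> I"
  have "(\<Sum>a\<in>I. (\<Sum>j\<in>J. S k j * T j a) * u a i y y') = (\<Sum>j\<in>J. S k j * (\<Sum>a\<in>I. T j a * u a i y y'))"
    unfolding sum_distrib_left sum_distrib_right by (subst sum.swap) (simp add: mult.assoc)
  also have "\<dots> = (\<Sum>j\<in>J. S k j * (\<Sum>l\<in>J. v j l y y' * T l i))"
    by (intro sum.cong refl) (simp add: intertwinesD[OF T _ i])
  also have "\<dots> = (\<Sum>l\<in>K. w k l y y' * (\<Sum>j\<in>J. S l j * T j i))"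
    by (rule intertwines_apply[OF S k])
  finally show "(\<Sum>a\<in>I. (\<Sum>j\<in>J. S k j * T j a) * u a i y y') = (\<Sum>l\<in>K. w k l y y' * (\<Sum>j\<in>J. S l j * T j i))" .
qed

lemma intertwines_inverse:
  assumes fin: "finite I" "finite J" and T: "intertwines I u J v T"
    and RT: "\<And>i i'. i \<in> I \<Longrightarrow> i' \<in> I \<Longrightarrow> (\<Sum>j\<in>J. R i j * T j i') = (if i = i' then 1 else 0)"
    and TR: "\<And>j j'. j \<in> J \<Longrightarrow> j' \<in> J \<Longrightarrow> (\<Sum>i\<in>I. T j i * R i j') = (if j = j' then 1 else 0)"
  shows "intertwines J v I u R"
  unfolding intertwines_def
proof (intro ballI allI)
  fix i j y y' assume i: "i \<in> I" and j: "j \<in> J"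
  have "(\<Sum>k\<in>J. R i k * v k j y y') = (\<Sum>k\<in>J. R i k * (\<Sum>l\<in>J. v k l y y' * (\<Sum>a\<in>I. T l a * R a j)))"
  proof (intro sum.cong refl arg_cong2[where f = times])
    fix k
    have "(\<Sum>l\<in>J. v k l y y' * (\<Sum>a\<in>I. T l a * R a j)) = (\<Sum>l\<in>J. v k l y y' * (if l = j then 1 else 0))"
      using j by (intro sum.cong refl) (simp add: TR)
    then show "v k j y y' = (\<Sum>l\<in>J. v k l y y' * (\<Sum>a\<in>I. T l a * R a j))"
      using sum_delta_mult(2)[OF fin(2) j, of "\<lambda>l. v k l y y'"] by simp
  qed
  also have "\<dots> = (\<Sum>k\<in>J. R i k * (\<Sum>b\<in>I. T k b * (\<Sum>a\<in>I. u b a y y' * R a j)))"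
    by (intro sum.cong refl arg_cong2[where f = times] intertwines_apply[OF T, symmetric])
  also have "\<dots> = (\<Sum>b\<in>I. (\<Sum>k\<in>J. R i k * T k b) * (\<Sum>a\<in>I. u b a y y' * R a j))"
    unfolding sum_distrib_left[of "R _ _"] sum_distrib_right by (subst sum.swap) (simp add: mult.assoc)
  also have "\<dots> = (\<Sum>b\<in>I. (if i = b then 1 else 0) * (\<Sum>a\<in>I. u b a y y' * R a j))"
    using i by (intro sum.cong refl) (simp add: RT)
  also have "\<dots> = (\<Sum>a\<in>I. u i a y y' * R a j)" by (rule sum_delta_mult(1)[OF fin(1) i])
  finally show "(\<Sum>k\<in>J. R i k * v k j y y') = (\<Sum>l\<in>I. u i l y y' * R l j)" .
qed

lemma rep_equivE:
  assumes "rep_equiv I u J v"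
  obtains T R where "intertwines I u J v T"
    "\<And>i i'. i \<in> I \<Longrightarrow> i' \<in> I \<Longrightarrow> (\<Sum>j\<in>J. R i j * T j i') = (if i = i' then 1 else 0)"
    "\<And>j j'. j \<in> J \<Longrightarrow> j' \<in> J \<Longrightarrow> (\<Sum>i\<in>I. T j i * R i j') = (if j = j' then 1 else 0)"
proof -
  obtain T R where *: "intertwines I u J v T"
    "\<forall>i\<in>I. \<forall>i'\<in>I. (\<Sum>j\<in>J. R i j * T j i') = (if i = i' then 1 else 0)"
    "\<forall>j\<in>J. \<forall>j'\<in>J. (\<Sum>i\<in>I. T j i * R i j') = (if j = j' then 1 else 0)"
    using assms unfolding rep_equiv_def intertwiner_iff by blast
  show ?thesis by (rule that[OF *(1)]) (rule *(2,3)[rule_format]; assumption)+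
qed

lemma rep_equiv_sym:
  assumes fin: "finite I" "finite J" and e: "rep_equiv I u J v" shows "rep_equiv J v I u"
proof -
  obtain T R where T: "intertwines I u J v T"
    and RT: "\<And>i i'. i \<in> I \<Longrightarrow> i' \<in> I \<Longrightarrow> (\<Sum>j\<in>J. R i j * T j i') = (if i = i' then 1 else 0)"
    and TR: "\<And>j j'. j \<in> J \<Longrightarrow> j' \<in> J \<Longrightarrow> (\<Sum>i\<in>I. T j i * R i j') = (if j = j' then 1 else 0)"
    by (rule rep_equivE[OF e], rule that)
  have "intertwines J v I u R" by (rule intertwines_inverse[OF fin T RT TR])
  then show ?thesis unfolding rep_equiv_def intertwiner_iff using RT TR by blast
qed

lemma rep_equiv_refl: "finite I \<Longrightarrow> rep_equiv I u I u"
  unfolding rep_equiv_def intertwiner_iff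
proof (intro exI conjI ballI)
  let ?\<delta> = "\<lambda>i j. if i = j then 1 else 0 :: complex"
  assume I: "finite I"
  show "intertwines I u I u ?\<delta>"
    unfolding intertwines_def by (simp add: sum_delta_mult[OF I])
  show "(\<Sum>j\<in>I. ?\<delta> i j * ?\<delta> j i') = ?\<delta> i i'" if "i \<in> I" for i i'
    by (rule sum_delta_mult(1)[OF I that])
  show "(\<Sum>j\<in>I. ?\<delta> i j * ?\<delta> j i') = ?\<delta> i i'" if "i \<in> I" for i i'
    by (rule sum_delta_mult(1)[OF I that])
qed

lemma matrix_inverse_compose:
  fixes T :: "'j \<Rightarrow> 'i \<Rightarrow> complex"
  assumes J: "finite J" 
    and RT: "\<And>i i'. i \<in> I \<Longrightarrow> i' \<in> I \<Longrightarrow> (\<Sum>j\<in>J. R i j * T j i') = (if i = i' then 1 else 0)"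
    and RT': "\<And>j j'. j \<in> J \<Longrightarrow> j' \<in> J \<Longrightarrow> (\<Sum>k\<in>K. R' j k * T' k j') = (if j = j' then 1 else 0)"
    and i: "i \<in> I" "i' \<in> I"
  shows "(\<Sum>k\<in>K. (\<Sum>j\<in>J. R i j * R' j k) * (\<Sum>j\<in>J. T' k j * T j i')) = (if i = i' then 1 else 0)"
proof -
  have "(\<Sum>k\<in>K. (\<Sum>j\<in>J. R i j * R' j k) * (\<Sum>j'\<in>J. T' k j' * T j' i'))
     = (\<Sum>k\<in>K. \<Sum>j\<in>J. \<Sum>j'\<in>J. R i j * (R' j k * T' k j') * T j' i')"
    by (simp add: sum_product mult.assoc)
  also have "\<dots> = (\<Sum>j\<in>J. \<Sum>k\<in>K. \<Sum>j'\<in>J. R i j * (R' j k * T' k j') * T j' i')" by (rule sum.swap)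
  also have "\<dots> = (\<Sum>j\<in>J. \<Sum>j'\<in>J. \<Sum>k\<in>K. R i j * (R' j k * T' k j') * T j' i')"
    by (intro sum.cong refl sum.swap)
  also have "\<dots> = (\<Sum>j\<in>J. \<Sum>j'\<in>J. R i j * ((if j = j' then 1 else 0) * T j' i'))"
  proof (intro sum.cong refl)
    fix j j' assume "j \<in> J" "j' \<in> J"
    have "(\<Sum>k\<in>K. R i j * (R' j k * T' k j') * T j' i') = R i j * (\<Sum>k\<in>K. R' j k * T' k j') * T j' i'"
      by (simp add: sum_distrib_left sum_distrib_right)
    then show "(\<Sum>k\<in>K. R i j * (R' j k * T' k j') * T j' i') = R i j * ((if j = j' then 1 else 0) * T j' i')"
      unfolding RT'[OF \<open>j \<in> J\<close> \<open>j' \<in> J\<close>] by simp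
  qed
  also have "\<dots> = (\<Sum>j\<in>J. R i j * T j i')"
    unfolding sum_distrib_left[symmetric]
    by (intro sum.cong refl arg_cong2[where f = times] sum_delta_mult(1)[OF J])
  finally show ?thesis unfolding RT[OF i] .
qed

lemma rep_equiv_trans:
  assumes fin: "finite J" and e: "rep_equiv I u J v" and e': "rep_equiv J v K w" shows "rep_equiv I u K w"
proof -
  obtain T R where T: "intertwines I u J v T"
    and RT: "\<And>i i'. i \<in> I \<Longrightarrow> i' \<in> I \<Longrightarrow> (\<Sum>j\<in>J. R i j * T j i') = (if i = i' then 1 else 0)"
    and TR: "\<And>j j'. j \<in> J \<Longrightarrow> j' \<in> J \<Longrightarrow> (\<Sum>i\<in>I. T j i * R i j') = (if j = j' then 1 else 0)"
    by (rule rep_equivE[OF e], rule that)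
  obtain T' R' where T': "intertwines J v K w T'"
    and RT': "\<And>i i'. i \<in> J \<Longrightarrow> i' \<in> J \<Longrightarrow> (\<Sum>j\<in>K. R' i j * T' j i') = (if i = i' then 1 else 0)"
    and TR': "\<And>j j'. j \<in> K \<Longrightarrow> j' \<in> K \<Longrightarrow> (\<Sum>i\<in>J. T' j i * R' i j') = (if j = j' then 1 else 0)"
    by (rule rep_equivE[OF e'], rule that)
  show ?thesis
    unfolding rep_equiv_def intertwiner_iff
  proof (intro exI conjI ballI)
    show "intertwines I u K w (\<lambda>k i. \<Sum>j\<in>J. T' k j * T j i)" by (rule intertwines_compose[OF T T'])
    show "(\<Sum>k\<in>K. (\<Sum>j\<in>J. R i j * R' j k) * (\<Sum>j\<in>J. T' k j * T j i')) = (if i = i' then 1 else 0)"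
      if "i \<in> I" "i' \<in> I" for i i'
      by (rule matrix_inverse_compose[OF fin RT RT' that])
    show "(\<Sum>i\<in>I. (\<Sum>j\<in>J. T' k j * T j i) * (\<Sum>j\<in>J. R i j * R' j k')) = (if k = k' then 1 else 0)"
      if "k \<in> K" "k' \<in> K" for k k'
      by (rule matrix_inverse_compose[OF fin TR' TR that])
  qed
qed

lemma equiv_irrep_rel: "equiv (irreps Q \<Delta>) (irrep_rel Q \<Delta>)"
proof (rule equivI)
  show "irrep_rel Q \<Delta> \<subseteq> irreps Q \<Delta> \<times> irreps Q \<Delta>" unfolding irrep_rel_def by auto
  show "refl_on (irreps Q \<Delta>) (irrep_rel Q \<Delta>)"
    unfolding refl_on_def irrep_rel_def using rep_equiv_refl by auto
  show "sym (irrep_rel Q \<Delta>)" unfolding sym_def irrep_rel_def using rep_equiv_sym by auto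
  show "trans (irrep_rel Q \<Delta>)" unfolding trans_def irrep_rel_def
    using rep_equiv_trans[OF finite_lessThan] by (auto; blast)
qed

text \<open>\<open>w = L x T\<close>, from \<open>T w = x T\<close> and \<open>L T = 1\<close>.\<close>

lemma rep_entries_of_left_inverse:
  assumes I: "finite I" and T: "intertwiner I w J x T"
    and L: "\<And>i i'. i \<in> I \<Longrightarrow> i' \<in> I \<Longrightarrow> (\<Sum>j\<in>J. L i j * T j i') = (if i = i' then 1 else 0)"
    and ai: "a \<in> I" "i \<in> I"
  shows "w a i = (\<Sum>j\<in>J. \<Sum>l\<in>J. opr_scale (L a j * T l i) (x j l))"
proof (intro ext)
  fix y y'
  have "(\<Sum>j\<in>J. \<Sum>l\<in>J. opr_scale (L a j * T l i) (x j l)) y y' = (\<Sum>j\<in>J. L a j * (\<Sum>l\<in>J. x j l y y' * T l i))"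
    by (simp add: opr_sum_apply opr_scale_def sum_distrib_left mult_ac)
  also have "\<dots> = (\<Sum>j\<in>J. L a j * (\<Sum>k\<in>I. T j k * w k i y y'))"
    using intertwinesD[OF T[unfolded intertwiner_iff] _ ai(2)] by (intro sum.cong refl) simp
  also have "\<dots> = (\<Sum>k\<in>I. (\<Sum>j\<in>J. L a j * T j k) * w k i y y')"
    unfolding sum_distrib_left sum_distrib_right by (subst sum.swap) (simp add: mult.assoc)
  also have "\<dots> = (\<Sum>k\<in>I. (if a = k then 1 else 0) * w k i y y')"
    using ai(1) by (intro sum.cong refl) (simp add: L)
  also have "\<dots> = w a i y y'" by (rule sum_delta_mult(1)[OF I ai(1)])
  finally show "w a i y y' = (\<Sum>j\<in>J. \<Sum>l\<in>J. opr_scale (L a j * T l i) (x j l)) y y'" ..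
qed

section \<open>Word length\<close>

lemma word_length_witness:
  assumes "symmetric_generating_set S"
  obtains ws where "length ws = word_length S g" "set ws \<subseteq> S" "sum_list ws = g"
proof -
  obtain ws where "set ws \<subseteq> S" "sum_list ws = g" using assms unfolding symmetric_generating_set_def by blast
  then have "\<exists>n. \<exists>ws. length ws = n \<and> set ws \<subseteq> S \<and> sum_list ws = g" by blast
  from LeastI_ex[OF this] show ?thesis unfolding word_length_def[symmetric] using that by blast
qed

lemma word_length_le: "set ws \<subseteq> S \<Longrightarrow> sum_list ws = g \<Longrightarrow> word_length S g \<le> length ws"
  unfolding word_length_def by (rule Least_le) blast

lemma word_length_zero: "word_length S 0 = 0"
  using word_length_le[of "[]" S 0] by simp

lemma word_length_add:
  assumes "symmetric_generating_set S" shows "word_length S (g + h) \<le> word_length S g + word_length S h"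
proof -
  obtain ws where ws: "length ws = word_length S g" "set ws \<subseteq> S" "sum_list ws = g"
    by (rule word_length_witness[OF assms])
  obtain vs where vs: "length vs = word_length S h" "set vs \<subseteq> S" "sum_list vs = h"
    by (rule word_length_witness[OF assms])
  show ?thesis using word_length_le[of "ws @ vs" S "g + h"] ws vs by simp
qed

lemma word_length_minus:
  assumes S: "symmetric_generating_set S" shows "word_length S (- g) = word_length S g"
proof -
  have le: "word_length S (- g) \<le> word_length S g" for g
  proof -
    obtain ws where ws: "length ws = word_length S g" "set ws \<subseteq> S" "sum_list ws = g"
      by (rule word_length_witness[OF S])
    have "sum_list (rev (map uminus vs)) = - sum_list vs" for vs :: "'a list"
      by (induction vs) (simp_all add: minus_add)
    moreover have "set (rev (map uminus ws)) \<subseteq> S" using ws(2) S unfolding symmetric_generating_set_def by auto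
    ultimately show ?thesis using word_length_le[of "rev (map uminus ws)" S "- g"] ws by simp
  qed
  show ?thesis using le[of g] le[of "- g"] by simp
qed

section \<open>The length of an irreducible representation\<close>

text \<open>A condition on the zero pattern of the matrix, satisfied by all operators in the closed linear span of
  the \<open>\<lambda>\<^sub>g\<close> with \<open>g \<in> F\<close>. It can be read off at a single nonzero entry.\<close>

definition supported_on :: "('g \<Rightarrow> 'x \<Rightarrow> 'x) \<Rightarrow> 'g set \<Rightarrow> 'x opr \<Rightarrow> bool" where
  "supported_on act F T \<longleftrightarrow> (\<forall>x y. T x y \<noteq> 0 \<longrightarrow> (\<exists>g\<in>F. x = act g y))"

lemma supported_on_sum:
  assumes "\<And>i. i \<in> I \<Longrightarrow> supported_on act F (T i)" shows "supported_on act F (\<Sum>i\<in>I. T i)"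
  unfolding supported_on_def
proof (intro allI impI)
  fix x y assume "(\<Sum>i\<in>I. T i) x y \<noteq> 0"
  then have "\<exists>i\<in>I. T i x y \<noteq> 0" unfolding opr_sum_apply by (meson sum.neutral)
  then show "\<exists>g\<in>F. x = act g y" using assms unfolding supported_on_def by blast
qed

lemma supported_on_scale: "supported_on act F T \<Longrightarrow> supported_on act F (opr_scale c T)"
  unfolding supported_on_def opr_scale_def by auto

lemma supported_on_mult:
  assumes a: "free_action act" and S: "supported_on act F S" and T: "supported_on act F' T"
  shows "supported_on act {g + h | g h. g \<in> F \<and> h \<in> F'} (opr_mult S T)"
  unfolding supported_on_def
proof (intro allI impI)
  fix x z assume nz: "opr_mult S T x z \<noteq> 0"
  have "\<exists>y. S x y * T y z \<noteq> 0"
  proof (rule ccontr)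
    assume "\<nexists>y. S x y * T y z \<noteq> 0"
    then have "(\<lambda>y. S x y * T y z) = (\<lambda>y. 0)" by auto
    then show False using nz by (simp add: opr_mult_def)
  qed
  then obtain y where "S x y \<noteq> 0" "T y z \<noteq> 0" by auto
  then obtain g h where "g \<in> F" "x = act g y" "h \<in> F'" "y = act h z"
    using S T unfolding supported_on_def by blast
  then show "\<exists>k\<in>{g + h | g h. g \<in> F \<and> h \<in> F'}. x = act k z"
    by (intro bexI[of _ "g + h"]) (auto simp: free_actionD(2)[OF a])
qed

lemma supported_on_adj:
  assumes a: "free_action act" and T: "supported_on act F T"
  shows "supported_on act (uminus ` F) (opr_adj T)"
  unfolding supported_on_def
proof (intro allI impI)
  fix x y assume "opr_adj T x y \<noteq> 0"
  then have "T y x \<noteq> 0" by (simp add: opr_adj_def)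
  then obtain g where g: "g \<in> F" "y = act g x" using T unfolding supported_on_def by blast
  show "\<exists>g\<in>uminus ` F. x = act g y" using g by (intro bexI[of _ "- g"]) (auto simp: free_actionD[OF a])
qed

lemma supported_on_mono: "supported_on act F T \<Longrightarrow> F \<subseteq> F' \<Longrightarrow> supported_on act F' T"
  unfolding supported_on_def by blast

text \<open>Unions of spheres: the coefficients of the action with row index in \<open>F\<close> vanish unless the column index
  is in \<open>F\<close> as well.\<close>

definition sphere_saturated :: "'g::group_add set \<Rightarrow> 'g set \<Rightarrow> bool" where
  "sphere_saturated S F \<longleftrightarrow> (\<forall>h\<in>F. \<forall>g. word_length S g = word_length S h \<longrightarrow> g \<in> F)"

definition rep_supported ::
  "('q opr \<Rightarrow> 'r opr) \<Rightarrow> ('g \<Rightarrow> 'r \<Rightarrow> 'r) \<Rightarrow> 'g set \<Rightarrow> 'i set \<Rightarrow> ('i \<Rightarrow> 'i \<Rightarrow> 'q opr) \<Rightarrow> bool" where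
  "rep_supported \<phi> act F I u \<longleftrightarrow> (\<forall>i\<in>I. \<forall>j\<in>I. supported_on act F (\<phi> (u i j)))"

text \<open>The entries of \<open>w\<close> are linear combinations of the entries of \<open>x\<close>.\<close>

lemma rep_supported_left_inverse:
  assumes Q: "opr.subspace Q" and \<phi>: "opr_linear_on Q \<phi>" and fin: "finite I" "finite J"
    and T: "intertwiner I w J x T"
    and L: "\<And>i i'. i \<in> I \<Longrightarrow> i' \<in> I \<Longrightarrow> (\<Sum>j\<in>J. L i j * T j i') = (if i = i' then 1 else 0)"
    and xQ: "\<And>j l. j \<in> J \<Longrightarrow> l \<in> J \<Longrightarrow> x j l \<in> Q"
    and x: "rep_supported \<phi> act F J x"
  shows "rep_supported \<phi> act F I w"
  unfolding rep_supported_def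
proof (intro ballI)
  fix a i assume ai: "a \<in> I" "i \<in> I"
  have sc: "opr_scale c (x j l) \<in> Q" if "j \<in> J" "l \<in> J" for c j l
    using opr.subspace_scale[OF Q xQ[OF that]] .
  have "\<phi> (w a i) = \<phi> (\<Sum>j\<in>J. \<Sum>l\<in>J. opr_scale (L a j * T l i) (x j l))"
    by (rule arg_cong[OF rep_entries_of_left_inverse[OF fin(1) T L ai]])
  also have "\<dots> = (\<Sum>j\<in>J. \<phi> (\<Sum>l\<in>J. opr_scale (L a j * T l i) (x j l)))"
    by (rule opr_linear_on_sum[OF Q \<phi> fin(2)]) (intro opr.subspace_sum[OF Q] sc)
  also have "\<dots> = (\<Sum>j\<in>J. \<Sum>l\<in>J. \<phi> (opr_scale (L a j * T l i) (x j l)))"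
    by (intro sum.cong refl opr_linear_on_sum[OF Q \<phi> fin(2)] sc)
  also have "\<dots> = (\<Sum>j\<in>J. \<Sum>l\<in>J. opr_scale (L a j * T l i) (\<phi> (x j l)))"
  proof (intro sum.cong refl)
    fix j l assume "j \<in> J" "l \<in> J"
    then show "\<phi> (opr_scale (L a j * T l i) (x j l)) = opr_scale (L a j * T l i) (\<phi> (x j l))"
      using \<phi> xQ unfolding opr_linear_on_def by blast
  qed
  finally have eq: "\<phi> (w a i) = (\<Sum>j\<in>J. \<Sum>l\<in>J. opr_scale (L a j * T l i) (\<phi> (x j l)))" .
  show "supported_on act F (\<phi> (w a i))"
    unfolding eq using x unfolding rep_supported_def
    by (intro supported_on_sum supported_on_scale) blast
qed

lemma rep_supported_equiv:
  assumes Q: "opr.subspace Q" and \<phi>: "opr_linear_on Q \<phi>" and fin: "finite I" "finite J"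
    and e: "rep_equiv I w J x" and xQ: "\<And>j l. j \<in> J \<Longrightarrow> l \<in> J \<Longrightarrow> x j l \<in> Q"
    and x: "rep_supported \<phi> act F J x"
  shows "rep_supported \<phi> act F I w"
proof -
  obtain T R where T: "intertwines I w J x T"
    and RT: "\<And>i i'. i \<in> I \<Longrightarrow> i' \<in> I \<Longrightarrow> (\<Sum>j\<in>J. R i j * T j i') = (if i = i' then 1 else 0)"
    by (rule rep_equivE[OF e], rule that)
  show ?thesis by (rule rep_supported_left_inverse[OF Q \<phi> fin T[folded intertwiner_iff] RT xQ x])
qed

lemma irrepsD:
  assumes "(n, u) \<in> irreps Q \<Delta>"
  shows "irreducible_rep Q \<Delta> {..<n} u" "0 < n" "i < n \<Longrightarrow> j < n \<Longrightarrow> u i j \<in> Q"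
    "j < n \<Longrightarrow> (\<Sum>k<n. opr_mult (opr_adj (u k j)) (u k j)) = opr_one"
proof -
  show 1: "irreducible_rep Q \<Delta> {..<n} u" using assms by (simp add: irreps_def)
  then show "0 < n" unfolding irreducible_rep_def by auto
  show "i < n \<Longrightarrow> j < n \<Longrightarrow> u i j \<in> Q" using 1 unfolding irreducible_rep_def unitary_rep_def by blast
  show "j < n \<Longrightarrow> (\<Sum>k<n. opr_mult (opr_adj (u k j)) (u k j)) = opr_one"
    using 1 unfolding irreducible_rep_def unitary_rep_def by auto
qed

text \<open>Otherwise the image of \<open>\<Sum>\<^sub>k u\<^bsub>k0\<^esub>\<^sup>* u\<^bsub>k0\<^esub> = 1\<close> would be zero.\<close>

lemma irrep_image_nonzero:
  assumes Q: "cstar_algebra Q" and \<phi>: "star_hom Q R \<phi>" and u: "(n, u) \<in> irreps Q \<Delta>"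
  shows "\<exists>i<n. \<exists>j<n. \<exists>x y. \<phi> (u i j) x y \<noteq> 0"
proof (rule ccontr)
  assume n: "\<not> ?thesis"
  have z: "\<phi> (u k 0) = 0" if "k < n" for k
    using n that irrepsD(2)[OF u] by (intro ext) auto
  note star = star_closedD[OF cstarD(1)[OF Q]]
  have uQ: "u k 0 \<in> Q" if "k < n" for k using irrepsD(2,3)[OF u] that by blast
  have lin: "opr_linear_on Q \<phi>" using \<phi> unfolding star_hom_def opr_linear_on_def by blast
  have "opr_one = \<phi> opr_one" using \<phi> unfolding star_hom_def by simp
  also have "\<dots> = \<phi> (\<Sum>k<n. opr_mult (opr_adj (u k 0)) (u k 0))" using irrepsD(4)[OF u irrepsD(2)[OF u]] by simp
  also have "\<dots> = (\<Sum>k<n. \<phi> (opr_mult (opr_adj (u k 0)) (u k 0)))"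
    by (rule opr_linear_on_sum[OF cstarD(5)[OF Q] lin finite_lessThan]) (simp add: star uQ)
  also have "\<dots> = (\<Sum>k<n. 0)"
  proof (intro sum.cong refl)
    fix k assume "k \<in> {..<n}"
    then have k: "u k 0 \<in> Q" "opr_adj (u k 0) \<in> Q" "\<phi> (u k 0) = 0" using uQ z star(7) by auto
    have "\<phi> (opr_mult (opr_adj (u k 0)) (u k 0)) = opr_mult (\<phi> (opr_adj (u k 0))) (\<phi> (u k 0))"
      using \<phi> k(1,2) unfolding star_hom_def by blast
    then show "\<phi> (opr_mult (opr_adj (u k 0)) (u k 0)) = 0" unfolding k(3) opr_mult_zero .
  qed
  finally have "(opr_one :: 'b opr) undefined undefined = (0 :: 'b opr) undefined undefined" by (simp only: sum.neutral_const)
  then show False by (simp add: opr_one_def)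
qed

text \<open>A subspace equivalent to \<open>u\<close> has Fourier coefficients, and these form an intertwiner from \<open>u\<close>
  to the matrix of coefficients of the action.\<close>

lemma full_spectrum_intertwiner:
  fixes S :: "'g::group_add set"
  assumes o: "qiso_object S Q \<Delta> \<alpha>" and fs: "full_spectrum Q \<Delta> reduced_group_algebra \<alpha>"
    and u: "(n, u) \<in> irreps Q \<Delta>"
  obtains T where "\<exists>h. \<exists>k<n. T h k \<noteq> 0"
    "\<And>F. finite F \<Longrightarrow> sphere_saturated S F \<Longrightarrow> intertwines {..<n} u F (action_coeff \<alpha>) T"
proof -
  let ?B = "reduced_group_algebra :: 'g opr set"
  define P where "P V \<longleftrightarrow> V \<subseteq> ?B \<and> (\<exists>m e v. inj_on e {..<m} \<and> opr.independent (e ` {..<m}) \<and> V = opr.span (e ` {..<m}) \<and>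
        (\<forall>j<m::nat. (\<forall>i<m. v i j \<in> Q) \<and> \<alpha> (e j) = (\<Sum>i<m. opr_tensor (e i) (v i j))) \<and>
        rep_equiv {..<m} v {..<n} u)" for V
  have ne: "opr.span (\<Union>{V. P V}) \<noteq> {0}"
    using fs u unfolding full_spectrum_def spectral_subspace_def P_def by auto
  have "\<exists>V. P V \<and> \<not> V \<subseteq> {0}"
  proof (rule ccontr)
    assume "\<nexists>V. P V \<and> \<not> V \<subseteq> {0}"
    then have "\<Union>{V. P V} \<subseteq> {0}" by blast
    then have "opr.span (\<Union>{V. P V}) \<subseteq> {0}" by (rule opr.span_minimal) (rule opr.subspace_single_0)
    moreover have "0 \<in> opr.span (\<Union>{V. P V})" by (rule opr.span_zero)
    ultimately show False using ne by blast
  qed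
  then obtain V where V: "P V" "\<not> V \<subseteq> {0}" by blast
  have VB: "V \<subseteq> ?B" using V(1) unfolding P_def by (rule conjunct1)
  from V(1)[unfolded P_def, THEN conjunct2] obtain m :: nat and e v where
    e: "opr.independent (e ` {..<m})" "V = opr.span (e ` {..<m})"
    and \<alpha>: "\<forall>j<m. (\<forall>i<m. v i j \<in> Q) \<and> \<alpha> (e j) = (\<Sum>i<m. opr_tensor (e i) (v i j))"
    and eq: "rep_equiv {..<m} v {..<n} u" by blast
  have m: "0 < m"
  proof (rule ccontr)
    assume "\<not> 0 < m"
    then have "V = {0}" unfolding e(2) by simp
    then show False using V(2) by blast
  qed
  have eB: "e j \<in> ?B" if "j < m" for j
    using VB opr.span_base[of "e j" "e ` {..<m}"] that unfolding e(2) by blast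
  have "e 0 \<noteq> 0" using opr.dependent_zero e(1) m by (metis imageI lessThan_iff)
  then obtain x x' where "e 0 x x' \<noteq> 0" by (auto simp: fun_eq_iff)
  then have "e 0 (x - x') 0 \<noteq> 0" using reduced_group_algebra_entry[OF eB[OF m], of x x'] by simp
  then obtain h0 where h0: "e 0 h0 0 \<noteq> 0" by blast
  obtain E R where E: "intertwines {..<m} v {..<n} u E"
    and RE: "\<And>i i'. i \<in> {..<m} \<Longrightarrow> i' \<in> {..<m} \<Longrightarrow> (\<Sum>j<n. R i j * E j i') = (if i = i' then 1 else 0)"
    and ER: "\<And>j j'. j \<in> {..<n} \<Longrightarrow> j' \<in> {..<n} \<Longrightarrow> (\<Sum>i<m. E j i * R i j') = (if j = j' then 1 else 0)"
    by (rule rep_equivE[OF eq], rule that)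
  have R: "intertwines {..<n} u {..<m} v R" by (rule intertwines_inverse[OF finite_lessThan finite_lessThan E RE ER])
  define T where "T h k = (\<Sum>j<m. e j h 0 * R j k)" for h k
  show ?thesis
  proof (rule that[of T])
    show "\<exists>h. \<exists>k<n. T h k \<noteq> 0"
    proof (rule ccontr)
      assume "\<not> ?thesis"
      then have z: "T h0 k = 0" if "k < n" for k using that by blast
      have "(\<Sum>k<n. T h0 k * E k 0) = (\<Sum>j<m. e j h0 0 * (\<Sum>k<n. R j k * E k 0))"
        unfolding T_def sum_distrib_left sum_distrib_right by (subst sum.swap) (simp add: mult.assoc)
      also have "\<dots> = (\<Sum>j<m. e j h0 0 * (if j = 0 then 1 else 0))"
        using m by (intro sum.cong refl) (simp add: RE)
      also have "\<dots> = e 0 h0 0" using m by (intro sum_delta_mult(2)) auto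
      finally show False using h0 z by simp
    qed
    fix F :: "'g set" assume F: "finite F" "sphere_saturated S F"
    have "intertwines {..<m} v F (action_coeff \<alpha>) (\<lambda>h j. e j h 0)"
      unfolding intertwiner_iff[symmetric] intertwiner_def
    proof (intro ballI)
      fix h j assume h: "h \<in> F" and j: "j \<in> {..<m}"
      have "opr_slice (\<alpha> (e j)) h 0 = (\<Sum>g\<in>F. opr_scale (e j g 0) (action_coeff \<alpha> h g))"
        by (rule action_slice[OF o eB F(1)]) (use j h F(2) in \<open>auto simp: sphere_saturated_def\<close>)
      moreover have "opr_slice (\<alpha> (e j)) h 0 = (\<Sum>k<m. opr_scale (e k h 0) (v k j))"
        using \<alpha> j by (simp only: lessThan_iff opr_slice_sum opr_slice_tensor)
      ultimately show "(\<Sum>k<m. opr_scale (e k h 0) (v k j)) = (\<Sum>l\<in>F. opr_scale (e j l 0) (action_coeff \<alpha> h l))"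
        by (simp only:)
    qed
    from intertwines_compose[OF R this] show "intertwines {..<n} u F (action_coeff \<alpha>) T"
      unfolding T_def .
  qed
qed

text \<open>Since \<open>\<phi>\<close> maps the matrix of coefficients to a diagonal matrix, the vector of all entries
  \<open>\<phi> (u k j) x y\<close>, \<open>k < n\<close>, is mapped by \<open>T\<close> to a vector whose \<open>h\<close>-th component vanishes
  unless \<open>x = h y\<close>. As \<open>T\<close> is injective, some component is nonzero.\<close>

lemma irrep_supported_on_sphere:
  fixes S :: "'g::group_add set"
  assumes o: "qiso_object S Q \<Delta> \<alpha>" and a: "free_action act"
    and \<phi>: "qiso_morphism Q \<Delta> \<alpha> (act_algebra act) (diag_hom act act) (diag_hom (+) act) \<phi>"
    and u: "(n, u) \<in> irreps Q \<Delta>" and F: "finite F"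
    and T: "intertwines {..<n} u F (action_coeff \<alpha>) T" and nz: "h0 \<in> F" "k0 < n" "T h0 k0 \<noteq> 0"
  shows "rep_supported \<phi> act F {..<n} u"
  unfolding rep_supported_def supported_on_def
proof (intro ballI allI impI)
  fix i j x y assume i: "i \<in> {..<n}" and j: "j \<in> {..<n}" and ne: "\<phi> (u i j) x y \<noteq> 0"
  have hom: "star_hom Q (act_algebra act) \<phi>" using \<phi> unfolding qiso_morphism_def cqg_morphism_def by blast
  have lin: "opr_linear_on Q \<phi>" using hom unfolding star_hom_def opr_linear_on_def by blast
  have scale: "\<phi> (opr_scale c b) = opr_scale c (\<phi> b)" if "b \<in> Q" for c b
    using hom that unfolding star_hom_def by blast
  note Q = cstarD[OF qiso_objectD(1)[OF o]]
  have "\<exists>h\<in>F. (\<Sum>k<n. T h k * \<phi> (u k j) x y) \<noteq> 0"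
  proof (rule ccontr)
    assume "\<not> ?thesis"
    then have "\<phi> (u i j) x y = 0"
      using nz i by (intro intertwiner_injective[OF irrepsD(1)[OF u] T, of h0 k0 "\<lambda>k. \<phi> (u k j) x y"]) auto
    then show False using ne by simp
  qed
  then obtain h where h: "h \<in> F" "(\<Sum>k<n. T h k * \<phi> (u k j) x y) \<noteq> 0" by blast
  have uQ: "u k j \<in> Q" if "k < n" for k using irrepsD(3)[OF u that] j by simp
  have "(\<Sum>k<n. opr_scale (T h k) (\<phi> (u k j))) = \<phi> (\<Sum>k<n. opr_scale (T h k) (u k j))"
  proof -
    have "\<phi> (\<Sum>k<n. opr_scale (T h k) (u k j)) = (\<Sum>k<n. \<phi> (opr_scale (T h k) (u k j)))"
      by (rule opr_linear_on_sum[OF Q(5) lin finite_lessThan]) (simp add: opr.subspace_scale[OF Q(5)] uQ)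
    also have "\<dots> = (\<Sum>k<n. opr_scale (T h k) (\<phi> (u k j)))" by (intro sum.cong refl scale uQ) simp
    finally show ?thesis ..
  qed
  also have "(\<Sum>k<n. opr_scale (T h k) (u k j)) = (\<Sum>g\<in>F. opr_scale (T g j) (action_coeff \<alpha> h g))"
    using T h(1) j unfolding intertwiner_iff[symmetric] intertwiner_def by blast
  also have "\<phi> \<dots> = (\<Sum>g\<in>F. \<phi> (opr_scale (T g j) (action_coeff \<alpha> h g)))"
    by (rule opr_linear_on_sum[OF Q(5) lin F]) (intro opr.subspace_scale[OF Q(5)] action_coeff_in[OF o])
  also have "\<dots> = (\<Sum>g\<in>F. opr_scale (T g j) (if h = g then perm_opr act g else 0))"
    by (intro sum.cong refl) (simp only: scale action_coeff_in[OF o] qiso_morphism_coeff[OF o a \<phi>])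
  finally have "(\<Sum>k<n. opr_scale (T h k) (\<phi> (u k j))) x y
    = (\<Sum>g\<in>F. opr_scale (T g j) (if h = g then perm_opr act g else 0)) x y" by (simp only:)
  then have "(\<Sum>g\<in>F. T g j * (if h = g then perm_opr act g else 0) x y) \<noteq> 0"
    using h(2) by (simp add: opr_sum_apply opr_scale_def)
  then obtain g where g: "g \<in> F" "T g j * (if h = g then perm_opr act g else 0) x y \<noteq> 0"
    by (meson sum.neutral)
  then have "perm_opr act g x y \<noteq> 0" by (auto split: if_splits)
  then have "x = act g y" by (simp add: perm_opr_def split: if_splits)
  then show "\<exists>g\<in>F. x = act g y" using g(1) by blast
qed

text \<open>A nonzero entry of the image at \<open>(x, y)\<close> determines \<open>g\<close> with \<open>x = g y\<close>, by freeness.\<close>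

lemma rep_supported_common:
  assumes a: "free_action act" and Q: "cstar_algebra Q" and \<phi>: "star_hom Q R \<phi>" and u: "(n, u) \<in> irreps Q \<Delta>"
    and F: "rep_supported \<phi> act F {..<n} u" and F': "rep_supported \<phi> act F' {..<n} u"
  shows "\<exists>g. g \<in> F \<and> g \<in> F'"
proof -
  obtain i j x y where ij: "i < n" "j < n" "\<phi> (u i j) x y \<noteq> 0" using irrep_image_nonzero[OF Q \<phi> u] by blast
  then obtain g g' where g: "g \<in> F" "x = act g y" and g': "g' \<in> F'" "x = act g' y"
    using F F' unfolding rep_supported_def supported_on_def by (meson lessThan_iff)
  then have "g = g'" using free_action_inj[OF a, of g y g'] by simp
  then show ?thesis using g g' by blast
qed

lemma trivial_irrep:
  assumes "cqg Q \<Delta>" shows "(1, \<lambda>_ _. opr_one) \<in> irreps Q \<Delta>"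
proof -
  have "cstar_algebra Q" "\<Delta> opr_one = opr_one" using assms unfolding cqg_def star_hom_def by blast+
  then have "unitary_rep Q \<Delta> {..<1 :: nat} (\<lambda>_ _. opr_one)"
    unfolding unitary_rep_def by (simp add: cstarD(3) opr_tensor_one lessThan_Suc)
  moreover have "(\<forall>i\<in>{..<1}. \<forall>j\<in>{..<1}. p i j = 0) \<or> (\<forall>i\<in>{..<1}. \<forall>j\<in>{..<1}. p i j = (if i = j then 1 else 0))"
    if "invariant_proj {..<1 :: nat} (\<lambda>_ _. opr_one) p" for p
  proof -
    have "p 0 0 * p 0 0 = p 0 0" using that unfolding invariant_proj_def by (simp add: lessThan_Suc)
    then have "p 0 0 = 0 \<or> p 0 0 = 1" by simp
    then show ?thesis by (auto simp: lessThan_Suc)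
  qed
  ultimately show ?thesis unfolding irreps_def irreducible_rep_def by auto
qed

lemma sum_squares_le_square_sum:
  fixes x :: "'c \<Rightarrow> real"
  assumes "finite C" "\<And>c. c \<in> C \<Longrightarrow> 0 \<le> x c" shows "(\<Sum>c\<in>C. (x c)\<^sup>2) \<le> (\<Sum>c\<in>C. x c)\<^sup>2"
proof -
  have "(\<Sum>c\<in>C. (x c)\<^sup>2) \<le> (\<Sum>c\<in>C. x c * (\<Sum>c\<in>C. x c))"
    unfolding power2_eq_square using assms by (intro sum_mono mult_left_mono member_le_sum) auto
  then show ?thesis by (simp add: power2_eq_square sum_distrib_right)
qed

text \<open>The morphism \<open>\<phi>\<close> is the restriction of functions to the quantum subgroup dual to \<open>\<Gamma>\<close>.\<close>

locale dual_restriction =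
  fixes S :: "'g::group_add set" and Q :: "'q opr set" and \<Delta> :: "'q opr \<Rightarrow> ('q \<times> 'q) opr"
    and \<alpha> :: "'g opr \<Rightarrow> ('g \<times> 'q) opr" and act :: "'g \<Rightarrow> 'q \<Rightarrow> 'q" and \<phi> :: "'q opr \<Rightarrow> 'q opr"
  assumes gen: "symmetric_generating_set S"
    and fin_ball: "\<And>N. finite {g. word_length S g \<le> N}"
    and obj: "qiso_object S Q \<Delta> \<alpha>"
    and full: "full_spectrum Q \<Delta> reduced_group_algebra \<alpha>"
    and act: "free_action act"
    and morph: "qiso_morphism Q \<Delta> \<alpha> (act_algebra act) (diag_hom act act) (diag_hom (+) act) \<phi>"
begin

lemma morph_star_hom: "star_hom Q (act_algebra act) \<phi>"
  using morph unfolding qiso_morphism_def cqg_morphism_def by blast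

lemma morph_linear: "opr_linear_on Q \<phi>"
  using morph_star_hom unfolding star_hom_def opr_linear_on_def by blast

lemmas cstar_Q = qiso_objectD(1)[OF obj]

lemmas subspace_Q = cstarD(5)[OF cstar_Q]

definition sphere :: "nat \<Rightarrow> 'g set" where
  "sphere r = {g. word_length S g = r}"

text \<open>Restricted to the dual of \<open>\<Gamma>\<close>, the representation is a sum of group elements of length \<open>r\<close>.\<close>

definition has_degree :: "'q rep \<Rightarrow> nat \<Rightarrow> bool" where
  "has_degree \<pi> r \<longleftrightarrow> rep_supported \<phi> act (sphere r) {..<fst \<pi>} (snd \<pi>)"

definition degree_of :: "'q rep \<Rightarrow> nat" where
  "degree_of \<pi> = (SOME r. has_degree \<pi> r)"

lemma has_degree_iff: "has_degree (n, u) r \<longleftrightarrow> rep_supported \<phi> act (sphere r) {..<n} u"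
  by (simp add: has_degree_def)

lemma has_degree_unique:
  assumes "\<pi> \<in> irreps Q \<Delta>" "has_degree \<pi> r" "has_degree \<pi> r'" shows "r = r'"
  using rep_supported_common[OF act cstar_Q morph_star_hom, of "fst \<pi>" "snd \<pi>" \<Delta>] assms
  by (auto simp: has_degree_def sphere_def)

text \<open>The rows of length \<open>word_length S h\<close> of the intertwiner already form a nonzero intertwiner.\<close>

lemma has_degree_of_coefficient:
  assumes u: "(n, u) \<in> irreps Q \<Delta>" and T: "T h k \<noteq> 0" "k < n"
    and int: "\<And>F. finite F \<Longrightarrow> sphere_saturated S F \<Longrightarrow> intertwines {..<n} u F (action_coeff \<alpha>) T"
  shows "has_degree (n, u) (word_length S h)"
proof -
  have fin: "finite (sphere r)" for r
    by (rule finite_subset[OF _ fin_ball[of r]]) (auto simp: sphere_def)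
  have sat: "sphere_saturated S (sphere r)" for r by (simp add: sphere_saturated_def sphere_def)
  show ?thesis unfolding has_degree_iff
    by (rule irrep_supported_on_sphere[OF obj act morph u fin int[OF fin sat] _ T(2,1)]) (simp add: sphere_def)
qed

lemma has_degree_exists:
  assumes "\<pi> \<in> irreps Q \<Delta>" shows "\<exists>r. has_degree \<pi> r"
proof -
  obtain n u where nu: "\<pi> = (n, u)" by (cases \<pi>)
  note u = assms[unfolded nu]
  obtain T where T: "\<exists>h. \<exists>k<n. T h k \<noteq> 0"
    and int: "\<And>F. finite F \<Longrightarrow> sphere_saturated S F \<Longrightarrow> intertwines {..<n} u F (action_coeff \<alpha>) T"
    by (rule full_spectrum_intertwiner[OF obj full u]) blast
  then obtain h k where "k < n" "T h k \<noteq> 0" by blast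
  then show ?thesis unfolding nu using has_degree_of_coefficient[OF u _ _ int] by blast
qed

lemma degree_of: "\<pi> \<in> irreps Q \<Delta> \<Longrightarrow> has_degree \<pi> (degree_of \<pi>)"
  unfolding degree_of_def by (rule someI_ex[OF has_degree_exists])

lemma degree_of_eq: "\<pi> \<in> irreps Q \<Delta> \<Longrightarrow> has_degree \<pi> r \<Longrightarrow> degree_of \<pi> = r"
  by (rule has_degree_unique[OF _ degree_of])

lemma degree_of_equiv:
  assumes "(\<pi>, \<rho>) \<in> irrep_rel Q \<Delta>" shows "degree_of \<rho> = degree_of \<pi>"
proof -
  obtain n u m v where nm: "\<pi> = (n, u)" "\<rho> = (m, v)" by (cases \<pi>, cases \<rho>)
  have *: "(n, u) \<in> irreps Q \<Delta>" "(m, v) \<in> irreps Q \<Delta>" "rep_equiv {..<n} u {..<m} v"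
    using assms unfolding nm irrep_rel_def by auto
  have "rep_supported \<phi> act (sphere (degree_of \<pi>)) {..<m} v"
    by (rule rep_supported_equiv[OF subspace_Q morph_linear _ _ rep_equiv_sym[OF _ _ *(3)]])
       (use degree_of[of \<pi>] * irrepsD(3)[OF *(1)] in \<open>auto simp: nm has_degree_iff\<close>)
  then show ?thesis using * by (intro degree_of_eq) (auto simp: nm has_degree_iff)
qed

lemma degree_of_trivial: "degree_of (1, \<lambda>_ _. opr_one) = 0"
proof (rule degree_of_eq)
  show "(1, \<lambda>_ _. opr_one) \<in> irreps Q \<Delta>"
    by (rule trivial_irrep) (use obj in \<open>auto simp: qiso_object_def\<close>)
  have "\<phi> opr_one = opr_one" using morph_star_hom unfolding star_hom_def by blast
  then show "has_degree (1, \<lambda>_ _. opr_one) 0"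
    by (auto simp: has_degree_iff rep_supported_def supported_on_def sphere_def opr_one_def
        free_actionD(1)[OF act] word_length_zero intro!: exI[of _ 0] split: if_splits)
qed

text \<open>The conjugate restricts to the inverses, which have the same lengths.\<close>

lemma degree_of_conj:
  assumes u: "(n, u) \<in> irreps Q \<Delta>" and v: "(m, v) \<in> irreps Q \<Delta>"
    and e: "rep_equiv {..<m} v {..<n} (rep_conj u)"
  shows "degree_of (m, v) = degree_of (n, u)"
proof -
  let ?G = "sphere (degree_of (n, u))"
  have su: "rep_supported \<phi> act ?G {..<n} u" using degree_of[OF u] by (simp add: has_degree_iff)
  have "rep_supported \<phi> act ?G {..<n} (rep_conj u)"
    unfolding rep_supported_def
  proof (intro ballI)
    fix i j assume ij: "i \<in> {..<n}" "j \<in> {..<n}"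
    have "supported_on act (uminus ` ?G) (opr_adj (\<phi> (u i j)))"
      using su ij unfolding rep_supported_def by (intro supported_on_adj[OF act]) blast
    moreover have "opr_adj (\<phi> (u i j)) = \<phi> (rep_conj u i j)"
      using morph_star_hom irrepsD(3)[OF u] ij unfolding rep_conj_def star_hom_def by simp
    moreover have "uminus ` ?G \<subseteq> ?G" by (auto simp: sphere_def word_length_minus[OF gen])
    ultimately show "supported_on act ?G (\<phi> (rep_conj u i j))" using supported_on_mono by metis
  qed
  then have "rep_supported \<phi> act ?G {..<m} v"
    by (intro rep_supported_equiv[OF subspace_Q morph_linear finite_lessThan finite_lessThan e])
       (auto simp: rep_conj_def irrepsD(3)[OF u] star_closedD(7)[OF cstarD(1)[OF cstar_Q]])
  then show ?thesis by (intro degree_of_eq[OF v]) (simp add: has_degree_iff)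
qed

text \<open>The tensor product restricts to products \<open>g + h\<close> of elements of the two spheres. Some product of this kind
  occurs in the restriction of \<open>w\<close> as well, and its length is the degree of \<open>w\<close>.\<close>

lemma degree_of_tensor:
  assumes u: "(n, u) \<in> irreps Q \<Delta>" and v: "(m, v) \<in> irreps Q \<Delta>" and w: "(k, w) \<in> irreps Q \<Delta>"
    and s: "subrep {..<k} w ({..<n} \<times> {..<m}) (rep_tensor u v)"
  shows "degree_of (k, w) \<le> degree_of (n, u) + degree_of (m, v)"
proof -
  have su: "rep_supported \<phi> act (sphere (degree_of (n, u))) {..<n} u"
    and sv: "rep_supported \<phi> act (sphere (degree_of (m, v))) {..<m} v"
    and sw: "rep_supported \<phi> act (sphere (degree_of (k, w))) {..<k} w"
    using degree_of[OF u] degree_of[OF v] degree_of[OF w] by (simp_all add: has_degree_iff)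
  let ?F = "{g + h | g h. g \<in> sphere (degree_of (n, u)) \<and> h \<in> sphere (degree_of (m, v))}"
  obtain T where T: "intertwiner {..<k} w ({..<n} \<times> {..<m}) (rep_tensor u v) T"
    and iso: "\<And>i i'. i \<in> {..<k} \<Longrightarrow> i' \<in> {..<k} \<Longrightarrow>
       (\<Sum>j\<in>{..<n} \<times> {..<m}. cnj (T j i) * T j i') = (if i = i' then 1 else 0)"
    using s unfolding subrep_def by blast
  have uv: "u i j \<in> Q" "v i' j' \<in> Q" if "i < n" "j < n" "i' < m" "j' < m" for i j i' j'
    using irrepsD(3)[OF u] irrepsD(3)[OF v] that by blast+
  have "rep_supported \<phi> act ?F {..<k} w"
  proof (rule rep_supported_left_inverse[OF subspace_Q morph_linear _ _ T iso])
    show "rep_tensor u v p q \<in> Q" if "p \<in> {..<n} \<times> {..<m}" "q \<in> {..<n} \<times> {..<m}" for p q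
      using that uv by (auto simp: rep_tensor_def star_closedD(6)[OF cstarD(1)[OF cstar_Q]])
    show "rep_supported \<phi> act ?F ({..<n} \<times> {..<m}) (rep_tensor u v)"
      unfolding rep_supported_def
    proof (intro ballI)
      fix p q assume "p \<in> {..<n} \<times> {..<m}" "q \<in> {..<n} \<times> {..<m}"
      then obtain i i' j j' where pq: "p = (i, i')" "q = (j, j')" "i < n" "j < n" "i' < m" "j' < m" by auto
      have "\<phi> (rep_tensor u v p q) = opr_mult (\<phi> (u i j)) (\<phi> (v i' j'))"
        using morph_star_hom uv[OF pq(3-6)] unfolding pq(1,2) rep_tensor_def star_hom_def by simp
      moreover have "supported_on act ?F (opr_mult (\<phi> (u i j)) (\<phi> (v i' j')))"
        using su sv pq(3-6) unfolding rep_supported_def by (intro supported_on_mult[OF act]) auto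
      ultimately show "supported_on act ?F (\<phi> (rep_tensor u v p q))" by (simp only:)
    qed
  qed auto
  with sw obtain f where "f \<in> ?F" "f \<in> sphere (degree_of (k, w))"
    using rep_supported_common[OF act cstar_Q morph_star_hom w] by blast
  then obtain g h where "word_length S (g + h) = degree_of (k, w)" "word_length S g = degree_of (n, u)"
    "word_length S h = degree_of (m, v)" by (auto simp: sphere_def)
  then show ?thesis using word_length_add[OF gen, of g h] by simp
qed

text \<open>The representative whose dimension is \<open>class_dim\<close>.\<close>

definition class_rep :: "'q rep set \<Rightarrow> 'q rep" where
  "class_rep c = (SOME \<pi>. \<pi> \<in> c)"

lemma class_rep:
  assumes c: "c \<in> irr_classes Q \<Delta>" shows "class_rep c \<in> c" "class_rep c \<in> irreps Q \<Delta>"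
proof -
  have "c \<noteq> {}" using in_quotient_imp_non_empty[OF equiv_irrep_rel c[unfolded irr_classes_def]] .
  then show "class_rep c \<in> c" unfolding class_rep_def by (simp add: some_in_eq)
  then show "class_rep c \<in> irreps Q \<Delta>"
    using in_quotient_imp_subset[OF equiv_irrep_rel c[unfolded irr_classes_def]] by blast
qed

lemma class_dim_eq: "class_dim c = fst (class_rep c)"
  by (simp add: class_dim_def class_rep_def)

lemma class_rep_inequivalent:
  assumes c: "c \<in> irr_classes Q \<Delta>" "c' \<in> irr_classes Q \<Delta>" "c \<noteq> c'"
  shows "\<not> rep_equiv {..<fst (class_rep c)} (snd (class_rep c)) {..<fst (class_rep c')} (snd (class_rep c'))"
proof
  assume "rep_equiv {..<fst (class_rep c)} (snd (class_rep c)) {..<fst (class_rep c')} (snd (class_rep c'))"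
  then have "(class_rep c, class_rep c') \<in> irrep_rel Q \<Delta>"
    using class_rep(2)[OF c(1)] class_rep(2)[OF c(2)] unfolding irrep_rel_def by (simp add: case_prod_beta)
  from quotient_eqI[OF equiv_irrep_rel _ _ class_rep(1)[OF c(1)] class_rep(1)[OF c(2)] this] c
  show False by (simp add: irr_classes_def)
qed

definition class_length :: "'q rep set \<Rightarrow> real" where
  "class_length c = real (degree_of (class_rep c))"

lemma class_length_eq:
  assumes \<pi>: "\<pi> \<in> irreps Q \<Delta>" shows "class_length (irr_class Q \<Delta> \<pi>) = real (degree_of \<pi>)"
proof -
  have "irr_class Q \<Delta> \<pi> \<in> irr_classes Q \<Delta>"
    unfolding irr_class_def irr_classes_def by (rule quotientI[OF \<pi>])
  from class_rep(1)[OF this] have "(\<pi>, class_rep (irr_class Q \<Delta> \<pi>)) \<in> irrep_rel Q \<Delta>"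
    unfolding irr_class_def by blast
  from degree_of_equiv[OF this] show ?thesis unfolding class_length_def by simp
qed

lemma central_length_class_length: "central_length Q \<Delta> class_length"
proof -
  have triv: "(1, \<lambda>_ _. opr_one) \<in> irreps Q \<Delta>"
    by (rule trivial_irrep) (use obj in \<open>auto simp: qiso_object_def\<close>)
  have 1: "class_length (irr_class Q \<Delta> (1, \<lambda>_ _. opr_one)) = 0"
    unfolding class_length_eq[OF triv] degree_of_trivial by simp
  have 2: "class_length (irr_class Q \<Delta> (m, v)) = class_length (irr_class Q \<Delta> (n, u))"
    if "(n, u) \<in> irreps Q \<Delta>" "(m, v) \<in> irreps Q \<Delta>" "rep_equiv {..<m} v {..<n} (rep_conj u)" for n u m v
    unfolding class_length_eq[OF that(1)] class_length_eq[OF that(2)] degree_of_conj[OF that] ..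
  have 3: "class_length (irr_class Q \<Delta> (k, w)) \<le> class_length (irr_class Q \<Delta> (n, u)) + class_length (irr_class Q \<Delta> (m, v))"
    if "(n, u) \<in> irreps Q \<Delta>" "(m, v) \<in> irreps Q \<Delta>" "(k, w) \<in> irreps Q \<Delta>"
      "subrep {..<k} w ({..<n} \<times> {..<m}) (rep_tensor u v)" for n u m v k w
    using degree_of_tensor[OF that]
    unfolding class_length_eq[OF that(1)] class_length_eq[OF that(2)] class_length_eq[OF that(3)] by linarith
  have "0 \<le> class_length c" for c by (simp add: class_length_def)
  with 1 2 3 show ?thesis unfolding central_length_def by blast
qed

text \<open>By the uniqueness of the degree, the intertwiner into the span of the ball of radius \<open>N\<close> is
  nonzero for every class of length at most \<open>N\<close>.\<close>

lemma sum_class_dim_le: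
  assumes C: "finite C" "C \<subseteq> {c \<in> irr_classes Q \<Delta>. class_length c \<le> real N}"
  shows "(\<Sum>c\<in>C. class_dim c) \<le> card {g. word_length S g \<le> N}"
proof -
  let ?G = "{g. word_length S g \<le> N}"
  let ?d = "\<lambda>c. fst (class_rep c)" and ?U = "\<lambda>c. snd (class_rep c)"
  have cl: "c \<in> irr_classes Q \<Delta>" "degree_of (class_rep c) \<le> N" if "c \<in> C" for c
    using C(2) that by (auto simp: class_length_def)
  have irr: "(?d c, ?U c) \<in> irreps Q \<Delta>" if "c \<in> C" for c using class_rep(2)[OF cl(1)[OF that]] by simp
  have "\<exists>T. intertwines {..<?d c} (?U c) ?G (action_coeff \<alpha>) T \<and> (\<exists>g\<in>?G. \<exists>k<?d c. T g k \<noteq> 0)"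
    if c: "c \<in> C" for c
  proof -
    obtain T where T: "\<exists>h. \<exists>k<?d c. T h k \<noteq> 0"
      and int: "\<And>F. finite F \<Longrightarrow> sphere_saturated S F \<Longrightarrow> intertwines {..<?d c} (?U c) F (action_coeff \<alpha>) T"
      by (rule full_spectrum_intertwiner[OF obj full irr[OF c]]) blast
    then obtain h k where hk: "k < ?d c" "T h k \<noteq> 0" by blast
    have "has_degree (class_rep c) (word_length S h)"
      using has_degree_of_coefficient[OF irr[OF c] hk(2,1) int] by simp
    from degree_of_eq[OF class_rep(2)[OF cl(1)[OF c]] this] have "h \<in> ?G" using cl(2)[OF c] by simp
    moreover have "intertwines {..<?d c} (?U c) ?G (action_coeff \<alpha>) T"
      by (rule int[OF fin_ball]) (simp add: sphere_saturated_def)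
    ultimately show ?thesis using hk by blast
  qed
  then have "\<forall>c. \<exists>T. c \<in> C \<longrightarrow>
    intertwines {..<?d c} (?U c) ?G (action_coeff \<alpha>) T \<and> (\<exists>g\<in>?G. \<exists>k<?d c. T g k \<noteq> 0)" by blast
  from choice[OF this] obtain T where T: "\<forall>c. c \<in> C \<longrightarrow>
    intertwines {..<?d c} (?U c) ?G (action_coeff \<alpha>) (T c) \<and> (\<exists>g\<in>?G. \<exists>k<?d c. T c g k \<noteq> 0)" ..
  have "(\<Sum>c\<in>C. ?d c) \<le> card ?G"
  proof (rule inequivalent_irreducibles_dim_le[OF C(1) fin_ball, where U = ?U and T = T and q = "action_coeff \<alpha>"])
    fix c assume c: "c \<in> C"
    show "irreducible_rep Q \<Delta> {..<?d c} (?U c)" by (rule irrepsD(1)[OF irr[OF c]])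
    show "intertwines {..<?d c} (?U c) ?G (action_coeff \<alpha>) (T c)" using T c by blast
    show "\<exists>g\<in>?G. \<exists>k<?d c. T c g k \<noteq> 0" using T c by blast
    fix c' assume "c' \<in> C" and "c \<noteq> c'"
    then show "\<not> rep_equiv {..<?d c} (?U c) {..<?d c'} (?U c')" by (intro class_rep_inequivalent cl c)
  qed
  then show ?thesis by (simp add: class_dim_eq)
qed

text \<open>Every class contributes at least \<open>1\<close> to the bounded sum of dimensions.\<close>

lemma finite_class_length_le: "finite {c \<in> irr_classes Q \<Delta>. class_length c \<le> real N}"
proof (rule ccontr)
  assume "infinite {c \<in> irr_classes Q \<Delta>. class_length c \<le> real N}"
  from infinite_arbitrarily_large[OF this, of "Suc (card {g. word_length S g \<le> N})"]
  obtain C where C: "finite C" "card C = Suc (card {g. word_length S g \<le> N})"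
    "C \<subseteq> {c \<in> irr_classes Q \<Delta>. class_length c \<le> real N}" by blast
  have "1 \<le> class_dim c" if "c \<in> C" for c
    using irrepsD(2)[of "fst (class_rep c)" "snd (class_rep c)" Q \<Delta>] class_rep(2)[of c] C(3) that
    by (auto simp: class_dim_eq Suc_le_eq)
  then have "card C \<le> (\<Sum>c\<in>C. class_dim c)" using sum_mono[of C "\<lambda>_. 1" class_dim] by simp
  also have "\<dots> \<le> card {g. word_length S g \<le> N}" by (rule sum_class_dim_le[OF C(1,3)])
  finally show False using C(2) by simp
qed

end

theorem theorem2p29:
  fixes S :: "'g::group_add set"
    and Q :: "'q opr set"
    and \<Delta> :: "'q opr \<Rightarrow> ('q \<times> 'q) opr"
    and \<alpha> :: "'g opr \<Rightarrow> ('g \<times> 'q) opr"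
  assumes "infinite (UNIV :: 'q set)"
    and "finite S"
    and "symmetric_generating_set S"
    and "group_polynomial_growth S"
    and "is_QISO S Q \<Delta> \<alpha>"
    and "full_spectrum Q \<Delta> (reduced_group_algebra :: 'g opr set) \<alpha>"
  shows "dual_polynomial_growth Q \<Delta>"
proof -
  obtain act :: "'g \<Rightarrow> 'q \<Rightarrow> 'q" where act: "free_action act"
    by (rule free_action_exists[OF assms(1-3)])
  obtain P :: "real poly" where P: "\<And>N. finite {g. word_length S g \<le> N}"
    "\<And>N. real (card {g. word_length S g \<le> N}) \<le> poly P (real N)"
    using assms(4) unfolding group_polynomial_growth_def by blast
  have obj: "qiso_object S Q \<Delta> \<alpha>" using assms(5) unfolding is_QISO_def by blast
  obtain \<phi> where \<phi>: "qiso_morphism Q \<Delta> \<alpha> (act_algebra act) (diag_hom act act) (diag_hom (+) act) \<phi>"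
    using assms(5) qiso_object_act_algebra[OF act, of S] unfolding is_QISO_def by blast
  interpret dual_restriction S Q \<Delta> \<alpha> act \<phi>
    by unfold_locales (fact assms P(1) obj act \<phi>)+
  have "(\<Sum>c | c \<in> irr_classes Q \<Delta> \<and> class_length c \<le> real N. (real (class_dim c))\<^sup>2) \<le> poly (P * P) (real N)" for N
  proof -
    let ?C = "{c \<in> irr_classes Q \<Delta>. class_length c \<le> real N}"
    have "(\<Sum>c\<in>?C. (real (class_dim c))\<^sup>2) \<le> (\<Sum>c\<in>?C. real (class_dim c))\<^sup>2"
      by (rule sum_squares_le_square_sum[OF finite_class_length_le]) simp
    also have "\<dots> \<le> (poly P (real N))\<^sup>2"
    proof (rule power_mono)
      have "(\<Sum>c\<in>?C. real (class_dim c)) = real (\<Sum>c\<in>?C. class_dim c)" by simp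
      also have "\<dots> \<le> real (card {g. word_length S g \<le> N})"
        using sum_class_dim_le[OF finite_class_length_le order_refl, of N] by (simp only: of_nat_le_iff)
      also have "\<dots> \<le> poly P (real N)" by (rule P(2))
      finally show "(\<Sum>c\<in>?C. real (class_dim c)) \<le> poly P (real N)" .
    qed (simp add: sum_nonneg)
    finally show ?thesis by (simp add: power2_eq_square)
  qed
  then show ?thesis
    unfolding dual_polynomial_growth_def using central_length_class_length finite_class_length_le by blast
qed

end
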